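(* Let $P, Q$ be (non-random) Borel probability measures on $\mathbb{R}^d$, let $\pi \in \Pi(P,Q)$ be the only element of $\Pi(P,Q)$ with cyclically monotone support, and let $T \in \mathcal{F}(\mathbb{R}^d\times\mathbb{R}^d)$ be a maximal cyclically monotone set with $\operatorname{spt}\pi \subset T$. Write $V = \operatorname{int}(\operatorname{spt} P)$ and assume $V \ne \emptyset$. For $n \ge 1$ let $(P_n, Q_n, \pi_n, T_n)$ be random elements of $\mathcal{P}(\mathbb{R}^d) \times \mathcal{P}(\mathbb{R}^d) \times \mathcal{P}(\mathbb{R}^d\times\mathbb{R}^d) \times \mathcal{F}(\mathbb{R}^d\times\mathbb{R}^d)$ such that, with probability one, $\pi_n \in \Pi(P_n,Q_n)$, $T_n$ is maximal cyclically monotone, and $\operatorname{spt}\pi_n \subset T_n$. Let "mode" stand for either "almost surely" or "in distribution" (the same throughout), and suppose that $P_n \to P$ and $Q_n \to Q$ in $\mathcal{P}(\mathbb{R}^d)$ in the given mode as $n \to \infty$. An eventual property ("for all large $n$") is said to hold in the mode if: almost surely, it holds for all large $n$ (almost sure mode); or its probability tends to one as $n\to\infty$ (in-distribution mode). Then: (a) $V \subset \operatorname{dom} T$, and $\pi_n \to \pi$ in $\mathcal{P}(\mathbb{R}^d\times\mathbb{R}^d)$ and $T_n|_V \to T|_V$ in $\mathcal{F}(V\times\mathbb{R}^d)$ in the given mode. In particular, for any compact $K \subset V\times\mathbb{R}^d$ with $T\cap K=\emptyset$, the property $T_n\cap K=\emptyset$ holds for all large $n$ in the given mode, and for any open $G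 \subset V\times\mathbb{R}^d$ with $T\cap G\neq\emptyset$, the property $T_n \cap G\neq\emptyset$ holds for all large $n$ in the given mode. (b) For any compact $K\subset V$, the property that $K\subset\operatorname{int}(\operatorname{dom}T_n)$ (and thus $T_n(K)$ is compact) holds for all large $n$ in the given mode. If $T$ is single-valued on $\partial K$, then $d_H(T_n(K),T(K))\to 0$ in the given mode. If $T$ is single-valued on the whole of $K$, then $\sup_{x\in K}\sup_{y\in T_n(x)}|y-T(x)|\to 0$ in the given mode. In particular, if $P(W)=1$ for some Borel set $W\subset V$ on which $T$ is single-valued, then for $P$-almost every $x\in\mathbb{R}^d$, the property $T_n(x)\neq\emptyset$ holds for all large $n$ in the given mode and $\sup_{y\in T_n(x)}|y-T(x)|\to 0$ in the given mode. (c) Assume that $\operatorname{rge}T$ is bounded, that there exists an open set $U\subset\operatorname{spt}P$ such that $T(U)\subset\operatorname{int}(\operatorname{rge}T)$ and $\operatorname{rge}T\subset\operatorname{cl}(T(U))$, and that, for every $n$, $\operatorname{rge}T_n\subset\operatorname{cl}(\operatorname{rge}T)$ with probability one. Then $\operatorname{dom}T=\mathbb{R}^d$, the property $\operatorname{dom}T_n=\mathbb{R}^d$ holds for all large $n$ in the given mode, and $T_n\to T$ in $\mathcal{F}(\mathbb{R}^d\times\mathbb{R}^d)$ in the given mode. (d) If, in addition to the conditions in (c), $T$ is single-valued on the closure of an $F_\sigma$-set $E\subset\mathbb{R}^d$ that recedes only in directions in which the (necessarily convex) set $\operatorname{cl}(\operatorname{rge}T)$ is strictly convex, then the double supremum $\sup_{x\in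 E}\sup_{y\in T_n(x)}|y-T(x)|$ is a random variable and converges to $0$ in the given mode as $n\to\infty$.
   Context: $\mathcal{P}(\mathbb{R}^m)$ is the space of Borel probability measures on $\mathbb{R}^m$ with the weak topology and its Borel $\sigma$-field. For Borel probability measures $P,Q$ on $\mathbb{R}^d$, $\Pi(P,Q)$ is the set of Borel probability measures on $\mathbb{R}^d \times \mathbb{R}^d$ with first margin $P$ and second margin $Q$. The support $\operatorname{spt}\mu$ of a probability measure $\mu$ is the set of points all of whose open neighbourhoods have positive $\mu$-mass. For a locally compact Hausdorff second countable space $\mathbb{E}$, $\mathcal{F}(\mathbb{E})$ is the set of all closed subsets of $\mathbb{E}$ (including $\emptyset$), equipped with the Fell topology, i.e. the topology generated by the collections $\{F : F \cap G \ne \emptyset\}$ for open $G \subset \mathbb{E}$ and $\{F : F \cap K = \emptyset\}$ for compact $K \subset \mathbb{E}$, and with the corresponding Borel $\sigma$-field (this topology is compact metrizable). A random element of a topological space is a Borel measurable map from a probability space into it (in the almost sure mode all random elements live on a common probability space). Convergence in distribution to a non-random limit means weak convergence of the laws to the point mass at the limit. A set $T \subset \mathbb{R}^d \times \mathbb{R}^d$ is identified with the multivalued mapping $T(x) = \{y : (x,y) \in T\}$; $T(A) = \bigcup_{x \in A} T(x)$, $\operatorname{dom} T = \{x : T(x) \neq \emptyset\}$, $\operatorname{rge} T = T(\mathbb{R}^d)$. $T$ is single-valued at $x$ if $T(x)$ is a singleton, in which case $T(x)$ also denotes its unique element; it is single-valued on a set if it is so at each of its points. For non-empty $V \subset \mathbb{R}^d$,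 $T|_V = T \cap (V \times \mathbb{R}^d)$; if $V$ is open and $T$ closed, it is regarded as an element of $\mathcal{F}(V \times \mathbb{R}^d)$. $T$ is cyclically monotone if for every integer $m \ge 1$ and all $(x_1,y_1),\dots,(x_m,y_m) \in T$ we have $\sum_{i=1}^m \langle x_i, y_i\rangle \ge \sum_{i=1}^m \langle x_i, y_{i+1}\rangle$ with $y_{m+1} := y_1$; it is maximal cyclically monotone if it is cyclically monotone and not properly contained in another cyclically monotone subset of $\mathbb{R}^d\times\mathbb{R}^d$. $|\cdot|$ is the Euclidean norm. For $A,B \subset \mathbb{R}^d$, $d_H(A,B) = \max\{\sup_{a\in A} d(a,B), \sup_{b \in B} d(b,A)\}$, where $d(x,Y) = \inf_{y\in Y}|x-y|$ and $d(x,\emptyset)=\infty$; suprema are taken in $[0,\infty]$. A set $E \subset \mathbb{R}^d$ recedes in direction $u$ (with $|u|=1$) if there exist $x_n \in E$ with $|x_n| \to \infty$ and $x_n/|x_n| \to u$. A non-empty compact convex set $C \subset \mathbb{R}^d$ is strictly convex in direction $u$ if $\arg\max_{c \in C} \langle c, u\rangle$ is a singleton. An $F_\sigma$-set is a countable union of closed sets. *)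

theory Defs
  imports "HOL-Probability.Probability"
begin

section \<open>Spaces of probability measures and of closed sets\<close>

definition borel_of :: "'x topology \<Rightarrow> 'x measure" where
  "borel_of X = sigma (topspace X) {U. openin X U}"

definition prob_measures :: "'x topology \<Rightarrow> 'x measure set" where
  "prob_measures X = {\<mu>. prob_space \<mu> \<and> sets \<mu> = sets (borel_of X)}"

text \<open>The coarsest topology on the Borel probability measures on \<open>X\<close> for which all maps
  \<open>\<mu> \<mapsto> \<integral>f d\<mu>\<close>, with \<open>f\<close> bounded and continuous, are continuous.\<close>

definition weak_topology :: "'x topology \<Rightarrow> 'x measure topology" where
  "weak_topology X = topology_generated_by
     {{\<mu> \<in> prob_measures X. integral\<^sup>L \<mu> f \<in> U} | f U.
        continuous_map X euclideanreal f \<and> bounded (f ` topspace X) \<and> open U}"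

definition fell_topology :: "'x topology \<Rightarrow> 'x set topology" where
  "fell_topology X = topology_generated_by
     ({{F. closedin X F \<and> F \<inter> G \<noteq> {}} | G. openin X G} \<union>
      {{F. closedin X F \<and> F \<inter> K = {}} | K. compactin X K})"

lemma borel_of_euclidean: "borel_of euclidean = borel"
  by (simp add: borel_of_def borel_def)

lemma topspace_weak_topology: "topspace (weak_topology X) = prob_measures X"
proof -
  let ?S = "{{\<mu> \<in> prob_measures X. integral\<^sup>L \<mu> f \<in> U} | f U.
        continuous_map X euclideanreal f \<and> bounded (f ` topspace X) \<and> open U}"
  have "prob_measures X = {\<mu> \<in> prob_measures X. integral\<^sup>L \<mu> (\<lambda>x. 0) \<in> (UNIV :: real set)}"
    by simp
  moreover have "continuous_map X euclideanreal (\<lambda>x. 0)" "bounded ((\<lambda>x. 0::real) ` topspace X)"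
    by (auto simp: image_constant_conv)
  ultimately have "prob_measures X \<in> ?S"
    using open_UNIV by blast
  then have "\<Union> ?S = prob_measures X"
    by auto
  then show ?thesis
    by (simp add: weak_topology_def)
qed

lemma topspace_fell_topology: "topspace (fell_topology X) = {F. closedin X F}"
proof -
  let ?S = "{{F. closedin X F \<and> F \<inter> G \<noteq> {}} | G. openin X G} \<union>
      {{F. closedin X F \<and> F \<inter> K = {}} | K. compactin X K}"
  have "{F. closedin X F} = {F. closedin X F \<and> F \<inter> {} = {}}"
    by simp
  then have "{F. closedin X F} \<in> ?S"
    using compactin_empty[of X] by blast
  then have "\<Union> ?S = {F. closedin X F}"
    by auto
  then show ?thesis
    by (simp add: fell_topology_def)
qed

section \<open>Modes of convergence\<close>

datatype mode = Almost_Surely | In_Distribution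

text \<open>The \<open>n\<close>-th random element lives on the probability space \<open>M n\<close>. In the almost sure mode
  these spaces are assumed to coincide, and the common space is referred to as \<open>M 0\<close>. Convergence
  in either mode includes the requirement that the objects involved be random elements.\<close>

definition converges ::
  "mode \<Rightarrow> (nat \<Rightarrow> 'w measure) \<Rightarrow> 'x topology \<Rightarrow> (nat \<Rightarrow> 'w \<Rightarrow> 'x) \<Rightarrow> 'x \<Rightarrow> bool" where
  "converges m M X Y L \<longleftrightarrow>
     (\<forall>n. Y n \<in> M n \<rightarrow>\<^sub>M borel_of X) \<and> L \<in> topspace X \<and>
     (case m of
        Almost_Surely \<Rightarrow> AE \<omega> in M 0. limitin X (\<lambda>n. Y n \<omega>) L sequentially
      | In_Distribution \<Rightarrow>
          limitin (weak_topology X) (\<lambda>n. distr (M n) (borel_of X) (Y n))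
            (return (borel_of X) L) sequentially)"

text \<open>A property \<open>R n \<omega>\<close> that holds for all large \<open>n\<close> in the given mode. The completion is used
  because some properties of interest are measurable only up to a null set (they coincide with a
  measurable event on the event of probability one on which the standing assumptions hold).
  Non-measurable sets have measure 0, so convergence to 1 entails measurability for large \<open>n\<close>.\<close>

definition holds_eventually ::
  "mode \<Rightarrow> (nat \<Rightarrow> 'w measure) \<Rightarrow> (nat \<Rightarrow> 'w \<Rightarrow> bool) \<Rightarrow> bool" where
  "holds_eventually m M R \<longleftrightarrow>
     (case m of
        Almost_Surely \<Rightarrow> AE \<omega> in M 0. \<forall>\<^sub>F n in sequentially. R n \<omega>
      | In_Distribution \<Rightarrow>
          (\<lambda>n. measure (completion (M n)) {\<omega> \<in> space (M n). R n \<omega>}) \<longlonglongrightarrow> 1)"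

section \<open>Couplings and supports\<close>

definition couplings ::
  "'a::topological_space measure \<Rightarrow> 'a measure \<Rightarrow> ('a \<times> 'a) measure set" where
  "couplings P Q =
     {\<pi> \<in> prob_measures euclidean. distr \<pi> borel fst = P \<and> distr \<pi> borel snd = Q}"

definition spt :: "'a::topological_space measure \<Rightarrow> 'a set" where
  "spt \<mu> = {x. \<forall>U. open U \<and> x \<in> U \<longrightarrow> emeasure \<mu> U > 0}"

section \<open>Multivalued mappings\<close>

text \<open>A multivalued mapping is identified with its graph, a relation; thus \<open>T(x)\<close> is \<open>T `` {x}\<close>,
  and \<open>dom T\<close> and \<open>rge T\<close> are \<open>Domain T\<close> and \<open>Range T\<close>.\<close>

definition cyclically_monotone :: "('a::real_inner \<times> 'a) set \<Rightarrow> bool" where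
  "cyclically_monotone T \<longleftrightarrow>
     (\<forall>m\<ge>1. \<forall>x y. (\<forall>i<m. (x i, y i) \<in> T) \<longrightarrow>
        (\<Sum>i<m. x i \<bullet> y i) \<ge> (\<Sum>i<m. x i \<bullet> y (Suc i mod m)))"

definition maximal_cyclically_monotone :: "('a::real_inner \<times> 'a) set \<Rightarrow> bool" where
  "maximal_cyclically_monotone T \<longleftrightarrow>
     cyclically_monotone T \<and> \<not> (\<exists>S. cyclically_monotone S \<and> T \<subset> S)"

definition single_valued_at :: "('a \<times> 'b) set \<Rightarrow> 'a \<Rightarrow> bool" where
  "single_valued_at T x \<longleftrightarrow> is_singleton (T `` {x})"

text \<open>The value \<open>T(x)\<close> as a point; only meaningful where \<open>T\<close> is single-valued.\<close>

definition val :: "('a \<times> 'b) set \<Rightarrow> 'a \<Rightarrow> 'b" where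
  "val T x = the_elem (T `` {x})"

text \<open>The double supremum of \<open>|y - T(x)|\<close> over \<open>x \<in> A\<close> and \<open>y \<in> S(x)\<close>, in \<open>[0,\<infinity>]\<close>.\<close>

definition sup_deviation ::
  "('a \<times> 'b::real_normed_vector) set \<Rightarrow> ('a \<times> 'b) set \<Rightarrow> 'a set \<Rightarrow> ennreal" where
  "sup_deviation S T A = (\<Squnion>x\<in>A. \<Squnion>y\<in>S `` {x}. ennreal (norm (y - val T x)))"

text \<open>Unlike the library's \<^const>\<open>infdist\<close>, the distance to the empty set is \<open>\<infinity>\<close>.\<close>

definition dist_to :: "'a::metric_space \<Rightarrow> 'a set \<Rightarrow> ennreal" where
  "dist_to x Y = (\<Sqinter>y\<in>Y. ennreal (dist x y))"

definition hausdorff_dist :: "'a::metric_space set \<Rightarrow> 'a set \<Rightarrow> ennreal" where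
  "hausdorff_dist A B = max (\<Squnion>a\<in>A. dist_to a B) (\<Squnion>b\<in>B. dist_to b A)"

definition recedes_in_direction :: "'a::real_normed_vector set \<Rightarrow> 'a \<Rightarrow> bool" where
  "recedes_in_direction E u \<longleftrightarrow>
     (\<exists>x :: nat \<Rightarrow> 'a. (\<forall>n. x n \<in> E) \<and> filterlim (\<lambda>n. norm (x n)) at_top sequentially \<and>
        (\<lambda>n. x n /\<^sub>R norm (x n)) \<longlonglongrightarrow> u)"

definition strictly_convex_in_direction :: "'a::real_inner set \<Rightarrow> 'a \<Rightarrow> bool" where
  "strictly_convex_in_direction C u \<longleftrightarrow>
     is_singleton {c. is_arg_max (\<lambda>c. c \<bullet> u) (\<lambda>c. c \<in> C) c}"

end

theory Submission
  imports Defs "HOL-Library.Diagonal_Subsequence"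
begin

text \<open>By Rockafellar's theorem a maximal cyclically monotone set \<open>T\<close> is the subdifferential of a
  supremum of affine functions, so minimising \<open>f u + |u - z|\<^sup>2 / (2 t)\<close> shows Minty's property: every
  \<open>z\<close> is, for every \<open>t > 0\<close>, of the form \<open>x + t y\<close> with \<open>(x, y) \<in> T\<close>. For monotone sets this property entails maximality
  and passes to inverses and to Kuratowski limits, and it replaces all further convex analysis.

  By tightness, from every subsequence one extracts a further one along which \<open>\<pi>\<^sub>n\<close> converges weakly to a
  coupling of \<open>P\<close> and \<open>Q\<close> and \<open>T\<^sub>n\<close> converges to some \<open>L\<close> containing its support. Uniqueness identifies
  the coupling as \<open>\<pi>\<close>, so \<open>L\<close> and \<open>T\<close> are Minty sets containing \<open>spt \<pi>\<close>, whose domain is dense in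
  \<open>V\<close>; such sets coincide over \<open>V\<close>. Under the conditions of (c) the same argument for the inverses
  gives equality over the interior of \<open>Range T\<close>, hence everywhere. In distribution, arguing by contradiction turns
  the statements about deterministic sequences into statements about neighbourhoods of \<open>(P, Q)\<close> that
  are defined by finitely many test functions.\<close>

section \<open>Maximal cyclically monotone sets\<close>

text \<open>Maximality is hard to recognise in a limit, whereas the solutions of
  \<open>x + t y = z\<close> along a sequence stay bounded because resolvents are nonexpansive; this
  is why Minty's property survives. Cyclic monotonicity of a limit serves to bring in the uniqueness
  of \<open>\<pi>\<close>; two Minty sets are compared by monotonicity alone. The domain of
  \<open>spt \<pi>\<close> is merely dense in \<open>V\<close>, so points and bounds are drawn from
  finite sets that surround a point. Such configurations survive small displacements, which makes
  the estimates uniform along a sequence and on compact sets. Compactness of tight sequences on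
  Euclidean space is reduced to Helly's selection theorem on the real line by a Borel coding with a
  continuous left inverse. In distribution the samples live on unrelated probability spaces, so no
  path can be followed. The counterexample sequence is assembled from arbitrary quadruples of
  measures and sets instead; for this the hypotheses on one sample form a deterministic predicate,
  and the margins are controlled by countably many test functions.\<close>

definition monotone_graph :: "('a::real_inner \<times> 'a) set \<Rightarrow> bool" where
  "monotone_graph T \<longleftrightarrow>
     (\<forall>x y a b. (x, y) \<in> T \<longrightarrow> (a, b) \<in> T \<longrightarrow> (x - a) \<bullet> (y - b) \<ge> 0)"

text \<open>Equivalently, all resolvents of \<open>T\<close> are defined everywhere. Every
  \<open>t > 0\<close> is asked for because \<open>t\<close> tends to 0 when points of the domain
  are sought, and becomes \<open>1 / t\<close> for the inverse.\<close>

definition minty :: "('a::real_inner \<times> 'a) set \<Rightarrow> bool" where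
  "minty T \<longleftrightarrow> monotone_graph T \<and> (\<forall>t>0. \<forall>z. \<exists>x y. (x, y) \<in> T \<and> x + t *\<^sub>R y = z)"

lemma monotone_graphD:
  "monotone_graph T \<Longrightarrow> (x, y) \<in> T \<Longrightarrow> (a, b) \<in> T \<Longrightarrow> (x - a) \<bullet> (y - b) \<ge> 0"
  by (auto simp: monotone_graph_def)

lemma minty_monotone: "minty T \<Longrightarrow> monotone_graph T"
  by (simp add: minty_def)

lemma minty_ex:
  assumes "minty T" "t > 0"
  obtains x y where "(x, y) \<in> T" "x + t *\<^sub>R y = z"
  using assms unfolding minty_def by blast

section \<open>Cyclic monotonicity, chains and potentials\<close>

lemma sum_cyclic_shift:
  fixes g :: "nat \<Rightarrow> 'b::comm_monoid_add"
  shows "(\<Sum>i<m. g (Suc i mod m)) = (\<Sum>i<m. g i)"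
proof (cases m)
  case (Suc k)
  have "(\<Sum>i<Suc k. g (Suc i mod Suc k)) = (\<Sum>i<k. g (Suc i mod Suc k)) + g 0"
    by simp
  also have "(\<Sum>i<k. g (Suc i mod Suc k)) = (\<Sum>i<k. g (Suc i))"
    by (intro sum.cong) auto
  also have "\<dots> + g 0 = (\<Sum>i<Suc k. g i)"
    by (simp add: sum.lessThan_Suc_shift add.commute del: sum.lessThan_Suc)
  finally show ?thesis
    using Suc by simp
qed simp

text \<open>Each \<open>y\<close> is a subgradient of \<open>f\<close> at \<open>x\<close>, tested
  on the domain of \<open>T\<close> only. When the subgradient inequalities are added around a
  cycle, the values of \<open>f\<close> cancel.\<close>

lemma cyclically_monotone_if_potential:
  assumes "\<And>x y a b. (x, y) \<in> T \<Longrightarrow> (a, b) \<in> T \<Longrightarrow> f a \<ge> f x + y \<bullet> (a - x)"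
  shows "cyclically_monotone T"
  unfolding cyclically_monotone_def
proof (intro allI impI)
  fix m :: nat and x y
  assume m: "1 \<le> m" and T: "\<forall>i<m. (x i, y i) \<in> T"
  let ?s = "\<lambda>i. Suc i mod m"
  \<comment> \<open>The slope at the successor \<open>?s i\<close> is tested at \<open>x i\<close>,
    which produces the pairing \<open>x i \<bullet> y (?s i)\<close> of the definition.\<close>
  have "(\<Sum>i<m. f (x i)) \<ge> (\<Sum>i<m. f (x (?s i)) + y (?s i) \<bullet> (x i - x (?s i)))"
    using T m by (intro sum_mono assms) auto
  then have "(\<Sum>i<m. f (x i)) \<ge> (\<Sum>i<m. f (x (?s i))) + (\<Sum>i<m. x i \<bullet> y (?s i))
      - (\<Sum>i<m. x (?s i) \<bullet> y (?s i))"
    by (simp add: sum.distrib sum_subtractf inner_diff_right inner_commute algebra_simps)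
  then show "(\<Sum>i<m. x i \<bullet> y (?s i)) \<le> (\<Sum>i<m. x i \<bullet> y i)"
    using sum_cyclic_shift[of "\<lambda>i. f (x i)" m] sum_cyclic_shift[of "\<lambda>i. x i \<bullet> y i" m] by simp
qed

lemma cyclically_monotone_subset:
  "cyclically_monotone T \<Longrightarrow> S \<subseteq> T \<Longrightarrow> cyclically_monotone S"
  unfolding cyclically_monotone_def by blast

text \<open>The definition pairs \<open>x i\<close> with the next \<open>y\<close>, whereas a chain
  moves to the next \<open>x\<close> along the slope at the present one. Reading the chain
  backwards, with \<open>n - i\<close> in place of \<open>i\<close>, reconciles the two.\<close>

lemma cyclically_monotone_chain:
  assumes "cyclically_monotone T" and T: "\<And>i. i \<le> n \<Longrightarrow> (x i, y i) \<in> T"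
  shows "(\<Sum>i<n. y i \<bullet> (x (Suc i) - x i)) + y n \<bullet> (x 0 - x n) \<le> 0"
proof -
  have "(\<Sum>i<Suc n. x (n - i) \<bullet> y (n - i)) \<ge>
      (\<Sum>i<Suc n. x (n - i) \<bullet> y (n - (Suc i mod Suc n)))"
    using assms(1)[unfolded cyclically_monotone_def, rule_format,
        of "Suc n" "\<lambda>i. x (n - i)" "\<lambda>i. y (n - i)"] T by simp
  moreover have "(\<Sum>i<Suc n. x (n - i) \<bullet> y (n - i)) = (\<Sum>i<Suc n. x i \<bullet> y i)"
    using sum.nat_diff_reindex[of "\<lambda>i. x i \<bullet> y i" "Suc n"] by simp
  \<comment> \<open>Only the last index \<open>i = n\<close> wraps around; its term
    \<open>x 0 \<bullet> y n\<close> closes the cycle and is split off here.\<close>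
  moreover have "(\<Sum>i<n. x (n - i) \<bullet> y (n - (Suc i mod Suc n))) =
      (\<Sum>i<n. x (Suc (n - Suc i)) \<bullet> y (n - Suc i))"
    by (intro sum.cong) (auto simp: Suc_diff_Suc)
  moreover have "\<dots> = (\<Sum>i<n. x (Suc i) \<bullet> y i)"
    using sum.nat_diff_reindex[of "\<lambda>i. x (Suc i) \<bullet> y i" n] by simp
  ultimately show ?thesis
    by (simp add: inner_diff_right sum_subtractf inner_commute)
qed

text \<open>The affine minorants \<open>x \<mapsto> a \<bullet> x + c\<close>, encoded as pairs \<open>(a, c)\<close>, whose supremum is
  Rockafellar's potential of \<open>T\<close> vanishing at \<open>x0\<close>.\<close>

inductive_set minorants :: "('a::real_inner \<times> 'a) set \<Rightarrow> 'a \<Rightarrow> 'a \<Rightarrow> ('a \<times> real) set"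
  for T x0 y0 where
  base: "(y0, - (y0 \<bullet> x0)) \<in> minorants T x0 y0"
| step: "(a, c) \<in> minorants T x0 y0 \<Longrightarrow> (x, y) \<in> T \<Longrightarrow>
    (y, a \<bullet> x + c - y \<bullet> x) \<in> minorants T x0 y0"

text \<open>Makes the chain behind a minorant explicit: the value of the minorant at
  \<open>x0\<close> is then the sum along the chain closed up at \<open>x0\<close>, which cyclic
  monotonicity bounds by 0.\<close>

lemma minorants_chain:
  assumes "(a, c) \<in> minorants T x0 y0" "(x0, y0) \<in> T"
  shows "\<exists>n x y. (\<forall>i\<le>n. (x i, y i) \<in> T) \<and> x 0 = x0 \<and> a = y n \<and>
           c = (\<Sum>i<n. y i \<bullet> (x (Suc i) - x i)) - y n \<bullet> x n"
  using assms(1)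
proof induction
  case base
  show ?case
    by (rule exI[of _ 0], rule exI[of _ "\<lambda>_. x0"], rule exI[of _ "\<lambda>_. y0"])
      (use assms(2) in auto)
next
  case (step a c x' y')
  then obtain n x y where *: "\<forall>i\<le>n. (x i, y i) \<in> T" "x 0 = x0" "a = y n"
    "c = (\<Sum>i<n. y i \<bullet> (x (Suc i) - x i)) - y n \<bullet> x n"
    by blast
  let ?x = "\<lambda>i. if i \<le> n then x i else x'" and ?y = "\<lambda>i. if i \<le> n then y i else y'"
  have "(\<Sum>i<n. ?y i \<bullet> (?x (Suc i) - ?x i)) = (\<Sum>i<n. y i \<bullet> (x (Suc i) - x i))"
    by (intro sum.cong) auto
  then show ?case
    using * step(2)
    by (intro exI[of _ "Suc n"] exI[of _ ?x] exI[of _ ?y])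
      (auto simp: inner_diff_right le_Suc_eq)
qed

section \<open>Suprema of affine functions and their subdifferentials\<close>

definition affine_sup_dom :: "('a::real_inner \<times> real) set \<Rightarrow> 'a set" where
  "affine_sup_dom A = {x. bdd_above ((\<lambda>(a, c). a \<bullet> x + c) ` A)}"

text \<open>Stands for a convex function with values in \<open>(-\<infinity>, \<infinity>]\<close>.
  The real supremum is meaningful only on \<open>affine_sup_dom A\<close>, which is why the
  effective domain is carried separately.\<close>

definition affine_sup :: "('a::real_inner \<times> real) set \<Rightarrow> 'a \<Rightarrow> real" where
  "affine_sup A x = (SUP (a, c)\<in>A. a \<bullet> x + c)"

text \<open>Testing the subgradient inequality on the effective domain is enough, since the function
  is infinite elsewhere.\<close>

definition affine_sup_subdifferential :: "('a::real_inner \<times> real) set \<Rightarrow> ('a \<times> 'a) set" where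
  "affine_sup_subdifferential A = {(x, y). x \<in> affine_sup_dom A \<and>
     (\<forall>z\<in>affine_sup_dom A. affine_sup A z \<ge> affine_sup A x + y \<bullet> (z - x))}"

lemma affine_sup_upper:
  assumes "x \<in> affine_sup_dom A" "(a, c) \<in> A"
  shows "a \<bullet> x + c \<le> affine_sup A x"
  using assms unfolding affine_sup_dom_def affine_sup_def
  by (intro cSUP_upper2[of _ _ "(a, c)"]) auto

lemma affine_sup_least:
  assumes "A \<noteq> {}" "\<And>a c. (a, c) \<in> A \<Longrightarrow> a \<bullet> x + c \<le> r"
  shows "x \<in> affine_sup_dom A" "affine_sup A x \<le> r"
proof -
  show "x \<in> affine_sup_dom A"
    unfolding affine_sup_dom_def using assms(2) by (auto intro!: bdd_aboveI2[of _ _ r])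
  show "affine_sup A x \<le> r"
    unfolding affine_sup_def using assms by (intro cSUP_least) auto
qed

lemma maximal_cyclically_monotone_nonempty:
  assumes "maximal_cyclically_monotone T"
  shows "T \<noteq> {}"
proof
  assume "T = {}"
  have "cyclically_monotone {(0, 0 :: 'a)}"
    by (intro cyclically_monotone_if_potential[of _ "\<lambda>_. 0"]) auto
  then show False
    using assms \<open>T = {}\<close> unfolding maximal_cyclically_monotone_def by blast
qed

text \<open>Rockafellar's theorem. No minorant is positive at \<open>x0\<close>, and appending
  \<open>(x, y)\<close> to a chain shows that the supremum is finite at \<open>x\<close> with
  subgradient \<open>y\<close>. The subdifferential is itself cyclically monotone, so maximality
  turns inclusion into equality.\<close>

lemma maximal_cyclically_monotone_eq_subdifferential:
  assumes T: "maximal_cyclically_monotone T"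
  obtains A where "A \<noteq> {}" "T = affine_sup_subdifferential A"
proof -
  have cm: "cyclically_monotone T"
    using T by (simp add: maximal_cyclically_monotone_def)
  obtain x0 y0 where 0: "(x0, y0) \<in> T"
    using maximal_cyclically_monotone_nonempty[OF T] by auto
  let ?A = "minorants T x0 y0"
  have ne: "?A \<noteq> {}"
    using minorants.base by blast
  have le0: "a \<bullet> x0 + c \<le> 0" if ac: "(a, c) \<in> ?A" for a c
  proof -
    obtain n x y where *: "\<forall>i\<le>n. (x i, y i) \<in> T" "x 0 = x0" "a = y n"
      "c = (\<Sum>i<n. y i \<bullet> (x (Suc i) - x i)) - y n \<bullet> x n"
      using minorants_chain[OF ac 0] by blast
    show ?thesis
      using cyclically_monotone_chain[OF cm, of n x y] * by (simp add: inner_diff_right)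
  qed
  have sub: "T \<subseteq> affine_sup_subdifferential ?A"
  proof clarify
    fix x y assume xy: "(x, y) \<in> T"
    \<comment> \<open>Appending \<open>(x, y)\<close> to the chain gives a minorant of slope
      \<open>y\<close> that touches the old one at \<open>x\<close>; it is evaluated at
      \<open>x0\<close>.\<close>
    have "a \<bullet> x + c \<le> y \<bullet> (x - x0)" if "(a, c) \<in> ?A" for a c
      using le0[OF minorants.step[OF that xy]] by (simp add: inner_diff_right)
    then have dom: "x \<in> affine_sup_dom ?A"
      using affine_sup_least(1)[OF ne] by blast
    have "affine_sup ?A x + y \<bullet> (z - x) \<le> affine_sup ?A z" if z: "z \<in> affine_sup_dom ?A" for z
    proof -
      have "affine_sup ?A x \<le> affine_sup ?A z - y \<bullet> (z - x)"
        using affine_sup_upper[OF z minorants.step[OF _ xy]]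
        by (intro affine_sup_least(2) ne) (auto simp: inner_diff_right algebra_simps)
      then show ?thesis by simp
    qed
    then show "(x, y) \<in> affine_sup_subdifferential ?A"
      using dom by (simp add: affine_sup_subdifferential_def)
  qed
  have "cyclically_monotone (affine_sup_subdifferential ?A)"
    by (intro cyclically_monotone_if_potential[of _ "affine_sup ?A"])
      (auto simp: affine_sup_subdifferential_def)
  then have "T = affine_sup_subdifferential ?A"
    using sub T unfolding maximal_cyclically_monotone_def by blast
  then show ?thesis
    using that ne by blast
qed

lemma monotone_affine_sup_subdifferential: "monotone_graph (affine_sup_subdifferential A)"
proof -
  have "(x - a) \<bullet> (y - b) \<ge> 0"
    if "(x, y) \<in> affine_sup_subdifferential A" "(a, b) \<in> affine_sup_subdifferential A" for x y a b
  proof -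
    have "affine_sup A a \<ge> affine_sup A x + y \<bullet> (a - x)" "affine_sup A x \<ge> affine_sup A a + b \<bullet> (x - a)"
      using that by (auto simp: affine_sup_subdifferential_def)
    then show ?thesis
      by (simp add: inner_diff_right inner_diff_left inner_commute)
  qed
  then show ?thesis by (auto simp: monotone_graph_def)
qed

section \<open>Proximal points\<close>

lemma affine_sup_convex:
  assumes "A \<noteq> {}" "u \<in> affine_sup_dom A" "v \<in> affine_sup_dom A" "0 \<le> s" "s \<le> 1"
  shows "u + s *\<^sub>R (v - u) \<in> affine_sup_dom A"
    "affine_sup A (u + s *\<^sub>R (v - u)) \<le> affine_sup A u + s * (affine_sup A v - affine_sup A u)"
proof -
  have *: "a \<bullet> (u + s *\<^sub>R (v - u)) + c \<le> affine_sup A u + s * (affine_sup A v - affine_sup A u)"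
    if "(a, c) \<in> A" for a c
  proof -
    have "a \<bullet> (u + s *\<^sub>R (v - u)) + c = (1 - s) * (a \<bullet> u + c) + s * (a \<bullet> v + c)"
      by (simp add: algebra_simps inner_diff_right)
    also have "\<dots> \<le> (1 - s) * affine_sup A u + s * affine_sup A v"
      using assms affine_sup_upper[OF _ that] by (intro add_mono mult_left_mono) auto
    finally show ?thesis by (simp add: algebra_simps)
  qed
  show "u + s *\<^sub>R (v - u) \<in> affine_sup_dom A"
    "affine_sup A (u + s *\<^sub>R (v - u)) \<le> affine_sup A u + s * (affine_sup A v - affine_sup A u)"
    using affine_sup_least[OF assms(1) *] by auto
qed

text \<open>A single affine minorant makes the objective coercive, so a minimising sequence is
  bounded. A cluster point is a minimiser because a supremum of affine functions is lower
  semicontinuous.\<close>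

lemma proximal_point_exists:
  fixes A :: "('a::euclidean_space \<times> real) set"
  assumes ne: "A \<noteq> {}" "affine_sup_dom A \<noteq> {}" and t: "t > 0"
  obtains u where "u \<in> affine_sup_dom A"
    "\<And>v. v \<in> affine_sup_dom A \<Longrightarrow>
      affine_sup A u + (norm (u - z))\<^sup>2 / (2 * t) \<le> affine_sup A v + (norm (v - z))\<^sup>2 / (2 * t)"
proof -
  let ?D = "affine_sup_dom A"
  define g where "g v = affine_sup A v + (norm (v - z))\<^sup>2 / (2 * t)" for v
  obtain a c where ac: "(a, c) \<in> A"
    using ne by auto
  define K where "K = \<bar>a \<bullet> z + c\<bar>"
  have coercive: "(norm (v - z))\<^sup>2 / (2 * t) \<le> g v + norm a * norm (v - z) + K" if "v \<in> ?D" for v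
  proof -
    have "a \<bullet> v + c = a \<bullet> (v - z) + (a \<bullet> z + c)"
      by (simp add: inner_diff_right)
    moreover have "\<bar>a \<bullet> (v - z)\<bar> \<le> norm a * norm (v - z)"
      by (rule Cauchy_Schwarz_ineq2)
    ultimately have "affine_sup A v \<ge> - (norm a * norm (v - z)) - K"
      using affine_sup_upper[OF that ac] unfolding K_def by linarith
    then show ?thesis by (simp add: g_def)
  qed
  have lower: "g v \<ge> - (t * (norm a)\<^sup>2 / 2) - K" if "v \<in> ?D" for v
  proof -
    have "0 \<le> (norm (v - z) - t * norm a)\<^sup>2 / (2 * t)"
      using t by simp
    also have "\<dots> = (norm (v - z))\<^sup>2 / (2 * t) - norm a * norm (v - z) + t * (norm a)\<^sup>2 / 2"
      using t by (simp add: power2_diff field_simps power2_eq_square)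
    finally show ?thesis using coercive[OF that] by linarith
  qed
  define I where "I = (INF v\<in>?D. g v)"
  have bdd: "bdd_below (g ` ?D)"
    using lower by (auto intro!: bdd_belowI2)
  have I_le: "I \<le> g v" if "v \<in> ?D" for v
    unfolding I_def by (rule cINF_lower[OF bdd that])
  have "\<exists>v\<in>?D. g v < I + 1 / real (Suc n)" for n
  proof -
    have "I < I + 1 / real (Suc n)" by simp
    then show ?thesis
      unfolding I_def using cINF_less_iff[OF ne(2) bdd] by blast
  qed
  then obtain v where v: "\<And>n. v n \<in> ?D" "\<And>n. g (v n) < I + 1 / real (Suc n)"
    by metis
  \<comment> \<open>Where the norm exceeds 1, the constant in the quadratic inequality is at most a
    multiple of the norm and one factor cancels; the summand 1 covers the other case.\<close>
  have bnd: "norm (v n - z) \<le> 1 + 2 * t * (norm a + (\<bar>I\<bar> + 1 + K))" for n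
  proof (cases "norm (v n - z) \<le> 1")
    case True
    then show ?thesis using t unfolding K_def by (smt (verit) mult_nonneg_nonneg norm_ge_zero)
  next
    case False
    let ?w = "norm (v n - z)"
    have "1 / real (Suc n) \<le> 1" by simp
    then have "?w\<^sup>2 / (2 * t) \<le> (\<bar>I\<bar> + 1 + K) + norm a * ?w"
      using coercive[OF v(1)[of n]] v(2)[of n] by linarith
    also have "\<dots> \<le> (\<bar>I\<bar> + 1 + K) * ?w + norm a * ?w"
      using False unfolding K_def by (simp add: mult_le_cancel_left1)
    finally have "?w * ?w \<le> (2 * t * (norm a + (\<bar>I\<bar> + 1 + K))) * ?w"
      using t by (simp add: field_simps power2_eq_square)
    then have "?w \<le> 2 * t * (norm a + (\<bar>I\<bar> + 1 + K))"
      using False by (auto simp: mult_le_cancel_right)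
    then show ?thesis by simp
  qed
  have "bounded (range (\<lambda>n. v n - z))"
    using bnd by (auto simp: bounded_iff)
  then obtain r l where r: "strict_mono (r :: nat \<Rightarrow> nat)" and l: "((\<lambda>n. v n - z) \<circ> r) \<longlonglongrightarrow> l"
    using bounded_imp_convergent_subsequence by blast
  define u where "u = l + z"
  have vu: "(\<lambda>n. v (r n)) \<longlonglongrightarrow> u"
    using tendsto_add[OF l tendsto_const[of z]] by (simp add: u_def o_def)
  have gI: "(\<lambda>n. I + 1 / real (Suc (r n))) \<longlonglongrightarrow> I"
    using LIMSEQ_subseq_LIMSEQ[OF tendsto_add[OF tendsto_const[of I] LIMSEQ_inverse_real_of_nat] r]
    by (simp add: o_def inverse_eq_divide)
  \<comment> \<open>Lower semicontinuity by hand: the limit is taken for each minorant separately,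
    the supremum only afterwards.\<close>
  have "a' \<bullet> u + c' \<le> I - (norm (u - z))\<^sup>2 / (2 * t)" if "(a', c') \<in> A" for a' c'
  proof -
    have "(\<lambda>n. a' \<bullet> v (r n) + c' + (norm (v (r n) - z))\<^sup>2 / (2 * t))
        \<longlonglongrightarrow> a' \<bullet> u + c' + (norm (u - z))\<^sup>2 / (2 * t)"
      using t by (intro tendsto_intros vu) auto
    moreover have "a' \<bullet> v (r n) + c' + (norm (v (r n) - z))\<^sup>2 / (2 * t) \<le> I + 1 / real (Suc (r n))" for n
      using v(2)[of "r n"] affine_sup_upper[OF v(1) that, of "r n"] by (simp add: g_def)
    ultimately have "a' \<bullet> u + c' + (norm (u - z))\<^sup>2 / (2 * t) \<le> I"
      using LIMSEQ_le[OF _ gI] by blast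
    then show ?thesis by simp
  qed
  then have "u \<in> ?D" "affine_sup A u \<le> I - (norm (u - z))\<^sup>2 / (2 * t)"
    using affine_sup_least[OF ne(1)] by blast+
  then show ?thesis
    using that[of u] I_le unfolding g_def by force
qed

text \<open>The optimality condition of the proximal point \<open>u\<close> says that
  \<open>(z - u) / t\<close> is a subgradient at \<open>u\<close>.\<close>

lemma maximal_cyclically_monotone_imp_minty:
  fixes T :: "('a::euclidean_space \<times> 'a) set"
  assumes "maximal_cyclically_monotone T"
  shows "minty T"
proof -
  obtain A where A: "A \<noteq> {}" and T: "T = affine_sup_subdifferential A"
    using maximal_cyclically_monotone_eq_subdifferential[OF assms] .
  have D: "affine_sup_dom A \<noteq> {}"
    using maximal_cyclically_monotone_nonempty[OF assms]
    by (auto simp: T affine_sup_subdifferential_def)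
  let ?f = "affine_sup A"
  have "\<exists>x y. (x, y) \<in> T \<and> x + t *\<^sub>R y = z" if t: "t > 0" for t z
  proof -
    obtain u where u: "u \<in> affine_sup_dom A" and min: "\<And>v. v \<in> affine_sup_dom A \<Longrightarrow>
      ?f u + (norm (u - z))\<^sup>2 / (2 * t) \<le> ?f v + (norm (v - z))\<^sup>2 / (2 * t)"
      using proximal_point_exists[OF A D t, of z] by blast
    define y where "y = (1 / t) *\<^sub>R (z - u)"
    have "?f v \<ge> ?f u + y \<bullet> (v - u)" if v: "v \<in> affine_sup_dom A" for v
    proof -
      let ?q = "\<lambda>s. ?f v - ?f u + ((u - z) \<bullet> (v - u)) / t + s * (norm (v - u))\<^sup>2 / (2 * t)"
      \<comment> \<open>\<open>u\<close> is compared with the point at fraction \<open>s\<close> of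
        the segment to \<open>v\<close>. After division by \<open>s\<close>, the quadratic remainder
        carries a factor \<open>s\<close> and disappears as \<open>s\<close> tends to 0.\<close>
      have pos: "?q s \<ge> 0" if s: "0 < s" "s \<le> 1" for s
      proof -
        let ?w = "u + s *\<^sub>R (v - u)"
        have w: "?w \<in> affine_sup_dom A" "?f ?w \<le> ?f u + s * (?f v - ?f u)"
          using affine_sup_convex[OF A u v, of s] s by auto
        have "(norm (?w - z))\<^sup>2 = (norm (u - z))\<^sup>2 + 2 * s * ((u - z) \<bullet> (v - u)) + s\<^sup>2 * (norm (v - u))\<^sup>2"
        proof -
          have eq: "?w - z = (u - z) + s *\<^sub>R (v - u)" by simp
          show ?thesis
            unfolding eq power2_norm_eq_inner
            by (simp add: inner_add_left inner_add_right inner_commute power2_eq_square algebra_simps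
                del: add_diff_eq diff_add_eq)
        qed
        then have "0 \<le> s * (?f v - ?f u) + (2 * s * ((u - z) \<bullet> (v - u)) + s\<^sup>2 * (norm (v - u))\<^sup>2) / (2 * t)"
          using min[OF w(1)] w(2) by (simp add: add_divide_distrib)
        also have "\<dots> = s * ?q s"
          using t by (simp add: field_simps power2_eq_square)
        finally show ?thesis
          using s by (simp add: zero_le_mult_iff)
      qed
      have "((\<lambda>s. ?q s) \<longlongrightarrow> ?q 0) (at_right 0)"
        using t by (intro tendsto_intros) auto
      moreover have "eventually (\<lambda>s. 0 \<le> ?q s) (at_right 0)"
        unfolding eventually_at_right_field using pos by (intro exI[of _ 1]) auto
      ultimately have "0 \<le> ?q 0"
        by (intro tendsto_lowerbound[of _ _ "at_right 0"]) auto
      then show ?thesis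
        using t by (simp add: y_def inner_diff_left diff_divide_distrib)
    qed
    then have "(u, y) \<in> T"
      using u by (simp add: T affine_sup_subdifferential_def)
    moreover have "u + t *\<^sub>R y = z"
      using t by (simp add: y_def)
    ultimately show ?thesis by blast
  qed
  then show ?thesis
    unfolding minty_def using T monotone_affine_sup_subdifferential by blast
qed

section \<open>Graphs with everywhere defined resolvents\<close>

text \<open>Solve \<open>a + b = x + y\<close> in \<open>T\<close>. Then
  \<open>y - b = - (x - a)\<close>, and the monotone relation forces
  \<open>- (norm (x - a))\<^sup>2\<close> to be nonnegative.\<close>

lemma minty_maximal:
  assumes T: "minty T" and xy: "\<And>a b. (a, b) \<in> T \<Longrightarrow> (x - a) \<bullet> (y - b) \<ge> 0"
  shows "(x, y) \<in> T"
proof -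
  obtain a b where ab: "(a, b) \<in> T" "a + 1 *\<^sub>R b = x + y"
    using minty_ex[OF T, of 1] by auto
  have eq: "y - b = - (x - a)"
    using ab(2) by (simp add: algebra_simps)
  have "(x - a) \<bullet> (x - a) \<le> 0"
    using xy[OF ab(1)] unfolding eq by (simp only: inner_minus_right neg_0_le_iff_le)
  then have "x - a = 0" using inner_gt_zero_iff[of "x - a"] by linarith
  then show ?thesis using ab by simp
qed

lemma minty_limit:
  assumes T: "minty T" and xy: "\<And>n. (x n, y n) \<in> T" "x \<longlonglongrightarrow> x'" "y \<longlonglongrightarrow> y'"
  shows "(x', y') \<in> T"
proof (rule minty_maximal[OF T])
  fix a b assume "(a, b) \<in> T"
  then have "\<forall>n. (x n - a) \<bullet> (y n - b) \<ge> 0"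
    using monotone_graphD[OF minty_monotone[OF T] xy(1)] by blast
  moreover have "(\<lambda>n. (x n - a) \<bullet> (y n - b)) \<longlonglongrightarrow> (x' - a) \<bullet> (y' - b)"
    by (intro tendsto_intros xy)
  ultimately show "(x' - a) \<bullet> (y' - b) \<ge> 0"
    by (intro LIMSEQ_le_const) auto
qed

lemma minty_closed:
  fixes T :: "('a::real_inner \<times> 'a) set"
  assumes "minty T"
  shows "closed T"
  unfolding closed_sequential_limits
proof (intro allI impI)
  fix z :: "nat \<Rightarrow> 'a \<times> 'a" and l assume "(\<forall>n. z n \<in> T) \<and> z \<longlonglongrightarrow> l"
  then have "(fst l, snd l) \<in> T"
    using minty_limit[OF assms, of "\<lambda>n. fst (z n)" "\<lambda>n. snd (z n)" "fst l" "snd l"]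
    by (simp add: tendsto_fst tendsto_snd)
  then show "l \<in> T" by simp
qed

text \<open>The equation \<open>y + t x = z\<close> is \<open>t\<close> times the equation
  \<open>x + (1 / t) y = (1 / t) z\<close>.\<close>

lemma minty_converse:
  assumes "minty T"
  shows "minty (T\<inverse>)"
  unfolding minty_def
proof (intro conjI allI impI)
  show "monotone_graph (T\<inverse>)"
    using monotone_graphD[OF minty_monotone[OF assms]]
    unfolding monotone_graph_def by (metis converseD inner_commute)
next
  fix t z assume t: "t > (0::real)"
  obtain x y where xy: "(x, y) \<in> T" "x + (1 / t) *\<^sub>R y = (1 / t) *\<^sub>R z"
    using minty_ex[OF assms, of "1 / t"] t by auto
  have "t *\<^sub>R (x + (1 / t) *\<^sub>R y) = z"
    unfolding xy(2) using t by simp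
  then have "(y, x) \<in> T\<inverse> \<and> y + t *\<^sub>R x = z"
    using t xy(1) by (simp add: scaleR_right_distrib add.commute)
  then show "\<exists>x y. (x, y) \<in> T\<inverse> \<and> x + t *\<^sub>R y = z"
    by blast
qed

lemma minty_nonempty: "minty T \<Longrightarrow> T \<noteq> {}"
  by (rule minty_ex[of T 1 0]) auto

section \<open>Points of the domain as limits of resolvents\<close>

lemma minty_value_limit:
  fixes T :: "('a::euclidean_space \<times> 'a) set"
  assumes T: "minty T" and xy: "\<And>n. (x n, y n) \<in> T" "x \<longlonglongrightarrow> x'" and B: "\<And>n. norm (y n) \<le> B"
  obtains r y' where "strict_mono (r :: nat \<Rightarrow> nat)" "(\<lambda>n. y (r n)) \<longlonglongrightarrow> y'" "(x', y') \<in> T"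
proof -
  have "bounded (range y)"
    using B by (auto simp: bounded_iff)
  then obtain r y' where r: "strict_mono (r :: nat \<Rightarrow> nat)" "(y \<circ> r) \<longlonglongrightarrow> y'"
    using bounded_imp_convergent_subsequence by blast
  have "(x', y') \<in> T"
    using xy r LIMSEQ_subseq_LIMSEQ[OF xy(2) r(1)] minty_limit[OF T, of "x \<circ> r" "y \<circ> r"]
    by auto
  then show ?thesis
    using that r by (auto simp: o_def)
qed

text \<open>In \<open>x' + t y = x\<close> with bounded \<open>y\<close>, letting \<open>t\<close>
  tend to 0 moves \<open>x'\<close> to \<open>x\<close>; a cluster point of the \<open>y\<close> is
  a value at \<open>x\<close> because the graph is closed.\<close>

lemma minty_in_Domain:
  fixes T :: "('a::euclidean_space \<times> 'a) set"
  assumes T: "minty T"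
    and B: "\<And>x' y t. 0 < t \<Longrightarrow> t \<le> t0 \<Longrightarrow> (x', y) \<in> T \<Longrightarrow> x' + t *\<^sub>R y = x \<Longrightarrow> norm y \<le> B"
    and "t0 > 0"
  shows "x \<in> Domain T"
proof -
  let ?t = "\<lambda>n. t0 / real (Suc n)"
  have t: "0 < ?t n" "?t n \<le> t0" for n
    using assms(3) by (auto simp: field_simps)
  have "\<exists>x' y. (x', y) \<in> T \<and> x' + ?t n *\<^sub>R y = x" for n
    using minty_ex[OF T t(1)] by metis
  then obtain u v where uv: "\<And>n. (u n, v n) \<in> T" "\<And>n. u n + ?t n *\<^sub>R v n = x"
    by metis
  have B': "norm (v n) \<le> B" for n
    using B[OF t uv] .
  have t0: "?t \<longlonglongrightarrow> 0"
    using tendsto_mult[OF tendsto_const[of t0] LIMSEQ_inverse_real_of_nat] by (simp add: field_simps)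
  have "(\<lambda>n. ?t n *\<^sub>R v n) \<longlonglongrightarrow> 0"
  proof (rule Lim_null_comparison)
    show "\<forall>\<^sub>F n in sequentially. norm (?t n *\<^sub>R v n) \<le> ?t n * B"
      using B' t assms(3) by (intro always_eventually allI) (simp add: divide_right_mono mult_left_mono)
    show "(\<lambda>n. ?t n * B) \<longlonglongrightarrow> 0"
      using tendsto_mult[OF t0 tendsto_const[of B]] by simp
  qed
  then have "(\<lambda>n. x - ?t n *\<^sub>R v n) \<longlonglongrightarrow> x"
    using tendsto_diff[OF tendsto_const[of x]] by fastforce
  moreover have "u = (\<lambda>n. x - ?t n *\<^sub>R v n)"
    using uv(2) by (metis (no_types, lifting) add_diff_cancel_right')
  ultimately have "u \<longlonglongrightarrow> x" by simp
  then show ?thesis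
    by (rule minty_value_limit[OF T uv(1) _ B']) blast
qed

lemma minty_bounded_Range_imp_Domain:
  fixes T :: "('a::euclidean_space \<times> 'a) set"
  assumes "minty T" "bounded (Range T)"
  shows "Domain T = UNIV"
proof -
  obtain B where "\<And>y. y \<in> Range T \<Longrightarrow> norm y \<le> B"
    using assms(2) by (auto simp: bounded_iff)
  then have "x \<in> Domain T" for x
    by (intro minty_in_Domain[OF assms(1), of 1 x B]) auto
  then show ?thesis by blast
qed

section \<open>Surrounding sets, domains and local bounds\<close>

text \<open>For finite \<open>A\<close> and \<open>\<rho> \<ge> 0\<close> this says that the closed
  \<open>\<rho>\<close>-ball about \<open>x\<close> lies in the convex hull of \<open>A\<close>.
  Stated by directions, it can be tested directly against inner products and is evidently stable
  under displacement.\<close>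

definition surrounds :: "real \<Rightarrow> 'a::real_inner \<Rightarrow> 'a set \<Rightarrow> bool" where
  "surrounds \<rho> x A \<longleftrightarrow> (\<forall>u. norm u = 1 \<longrightarrow> (\<exists>a\<in>A. \<rho> \<le> (a - x) \<bullet> u))"

lemma surrounds_norm:
  fixes x y :: "'a::real_inner"
  assumes "surrounds \<rho> x A" "y \<noteq> 0"
  obtains a where "a \<in> A" "\<rho> * norm y \<le> (a - x) \<bullet> y"
proof -
  have "norm (y /\<^sub>R norm y) = 1"
    using assms(2) by simp
  then obtain a where "a \<in> A" "\<rho> \<le> (a - x) \<bullet> (y /\<^sub>R norm y)"
    using assms(1) unfolding surrounds_def by blast
  then show ?thesis
    using that[of a] assms(2) by (simp add: field_simps)
qed

lemma surrounds_mono: "surrounds \<rho> x A \<Longrightarrow> A \<subseteq> B \<Longrightarrow> surrounds \<rho> x B"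
  unfolding surrounds_def by blast

lemma surrounds_perturb:
  assumes "surrounds \<rho> x A" and "dist x x' \<le> \<delta>" and A: "\<And>a. a \<in> A \<Longrightarrow> \<exists>a'\<in>A'. dist a a' \<le> \<epsilon>"
  shows "surrounds (\<rho> - \<delta> - \<epsilon>) x' A'"
  unfolding surrounds_def
proof (intro allI impI)
  fix u :: 'a assume u: "norm u = 1"
  then obtain a where a: "a \<in> A" "\<rho> \<le> (a - x) \<bullet> u"
    using assms(1) unfolding surrounds_def by blast
  obtain a' where a': "a' \<in> A'" "dist a a' \<le> \<epsilon>"
    using A[OF a(1)] by blast
  have *: "\<bar>v \<bullet> u\<bar> \<le> norm v" for v
    using Cauchy_Schwarz_ineq2[of v u] u by simp
  have "(a' - x') \<bullet> u = (a - x) \<bullet> u - (a - a') \<bullet> u - (x' - x) \<bullet> u"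
    by (simp add: inner_diff_left)
  then have "(a' - x') \<bullet> u \<ge> \<rho> - \<delta> - \<epsilon>"
    using *[of "a - a'"] *[of "x' - x"] a(2) a'(2) assms(2) by (simp add: dist_norm norm_minus_commute)
  then show "\<exists>a\<in>A'. \<rho> - \<delta> - \<epsilon> \<le> (a - x') \<bullet> u"
    using a'(1) by blast
qed

text \<open>The absolute coordinates of a unit vector add up to at least 1, so one of them is at
  least \<open>1 / DIM('a)\<close>; the axis point of matching sign is the witness.\<close>

lemma surrounds_axes:
  fixes x :: "'a::euclidean_space"
  assumes "\<delta> > 0"
  shows "surrounds (\<delta> / DIM('a)) x ((\<lambda>(s, b). x + (s * \<delta>) *\<^sub>R b) ` ({-1, 1} \<times> Basis))"
  unfolding surrounds_def
proof (intro allI impI)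
  fix u :: 'a assume u: "norm u = 1"
  have "\<exists>b\<in>Basis. \<bar>u \<bullet> b\<bar> \<ge> 1 / DIM('a)"
  proof (rule ccontr)
    assume "\<not> ?thesis"
    then have "(\<Sum>b\<in>Basis. \<bar>u \<bullet> b\<bar>) < (\<Sum>b\<in>(Basis::'a set). 1 / DIM('a))"
      by (intro sum_strict_mono) auto
    then show False
      using norm_le_l1[of u] u by simp
  qed
  then obtain b where b: "b \<in> Basis" "\<bar>u \<bullet> b\<bar> \<ge> 1 / DIM('a)" by blast
  define s :: real where "s = (if u \<bullet> b \<ge> 0 then 1 else -1)"
  have *: "(x + (s * \<delta>) *\<^sub>R b - x) \<bullet> u = \<delta> * \<bar>u \<bullet> b\<bar>"
    by (auto simp: s_def inner_commute[of u])
  have "\<delta> * (1 / DIM('a)) \<le> \<delta> * \<bar>u \<bullet> b\<bar>"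
    using b(2) assms by (intro mult_left_mono) auto
  then have "\<delta> / DIM('a) \<le> (x + (s * \<delta>) *\<^sub>R b - x) \<bullet> u"
    unfolding * by simp
  moreover have "x + (s * \<delta>) *\<^sub>R b \<in> (\<lambda>(s, b). x + (s * \<delta>) *\<^sub>R b) ` ({-1, 1} \<times> Basis)"
    using b(1) by (intro image_eqI[of _ _ "(s, b)"]) (auto simp: s_def)
  ultimately show "\<exists>a\<in>(\<lambda>(s, b). x + (s * \<delta>) *\<^sub>R b) ` ({-1, 1} \<times> Basis). \<delta> / DIM('a) \<le> (a - x) \<bullet> u"
    by blast
qed

lemma surrounds_dense:
  fixes x :: "'a::euclidean_space"
  assumes "open V" "x \<in> V" "V \<subseteq> closure Z"
  obtains A \<rho> where "finite A" "A \<subseteq> Z \<inter> V" "\<rho> > 0" "surrounds \<rho> x A"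
proof -
  obtain e where e: "e > 0" "ball x e \<subseteq> V"
    using assms(1,2) openE by blast
  define \<delta> where "\<delta> = e / 2"
  \<comment> \<open>Half of the radius \<open>\<delta> / DIM('a)\<close> in which the axis points
    surround \<open>x\<close>, so that after moving them into \<open>Z\<close> a positive radius
    remains.\<close>
  define \<epsilon> where "\<epsilon> = \<delta> / (2 * DIM('a))"
  have \<delta>: "\<delta> > 0" using e by (simp add: \<delta>_def)
  have \<epsilon>: "\<epsilon> > 0" "\<epsilon> \<le> \<delta> / 2" using \<delta> DIM_positive[where 'a='a] by (auto simp: \<epsilon>_def field_simps)
  define G where "G = (\<lambda>(s, b). x + (s * \<delta>) *\<^sub>R b) ` ({-1, 1} \<times> (Basis::'a set))"
  have "\<exists>z\<in>Z \<inter> V. dist g z \<le> \<epsilon>" if "g \<in> G" for g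
  proof -
    have g: "dist x g = \<delta>" using that \<delta> by (auto simp: G_def dist_norm)
    then have "g \<in> V" using e \<delta> by (auto simp: \<delta>_def subset_iff)
    then obtain z where z: "z \<in> Z" "dist z g < \<epsilon>"
      using assms(3) \<epsilon> closure_approachable by blast
    have "dist x z < e"
      using g z \<epsilon> \<delta> dist_triangle[of x z g] by (simp add: \<delta>_def dist_commute)
    then show ?thesis using z e by (intro bexI[of _ z]) (auto simp: dist_commute)
  qed
  then obtain f where f: "\<And>g. g \<in> G \<Longrightarrow> f g \<in> Z \<inter> V \<and> dist g (f g) \<le> \<epsilon>"
    by metis
  have "surrounds (\<delta> / DIM('a)) x G"
    unfolding G_def by (rule surrounds_axes[OF \<delta>])
  then have "surrounds (\<delta> / DIM('a) - 0 - \<epsilon>) x (f ` G)"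
    using f by (intro surrounds_perturb[of _ x G]) auto
  moreover have "\<delta> / DIM('a) - 0 - \<epsilon> > 0"
    using \<delta> by (simp add: \<epsilon>_def field_simps)
  moreover have "finite (f ` G)" by (simp add: G_def)
  ultimately show ?thesis using that f by blast
qed

text \<open>Choose \<open>a\<close> in the direction of \<open>y\<close>, so that
  \<open>\<rho> * norm y \<le> (a - x) \<bullet> y\<close>; monotonicity then replaces
  \<open>y\<close> by the value \<open>b\<close> at \<open>a\<close>.\<close>

lemma monotone_bound:
  assumes T: "monotone_graph T" and s: "surrounds \<rho> x A"
    and A: "\<And>a. a \<in> A \<Longrightarrow> \<exists>b. (a, b) \<in> T \<and> norm (a - x) \<le> \<alpha> \<and> norm b \<le> \<beta>"
    and xy: "(x, y) \<in> T" and "0 \<le> \<alpha>" "0 \<le> \<beta>" "\<rho> > 0"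
  shows "norm y \<le> \<alpha> * \<beta> / \<rho>"
proof (cases "y = 0")
  case False
  then obtain a where a: "a \<in> A" "\<rho> * norm y \<le> (a - x) \<bullet> y"
    using surrounds_norm[OF s] by blast
  obtain b where b: "(a, b) \<in> T" "norm (a - x) \<le> \<alpha>" "norm b \<le> \<beta>"
    using A[OF a(1)] by blast
  have "(a - x) \<bullet> y \<le> (a - x) \<bullet> b"
    using monotone_graphD[OF T b(1) xy] by (simp add: inner_diff_right)
  also have "\<dots> \<le> norm (a - x) * norm b"
    by (rule norm_cauchy_schwarz)
  also have "\<dots> \<le> \<alpha> * \<beta>"
    using b assms by (intro mult_mono) auto
  finally show ?thesis
    using a(2) assms by (simp add: field_simps)
qed (use assms in auto)

lemma finite_norm_bound:
  assumes "finite A"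
  shows "\<exists>B>0. \<forall>a\<in>A. norm (f a :: 'a::real_normed_vector) \<le> B"
  using finite_imp_bounded[OF finite_imageI[OF assms, of f]] by (simp add: bounded_pos)

text \<open>The argument for bounding values at \<open>x\<close> also bounds \<open>y\<close> in
  \<open>x' + t y = x\<close>, uniformly in small \<open>t\<close>: the displacement of
  \<open>x'\<close> from \<open>x\<close> costs only \<open>t * (y \<bullet> g a)\<close>, and the
  square \<open>t * (y \<bullet> y)\<close> has the favourable sign.\<close>

lemma minty_surrounds_in_Domain:
  fixes T :: "('a::euclidean_space \<times> 'a) set"
  assumes T: "minty T" and s: "surrounds \<rho> x A" "\<rho> > 0" and A: "finite A" "A \<subseteq> Domain T"
  shows "x \<in> Domain T"
proof -
  have "\<forall>a\<in>A. \<exists>b. (a, b) \<in> T" using A(2) by blast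
  then obtain g where g: "\<And>a. a \<in> A \<Longrightarrow> (a, g a) \<in> T"
    by metis
  obtain \<alpha> where \<alpha>: "\<alpha> > 0" "\<And>a. a \<in> A \<Longrightarrow> norm (a - x) \<le> \<alpha>"
    using finite_norm_bound[OF A(1), of "\<lambda>a. a - x"] by blast
  obtain \<beta> where \<beta>: "\<beta> > 0" "\<And>a. a \<in> A \<Longrightarrow> norm (g a) \<le> \<beta>"
    using finite_norm_bound[OF A(1), of g] by blast
  \<comment> \<open>With this choice the displacement term is at most half of
    \<open>\<rho> * norm y\<close> and can be absorbed on the left.\<close>
  define t0 where "t0 = \<rho> / (2 * \<beta>)"
  have "norm y \<le> 2 * \<alpha> * \<beta> / \<rho>" if t: "0 < t" "t \<le> t0" and xy: "(x', y) \<in> T" "x' + t *\<^sub>R y = x" for x' y t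
  proof (cases "y = 0")
    case False
    then obtain a where a: "a \<in> A" "\<rho> * norm y \<le> (a - x) \<bullet> y"
      using surrounds_norm[OF s(1)] by blast
    have x': "a - x' = a - x + t *\<^sub>R y"
      unfolding xy(2)[symmetric] by simp
    have "0 \<le> (a - x + t *\<^sub>R y) \<bullet> (g a - y)"
      using monotone_graphD[OF minty_monotone[OF T] g[OF a(1)] xy(1)] unfolding x' .
    then have "(a - x) \<bullet> y + t * (y \<bullet> y) \<le> (a - x) \<bullet> g a + t * (y \<bullet> g a)"
      by (simp add: inner_diff_right inner_add_left distrib_left)
    moreover have "t * (y \<bullet> y) \<ge> 0" using t by simp
    moreover have "(a - x) \<bullet> g a \<le> \<alpha> * \<beta>"
      using \<alpha> \<beta> a(1) by (intro order.trans[OF norm_cauchy_schwarz] mult_mono) auto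
    moreover have "t * (y \<bullet> g a) \<le> t0 * (norm y * \<beta>)"
      using t \<beta> a(1)
      by (intro order.trans[OF mult_left_mono[OF norm_cauchy_schwarz]] mult_mono) auto
    ultimately have "\<rho> * norm y \<le> \<alpha> * \<beta> + t0 * (norm y * \<beta>)"
      using a(2) by linarith
    then show ?thesis
      using s(2) \<beta>(1) by (simp add: t0_def field_simps)
  qed (use \<alpha>(1) \<beta>(1) s(2) in simp)
  moreover have "t0 > 0"
    using s(2) \<beta>(1) by (simp add: t0_def)
  ultimately show ?thesis
    using minty_in_Domain[OF T, of t0] by blast
qed

lemma minty_surrounds_in_interior_Domain:
  fixes T :: "('a::euclidean_space \<times> 'a) set"
  assumes T: "minty T" and s: "surrounds \<rho> x A" "\<rho> > 0" and A: "finite A" "A \<subseteq> Domain T"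
  shows "x \<in> interior (Domain T)"
proof -
  have "ball x (\<rho> / 2) \<subseteq> Domain T"
  proof
    fix x' assume "x' \<in> ball x (\<rho> / 2)"
    then have "surrounds (\<rho> - \<rho> / 2 - 0) x' A"
      by (intro surrounds_perturb[OF s(1)]) auto
    then show "x' \<in> Domain T"
      using s(2) by (intro minty_surrounds_in_Domain[OF T, of "\<rho> - \<rho> / 2 - 0" x' A] A) auto
  qed
  then show ?thesis
    using s(2) by (meson centre_in_ball half_gt_zero interior_maximal open_ball subsetD)
qed

text \<open>\<open>A\<close> still surrounds every point within \<open>\<rho> / 2\<close> of
  \<open>x\<close>, with radius \<open>\<rho> / 2\<close>, so that one bound serves them
  all.\<close>

lemma monotone_locally_bounded:
  assumes T: "monotone_graph T" and s: "surrounds \<rho> x A" "\<rho> > 0" and A: "finite A" "A \<subseteq> Domain T"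
  obtains B where "\<And>x' y. dist x x' \<le> \<rho> / 2 \<Longrightarrow> (x', y) \<in> T \<Longrightarrow> norm y \<le> B"
proof -
  have "\<forall>a\<in>A. \<exists>b. (a, b) \<in> T" using A(2) by blast
  then obtain g where g: "\<And>a. a \<in> A \<Longrightarrow> (a, g a) \<in> T"
    by metis
  obtain \<alpha> where \<alpha>: "\<alpha> > 0" "\<And>a. a \<in> A \<Longrightarrow> norm (a - x) \<le> \<alpha>"
    using finite_norm_bound[OF A(1), of "\<lambda>a. a - x"] by blast
  obtain \<beta> where \<beta>: "\<beta> > 0" "\<And>a. a \<in> A \<Longrightarrow> norm (g a) \<le> \<beta>"
    using finite_norm_bound[OF A(1), of g] by blast
  show ?thesis
  proof (rule that)
    fix x' y assume x': "dist x x' \<le> \<rho> / 2" "(x', y) \<in> T"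
    have "surrounds (\<rho> - \<rho> / 2 - 0) x' A"
      using x' by (intro surrounds_perturb[OF s(1)]) auto
    moreover have "norm (a - x') \<le> \<alpha> + \<rho> / 2" if "a \<in> A" for a
      using \<alpha>(2)[OF that] x'(1) norm_triangle_ineq[of "a - x" "x - x'"] by (simp add: dist_norm)
    ultimately show "norm y \<le> (\<alpha> + \<rho> / 2) * \<beta> / (\<rho> - \<rho> / 2 - 0)"
      using x' g \<beta> \<alpha>(1) s(2) by (intro monotone_bound[OF T]) auto
  qed
qed

text \<open>If \<open>(x, y) \<notin> T\<close>, then some \<open>(p, q) \<in> T\<close> has \<open>(p - x) \<bullet> (y - q) > 0\<close>. A point of \<open>S\<close> over
  a point close to \<open>x + t (p - x)\<close> cannot be monotonically related to both \<open>(p, q)\<close> and \<open>(x, y)\<close>.\<close>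

lemma minty_contains_monotone:
  fixes T :: "('a::euclidean_space \<times> 'a) set"
  assumes T: "minty T" and T': "monotone_graph T'" and S: "S \<subseteq> T" "S \<subseteq> T'"
    and V: "open V" "V \<subseteq> closure (Domain S)" and x: "x \<in> V" "(x, y) \<in> T'"
  shows "(x, y) \<in> T"
proof (rule ccontr)
  assume "(x, y) \<notin> T"
  then obtain p q where pq: "(p, q) \<in> T" "(x - p) \<bullet> (y - q) < 0"
    using minty_maximal[OF T] by (meson not_le)
  define w where "w = p - x"
  have w: "w \<bullet> (y - q) > 0"
    using pq(2) by (simp add: w_def inner_diff_left algebra_simps)
  obtain A \<rho> where A: "finite A" "A \<subseteq> Domain S \<inter> V" "\<rho> > 0" "surrounds \<rho> x A"
    using surrounds_dense[OF V(1) x(1) V(2)] by blast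
  have "A \<subseteq> Domain T" using A(2) S(1) by blast
  then obtain B where B: "\<And>x' y. dist x x' \<le> \<rho> / 2 \<Longrightarrow> (x', y) \<in> T \<Longrightarrow> norm y \<le> B"
    using monotone_locally_bounded[OF minty_monotone[OF T] A(4,3,1)] by blast
  obtain e where e: "e > 0" "ball x e \<subseteq> V"
    using V(1) x(1) openE by blast
  define d where "d = min e (\<rho> / 2)"
  have d: "d > 0" using e A by (simp add: d_def)
  \<comment> \<open>The bound \<open>1 / 2\<close> gives \<open>t \<le> 1 - t\<close>, used when the
    two monotonicity inequalities are combined; the other one keeps \<open>x + t w\<close> within
    \<open>d / 2\<close> of \<open>x\<close>, in reach of both \<open>V\<close> and the local bound
    \<open>B\<close>.\<close>
  define t where "t = min (1 / 2) (d / (2 * (norm w + 1)))"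
  have nw: "norm w + 1 > 0" using norm_ge_zero[of w] by linarith
  have t: "0 < t" using d nw by (simp add: t_def)
  have t2: "t \<le> 1 / 2" unfolding t_def by (rule min.cobounded1)
  have "t * norm w \<le> d / (2 * (norm w + 1)) * (norm w + 1)"
    using t d nw by (intro mult_mono) (auto simp: t_def)
  also have "\<dots> = d / 2" using nw by (simp add: field_simps)
  finally have tw: "t * norm w \<le> d / 2" .
  define C where "C = \<bar>B\<bar> + norm q + norm y + 1"
  have C: "C > 0" unfolding C_def by (smt (verit) norm_ge_zero)
  \<comment> \<open>Two errors of size \<open>\<epsilon> * C\<close> will occur; together they must
    stay below \<open>t * (w \<bullet> (y - q))\<close>, and this choice makes them at most half of
    it.\<close>
  define \<epsilon> where "\<epsilon> = min (d / 2) (t * (w \<bullet> (y - q)) / (4 * C))"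
  have \<epsilon>: "\<epsilon> > 0" using d t w C by (simp add: \<epsilon>_def)
  have "dist x (x + t *\<^sub>R w) < e"
    using tw d t by (simp add: dist_norm d_def)
  then have "x + t *\<^sub>R w \<in> closure (Domain S)"
    using e V(2) by (auto simp: subset_iff)
  then obtain x' where x': "x' \<in> Domain S" "dist x' (x + t *\<^sub>R w) < \<epsilon>"
    using \<epsilon> closure_approachable by blast
  then obtain y' where y': "(x', y') \<in> S" by blast
  define z where "z = x' - (x + t *\<^sub>R w)"
  have z: "norm z < \<epsilon>" using x' by (simp add: z_def dist_norm)
  have "dist x x' \<le> norm (t *\<^sub>R w) + norm z"
    using norm_triangle_ineq[of "t *\<^sub>R w" z] by (simp add: z_def dist_norm norm_minus_commute)
  also have "\<dots> \<le> \<rho> / 2"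
    using tw z t by (simp add: \<epsilon>_def d_def)
  finally have y'B: "norm y' \<le> B"
    using B y' S(1) by blast
  have bq: "norm (q - y') \<le> C" "norm (y' - y) \<le> C"
    using norm_triangle_ineq4[of q y'] norm_triangle_ineq4[of y' y] y'B unfolding C_def
    by (smt (verit) norm_ge_zero)+
  have "0 \<le> (p - x') \<bullet> (q - y')"
    using y' S(1) pq(1) monotone_graphD[OF minty_monotone[OF T]] by blast
  also have "p - x' = (1 - t) *\<^sub>R w - z"
    by (simp add: w_def z_def algebra_simps)
  finally have "0 \<le> (1 - t) * (w \<bullet> (q - y')) + norm z * norm (q - y')"
    using Cauchy_Schwarz_ineq2[of z "q - y'"] by (simp add: inner_diff_left[of _ z])
  also have "\<dots> \<le> (1 - t) * (w \<bullet> (q - y')) + \<epsilon> * C"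
    using z bq C \<epsilon> t by (intro add_left_mono mult_mono) auto
  finally have 1: "(1 - t) * (w \<bullet> (y' - q)) \<le> \<epsilon> * C"
    by (simp add: inner_diff_right algebra_simps)
  have "0 \<le> (x' - x) \<bullet> (y' - y)"
    using y' S(2) x(2) monotone_graphD[OF T'] by blast
  also have "x' - x = t *\<^sub>R w + z"
    by (simp add: z_def)
  finally have "0 \<le> t * (w \<bullet> (y' - y)) + norm z * norm (y' - y)"
    using Cauchy_Schwarz_ineq2[of z "y' - y"] by (simp add: inner_add_left)
  also have "\<dots> \<le> t * (w \<bullet> (y' - y)) + \<epsilon> * C"
    using z bq C \<epsilon> t by (intro add_left_mono mult_mono) auto
  finally have 2: "t * (w \<bullet> (y - y')) \<le> \<epsilon> * C"
    by (simp add: inner_diff_right algebra_simps)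
  \<comment> \<open>The factor \<open>1 - t\<close> is lowered to \<open>t\<close>, so that
    \<open>y'\<close> cancels when this is added to the second inequality.\<close>
  have "t * (w \<bullet> (y' - q)) \<le> \<epsilon> * C"
  proof (cases "w \<bullet> (y' - q) \<ge> 0")
    case True
    then have "t * (w \<bullet> (y' - q)) \<le> (1 - t) * (w \<bullet> (y' - q))"
      using t2 by (intro mult_right_mono) auto
    then show ?thesis using 1 by linarith
  next
    case False
    then have "t * (w \<bullet> (y' - q)) \<le> 0"
      using t by (simp add: mult_nonneg_nonpos)
    then show ?thesis using \<epsilon> C by (smt (verit) mult_pos_pos)
  qed
  then have "t * (w \<bullet> (y - q)) \<le> 2 * (\<epsilon> * C)"
    using 2 by (simp add: inner_diff_right algebra_simps)
  also have "\<dots> \<le> 2 * (t * (w \<bullet> (y - q)) / (4 * C) * C)"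
    using C by (intro mult_left_mono mult_right_mono) (auto simp: \<epsilon>_def)
  also have "\<dots> < t * (w \<bullet> (y - q))"
    using C t w by simp
  finally show False by simp
qed

text \<open>A point interior to the convex hull of the domain is surrounded by finitely many points
  of the hull. By Caratheodory each of these lies in the hull of finitely many domain points, one of
  which does at least as well in any given direction; so finitely many domain points surround, and
  the point is in the domain.\<close>

lemma minty_Domain_convex_interior:
  fixes T :: "('a::euclidean_space \<times> 'a) set"
  assumes T: "minty T"
  shows "convex (interior (Domain T))"
proof -
  have "interior (convex hull (Domain T)) \<subseteq> Domain T"
  proof
    fix x assume x: "x \<in> interior (convex hull (Domain T))"
    have "interior (convex hull (Domain T)) \<subseteq> closure (convex hull (Domain T))"
      using interior_subset closure_subset by (rule order_trans)
    then obtain F \<rho> where F: "finite F" "F \<subseteq> convex hull Domain T \<inter> interior (convex hull (Domain T))"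
        "\<rho> > 0" "surrounds \<rho> x F"
      by (rule surrounds_dense[OF open_interior x])
    have "\<exists>S. finite S \<and> S \<subseteq> Domain T \<and> a \<in> convex hull S" if "a \<in> F" for a
    proof -
      have "a \<in> convex hull (Domain T)" using F(2) that by blast
      then show ?thesis
        by (subst (asm) caratheodory) blast
    qed
    then obtain S where S: "\<And>a. a \<in> F \<Longrightarrow> finite (S a) \<and> S a \<subseteq> Domain T \<and> a \<in> convex hull (S a)"
      by metis
    let ?A = "\<Union>a\<in>F. S a"
    have "surrounds \<rho> x ?A"
      unfolding surrounds_def
    proof (intro allI impI)
      fix u :: 'a assume "norm u = 1"
      then obtain a where a: "a \<in> F" "\<rho> \<le> (a - x) \<bullet> u"
        using F(4) unfolding surrounds_def by blast
      show "\<exists>a\<in>?A. \<rho> \<le> (a - x) \<bullet> u"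
      proof (rule ccontr)
        assume "\<not> ?thesis"
        then have "S a \<subseteq> {s. u \<bullet> s < \<rho> + x \<bullet> u}"
          using a(1) by (auto simp: inner_diff_left inner_commute[of u] not_le diff_less_eq)
        then have "convex hull (S a) \<subseteq> {s. u \<bullet> s < \<rho> + x \<bullet> u}"
          by (intro hull_minimal convex_halfspace_lt) auto
        then show False
          using S[OF a(1)] a(2) by (auto simp: inner_diff_left inner_commute[of u])
      qed
    qed
    then show "x \<in> Domain T"
      using F S by (intro minty_surrounds_in_Domain[OF T, of \<rho> x ?A]) auto
  qed
  then have "interior (convex hull (Domain T)) = interior (Domain T)"
    by (intro subset_antisym interior_maximal interior_mono hull_subset) auto
  then show ?thesis
    using convex_interior[OF convex_convex_hull[of "Domain T"]] by simp
qed

text \<open>The graphs agree over the interior of \<open>Domain A\<close>. To relate \<open>(y, x) \<in> B\<close> to \<open>(b, a) \<in> A\<close>,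
  take a common point \<open>(m e, X e)\<close> over \<open>m e = (y + b) / 2 + (e / 2) (w - b)\<close>, with \<open>w\<close> interior,
  and let \<open>e\<close> tend to 0: since \<open>m\<close> moves along a line, \<open>X e \<bullet> (w - b)\<close> decreases with \<open>e\<close>.\<close>

lemma minty_eq_on_interior_imp_subset:
  fixes A B :: "('a::euclidean_space \<times> 'a) set"
  assumes A: "minty A" and B: "monotone_graph B"
    and V: "V \<subseteq> Domain A" "open V" "convex V" "V \<noteq> {}"
    and eq: "\<And>v x. v \<in> V \<Longrightarrow> (v, x) \<in> A \<Longrightarrow> (v, x) \<in> B"
    and dom: "Domain A \<subseteq> closure V" "Domain B \<subseteq> closure V"
  shows "B \<subseteq> A"
proof clarify
  fix y x assume yx: "(y, x) \<in> B"
  show "(y, x) \<in> A"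
  proof (rule minty_maximal[OF A])
    fix b a assume ba: "(b, a) \<in> A"
    obtain w where w: "w \<in> V" using V by blast
    define v where "v = w - b"
    define m where "m e = (1 / 2) *\<^sub>R (y + b) + (e / 2) *\<^sub>R v" for e :: real
    have m: "m e \<in> V" if e: "0 < e" "e \<le> 1" for e
    proof -
      \<comment> \<open>\<open>m e\<close> has weights \<open>1 / 2\<close>,
        \<open>(1 - e) / 2\<close> and \<open>e / 2\<close> on \<open>y\<close>, \<open>b\<close>
        and \<open>w\<close>. Normalising the first two gives \<open>q\<close> in the closure of
        \<open>V\<close>, so \<open>m e\<close> lies strictly between \<open>q\<close> and the
        interior point \<open>w\<close>.\<close>
      define q where "q = (1 / (2 - e)) *\<^sub>R y + ((1 - e) / (2 - e)) *\<^sub>R b"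
      have "y \<in> closure V" "b \<in> closure V" using dom yx ba by blast+
      moreover have "1 / (2 - e) + (1 - e) / (2 - e) = 1"
        using e by (simp add: field_simps)
      ultimately have q: "q \<in> closure V"
        unfolding q_def using e convex_closure[OF V(3)] by (intro convexD) auto
      have "q - (e / 2) *\<^sub>R (q - w) \<in> interior V"
        using e w V by (intro mem_interior_closure_convex_shrink[OF V(3) _ q]) (auto simp: interior_open)
      moreover have "q - (e / 2) *\<^sub>R (q - w) = (1 - e / 2) *\<^sub>R q + (e / 2) *\<^sub>R w"
        by (simp add: algebra_simps)
      moreover have "(1 - e / 2) *\<^sub>R q = (1 / 2) *\<^sub>R y + ((1 - e) / 2) *\<^sub>R b"
      proof -
        have "(1 - e / 2) / (2 - e) = 1 / 2"
          using e by (simp add: field_simps)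
        moreover from this have "(1 - e / 2) * (1 - e) / (2 - e) = (1 - e) / 2"
          by (metis mult.commute mult.right_neutral times_divide_eq_right)
        ultimately show ?thesis by (simp only: q_def scaleR_right_distrib scaleR_scaleR times_divide_eq_right mult.right_neutral)
      qed
      moreover have "(1 / 2) *\<^sub>R y + ((1 - e) / 2) *\<^sub>R b + (e / 2) *\<^sub>R w = m e"
        by (simp add: m_def v_def scaleR_right_distrib scaleR_right_diff_distrib diff_divide_distrib
            scaleR_left_diff_distrib)
      ultimately show ?thesis using interior_subset by auto
    qed
    have "\<exists>X. (m e, X) \<in> A" if "0 < e" "e \<le> 1" for e
      using m[OF that] V by blast
    then obtain X where X: "\<And>e. 0 < e \<Longrightarrow> e \<le> 1 \<Longrightarrow> (m e, X e) \<in> A"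
      by metis
    have X1: "X e \<bullet> v \<le> X 1 \<bullet> v" if e: "0 < e" "e \<le> 1" for e
    proof (cases "e = 1")
      case False
      have "0 \<le> (m 1 - m e) \<bullet> (X 1 - X e)"
        using monotone_graphD[OF minty_monotone[OF A] X[of 1] X[OF e]] by simp
      also have "m 1 - m e = ((1 - e) / 2) *\<^sub>R v"
        by (simp add: m_def scaleR_left_diff_distrib diff_divide_distrib)
      finally show ?thesis
        using e False by (simp add: zero_le_mult_iff inner_diff_right inner_commute)
    qed simp
    let ?k = "\<lambda>e. (y - b) \<bullet> (x - a) + e * (v \<bullet> (2 *\<^sub>R X 1 - x - a))"
    have "?k e \<ge> 0" if e: "0 < e" "e \<le> 1" for e
    proof -
      have "0 \<le> (m e - y) \<bullet> (X e - x)"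
        using monotone_graphD[OF B eq[OF m[OF e] X[OF e]] yx] .
      moreover have "0 \<le> (m e - b) \<bullet> (X e - a)"
        using monotone_graphD[OF minty_monotone[OF A] X[OF e] ba] .
      moreover have "m e - y = (1 / 2) *\<^sub>R ((b - y) + e *\<^sub>R v)" "m e - b = (1 / 2) *\<^sub>R ((y - b) + e *\<^sub>R v)"
      proof -
        have "y = (1 / 2) *\<^sub>R y + (1 / 2) *\<^sub>R y" "b = (1 / 2) *\<^sub>R b + (1 / 2) *\<^sub>R b"
          by (simp_all flip: scaleR_left_distrib)
        then show "m e - y = (1 / 2) *\<^sub>R ((b - y) + e *\<^sub>R v)" "m e - b = (1 / 2) *\<^sub>R ((y - b) + e *\<^sub>R v)"
          by (simp_all add: m_def scaleR_right_distrib scaleR_right_diff_distrib algebra_simps)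
      qed
      ultimately have "0 \<le> (b - y + e *\<^sub>R v) \<bullet> (X e - x)" "0 \<le> (y - b + e *\<^sub>R v) \<bullet> (X e - a)"
        by (simp_all add: zero_le_mult_iff)
      \<comment> \<open>In the sum of the two inequalities the products of \<open>X e\<close> with
        \<open>y - b\<close> cancel; the possibly unbounded \<open>X e\<close> survives only with
        the factor \<open>e\<close>, paired with \<open>v\<close>.\<close>
      then have "0 \<le> (y - b) \<bullet> (x - a) + e * (2 * (X e \<bullet> v) - v \<bullet> x - v \<bullet> a)"
        by (simp add: inner_add_left inner_diff_left inner_diff_right inner_commute algebra_simps)
      also have "\<dots> \<le> (y - b) \<bullet> (x - a) + e * (2 * (X 1 \<bullet> v) - v \<bullet> x - v \<bullet> a)"
        using X1[OF e] e by (intro add_left_mono mult_left_mono) auto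
      finally show ?thesis
        by (simp add: inner_diff_right inner_commute)
    qed
    then have "eventually (\<lambda>e. 0 \<le> ?k e) (at_right 0)"
      unfolding eventually_at_right_field by (intro exI[of _ 1]) auto
    moreover have "(?k \<longlongrightarrow> ?k 0) (at_right 0)"
      by (intro tendsto_intros)
    ultimately have "0 \<le> ?k 0"
      by (intro tendsto_lowerbound[of _ _ "at_right 0"]) auto
    then show "(y - b) \<bullet> (x - a) \<ge> 0" by simp
  qed
qed

section \<open>Kuratowski limits\<close>

lemma not_eventually_subseq:
  assumes "\<not> (\<forall>\<^sub>F n in sequentially. R n)"
  obtains s :: "nat \<Rightarrow> nat" where "strict_mono s" "\<And>k. \<not> R (s k)"
proof -
  have "infinite {n. \<not> R n}"
    using assms by (auto simp: eventually_sequentially infinite_nat_iff_unbounded_le)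
  then show ?thesis
    using infinite_enumerate[of "{n. \<not> R n}"] that by auto
qed

lemma eventually_by_subsequences:
  assumes "\<And>s :: nat \<Rightarrow> nat. strict_mono s \<Longrightarrow>
    \<exists>r :: nat \<Rightarrow> nat. strict_mono r \<and> (\<forall>\<^sub>F k in sequentially. R (s (r k)))"
  shows "\<forall>\<^sub>F n in sequentially. R n"
proof (rule ccontr)
  assume "\<not> ?thesis"
  then obtain s :: "nat \<Rightarrow> nat" where s: "strict_mono s" "\<And>k. \<not> R (s k)"
    by (rule not_eventually_subseq) blast
  then show False
    using assms[OF s(1)] eventually_happens'[OF sequentially_bot] by blast
qed

text \<open>The first clause places \<open>L\<close> inside the lower limit, the second places the
  upper limit inside \<open>L\<close>. Being stated at points, it is easily extracted from a
  countable base.\<close>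

definition kuratowski_limit :: "(nat \<Rightarrow> 'b::topological_space set) \<Rightarrow> 'b set \<Rightarrow> bool" where
  "kuratowski_limit A L \<longleftrightarrow>
     (\<forall>z G. z \<in> L \<longrightarrow> open G \<longrightarrow> z \<in> G \<longrightarrow> (\<forall>\<^sub>F k in sequentially. A k \<inter> G \<noteq> {})) \<and>
     (\<forall>z. z \<notin> L \<longrightarrow> (\<exists>G. open G \<and> z \<in> G \<and> (\<forall>\<^sub>F k in sequentially. A k \<inter> G = {})))"

lemma kuratowski_limit_hit:
  assumes "kuratowski_limit A L" "open G" "L \<inter> G \<noteq> {}"
  shows "\<forall>\<^sub>F k in sequentially. A k \<inter> G \<noteq> {}"
proof -
  obtain z where "z \<in> L" "z \<in> G" using assms(3) by auto
  then show ?thesis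
    using assms(1,2) by (simp add: kuratowski_limit_def)
qed

lemma kuratowski_limit_missed_nhd:
  assumes "kuratowski_limit A L" "z \<notin> L"
  obtains G where "open G" "z \<in> G" "\<forall>\<^sub>F k in sequentially. A k \<inter> G = {}"
proof -
  have "\<exists>G. open G \<and> z \<in> G \<and> (\<forall>\<^sub>F k in sequentially. A k \<inter> G = {})"
    using assms by (simp add: kuratowski_limit_def)
  then show ?thesis
    using that by (elim exE conjE)
qed

lemma kuratowski_limit_miss:
  assumes A: "kuratowski_limit A L" and K: "compact K" "L \<inter> K = {}"
  shows "\<forall>\<^sub>F k in sequentially. A k \<inter> K = {}"
proof -
  have "\<exists>G. open G \<and> z \<in> G \<and> (\<forall>\<^sub>F k in sequentially. A k \<inter> G = {})" if "z \<in> K" for z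
  proof -
    have "z \<notin> L" using K(2) that by auto
    then show ?thesis
      by (rule kuratowski_limit_missed_nhd[OF A]) auto
  qed
  then obtain G where G: "\<And>z. z \<in> K \<Longrightarrow> open (G z) \<and> z \<in> G z"
    "\<And>z. z \<in> K \<Longrightarrow> \<forall>\<^sub>F k in sequentially. A k \<inter> G z = {}"
    by metis
  obtain C where C: "C \<subseteq> K" "finite C" "K \<subseteq> (\<Union>z\<in>C. G z)"
    by (rule compactE_image[OF K(1), of K G]) (use G in auto)
  have "\<forall>\<^sub>F k in sequentially. \<forall>z\<in>C. A k \<inter> G z = {}"
    using C G by (intro eventually_ball_finite) auto
  then show ?thesis
    by eventually_elim (use C in blast)
qed

text \<open>A diagonal subsequence decides every set of a countable base: it is eventually hit or
  eventually missed. The points all of whose neighbourhoods are eventually hit form the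
  limit.\<close>

lemma kuratowski_limit_compact:
  fixes A :: "nat \<Rightarrow> 'b::second_countable_topology set"
  obtains r L where "strict_mono (r :: nat \<Rightarrow> nat)" "kuratowski_limit (A \<circ> r) L"
proof -
  obtain B :: "'b set set" where B: "countable B" "topological_basis B"
    using ex_countable_basis by blast
  define b where "b n = (if B = {} then {} else from_nat_into B n)" for n
  have bB: "\<And>G. G \<in> B \<Longrightarrow> \<exists>n. b n = G"
    using B(1) by (metis b_def empty_iff from_nat_into_surj)
  define P where "P n s \<longleftrightarrow> (\<forall>\<^sub>F k in sequentially. A (s k) \<inter> b n \<noteq> {}) \<or>
      (\<forall>\<^sub>F k in sequentially. A (s k) \<inter> b n = {})" for n and s :: "nat \<Rightarrow> nat"
  interpret subseqs P
  proof
    fix n and s :: "nat \<Rightarrow> nat"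
    show "\<exists>r. strict_mono r \<and> P n (s \<circ> r)"
    proof (cases "\<forall>\<^sub>F k in sequentially. A (s k) \<inter> b n = {}")
      case True
      then show ?thesis
        by (intro exI[of _ id]) (auto simp: P_def strict_mono_def)
    next
      case False
      then obtain r :: "nat \<Rightarrow> nat" where r: "strict_mono r" "\<And>k. A (s (r k)) \<inter> b n \<noteq> {}"
        by (rule not_eventually_subseq) blast
      then show ?thesis
        unfolding P_def by (intro exI[of _ r]) simp
    qed
  qed
  have "P n (diagseq \<circ> (+) (Suc n))" for n
  proof (rule diagseq_holds)
    fix r s :: "nat \<Rightarrow> nat" and n assume r: "strict_mono r" and "P n s"
    then show "P n (s \<circ> r)"
      unfolding P_def o_def using eventually_subseq[OF r] by fast
  qed
  note D = this
  \<comment> \<open>The diagonal sequence is a subsequence of the \<open>n\<close>-th one only from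
    a certain index on; both alternatives are eventual, so the shift is harmless.\<close>
  have "P n diagseq" for n
    using D[of n]
      eventually_sequentially_seg[of "\<lambda>k. A (diagseq k) \<inter> b n \<noteq> {}" "Suc n"]
      eventually_sequentially_seg[of "\<lambda>k. A (diagseq k) \<inter> b n = {}" "Suc n"]
    unfolding P_def[of n diagseq] P_def[of n "diagseq \<circ> (+) (Suc n)"]
    by (simp add: add.commute)
  then have P: "G \<in> B \<Longrightarrow> (\<forall>\<^sub>F k in sequentially. A (diagseq k) \<inter> G \<noteq> {}) \<or>
      (\<forall>\<^sub>F k in sequentially. A (diagseq k) \<inter> G = {})" for G
    using bB[of G] P_def[of _ diagseq] by blast
  define L where "L = {z. \<forall>G. open G \<longrightarrow> z \<in> G \<longrightarrow> (\<forall>\<^sub>F k in sequentially. A (diagseq k) \<inter> G \<noteq> {})}"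
  have "\<exists>G. open G \<and> z \<in> G \<and> (\<forall>\<^sub>F k in sequentially. A (diagseq k) \<inter> G = {})" if z: "z \<notin> L" for z
  proof -
    obtain U where U: "open U" "z \<in> U" "\<not> (\<forall>\<^sub>F k in sequentially. A (diagseq k) \<inter> U \<noteq> {})"
      using z unfolding L_def by blast
    obtain G where G: "G \<in> B" "z \<in> G" "G \<subseteq> U"
      using topological_basisE[OF B(2) U(1,2)] by blast
    have "\<not> (\<forall>\<^sub>F k in sequentially. A (diagseq k) \<inter> G \<noteq> {})"
      using U(3) G(3) eventually_mono[of "\<lambda>k. A (diagseq k) \<inter> G \<noteq> {}" sequentially
          "\<lambda>k. A (diagseq k) \<inter> U \<noteq> {}"] by blast
    then show ?thesis
      using P[OF G(1)] G topological_basis_open[OF B(2)] by blast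
  qed
  then have "kuratowski_limit (A \<circ> diagseq) L"
    unfolding kuratowski_limit_def by (simp add: L_def)
  then show ?thesis
    using that subseq_diagseq by blast
qed

text \<open>Almost nearest points of \<open>A k\<close> to \<open>z\<close> are chosen. Every ball
  about \<open>z\<close> is eventually hit, so the distances tend to 0; where \<open>A k\<close> is
  empty the choice is arbitrary.\<close>

lemma kuratowski_limit_sequence:
  fixes A :: "nat \<Rightarrow> 'b::metric_space set"
  assumes A: "kuratowski_limit A L" and z: "z \<in> L"
  obtains \<zeta> where "\<zeta> \<longlonglongrightarrow> z" "\<forall>\<^sub>F k in sequentially. \<zeta> k \<in> A k"
proof -
  have "\<exists>w. A k \<noteq> {} \<longrightarrow> w \<in> A k \<and> dist z w < infdist z (A k) + 1 / real (Suc k)" for k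
  proof (cases "A k = {}")
    case False
    have "infdist z (A k) < infdist z (A k) + 1 / real (Suc k)" by simp
    then have "\<exists>w\<in>A k. dist z w < infdist z (A k) + 1 / real (Suc k)"
      unfolding infdist_notempty[OF False] using cINF_less_iff[OF False, of "dist z"]
      by (meson bdd_below_image_dist)
    then show ?thesis by blast
  qed simp
  then obtain \<zeta> where \<zeta>: "\<And>k. A k \<noteq> {} \<Longrightarrow> \<zeta> k \<in> A k \<and> dist z (\<zeta> k) < infdist z (A k) + 1 / real (Suc k)"
    by metis
  have hit: "\<forall>\<^sub>F k in sequentially. A k \<inter> ball z e \<noteq> {}" if "e > 0" for e
    by (rule kuratowski_limit_hit[OF A]) (use z that in auto)
  show ?thesis
  proof (rule that)
    show "\<forall>\<^sub>F k in sequentially. \<zeta> k \<in> A k"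
      using hit[OF zero_less_one] by eventually_elim (use \<zeta> in blast)
    show "\<zeta> \<longlonglongrightarrow> z"
    proof (rule tendstoI)
      fix e :: real assume e: "e > 0"
      have "\<forall>\<^sub>F k in sequentially. inverse (real (Suc k)) < e / 2"
        using order_tendstoD(2)[OF LIMSEQ_inverse_real_of_nat, of "e / 2"] e by simp
      moreover have "\<forall>\<^sub>F k in sequentially. A k \<inter> ball z (e / 2) \<noteq> {}"
        using hit[of "e / 2"] e by simp
      ultimately show "\<forall>\<^sub>F k in sequentially. dist (\<zeta> k) z < e"
      proof eventually_elim
        case (elim k)
        then obtain w where "w \<in> A k" "dist z w < e / 2" by auto
        then have "dist z (\<zeta> k) < infdist z (A k) + inverse (real (Suc k))"
          using \<zeta>[of k] by (auto simp: inverse_eq_divide)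
        also have "infdist z (A k) \<le> dist z w"
          using \<open>w \<in> A k\<close> by (rule infdist_le)
        finally show ?case
          using \<open>dist z w < e / 2\<close> elim(1) by (simp add: dist_commute)
      qed
    qed
  qed
qed

lemma kuratowski_limit_contains:
  assumes A: "kuratowski_limit A L" and s: "strict_mono s" "\<And>k. w k \<in> A (s k)" "w \<longlonglongrightarrow> z"
  shows "z \<in> L"
proof (rule ccontr)
  assume "z \<notin> L"
  then obtain G where G: "open G" "z \<in> G" "\<forall>\<^sub>F k in sequentially. A k \<inter> G = {}"
    by (rule kuratowski_limit_missed_nhd[OF A])
  have "\<forall>\<^sub>F k in sequentially. False"
    using eventually_subseq[OF s(1) G(3)] topological_tendstoD[OF s(3) G(1,2)]
    by eventually_elim (use s(2) in blast)
  then show False by simp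
qed

lemma kuratowski_limit_monotone:
  assumes A: "kuratowski_limit A L" and mono: "\<And>k. monotone_graph (A k)"
  shows "monotone_graph L"
  unfolding monotone_graph_def
proof (intro allI impI)
  fix x y a b assume xy: "(x, y) \<in> L" and ab: "(a, b) \<in> L"
  obtain \<zeta> where \<zeta>: "\<zeta> \<longlonglongrightarrow> (x, y)" "\<forall>\<^sub>F k in sequentially. \<zeta> k \<in> A k"
    by (rule kuratowski_limit_sequence[OF A xy])
  obtain \<xi> where \<xi>: "\<xi> \<longlonglongrightarrow> (a, b)" "\<forall>\<^sub>F k in sequentially. \<xi> k \<in> A k"
    by (rule kuratowski_limit_sequence[OF A ab])
  have "(\<lambda>k. (fst (\<zeta> k) - fst (\<xi> k)) \<bullet> (snd (\<zeta> k) - snd (\<xi> k))) \<longlonglongrightarrow>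
      (fst (x, y) - fst (a, b)) \<bullet> (snd (x, y) - snd (a, b))"
    by (intro tendsto_inner tendsto_diff tendsto_fst tendsto_snd \<zeta> \<xi>)
  moreover have "\<forall>\<^sub>F k in sequentially. 0 \<le> (fst (\<zeta> k) - fst (\<xi> k)) \<bullet> (snd (\<zeta> k) - snd (\<xi> k))"
    using \<zeta>(2) \<xi>(2) by eventually_elim (use mono in \<open>auto simp: monotone_graph_def\<close>)
  ultimately show "0 \<le> (x - a) \<bullet> (y - b)"
    by (intro tendsto_lowerbound[of _ "(x - a) \<bullet> (y - b)" sequentially]) auto
qed

lemma kuratowski_limit_cyclically_monotone:
  assumes A: "kuratowski_limit A L" and mono: "\<And>k. cyclically_monotone (A k)"
  shows "cyclically_monotone L"
  unfolding cyclically_monotone_def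
proof (intro allI impI)
  fix m :: nat and x y assume m: "1 \<le> m" and L: "\<forall>i<m. (x i, y i) \<in> L"
  have "\<exists>\<zeta>. \<zeta> \<longlonglongrightarrow> (x i, y i) \<and> (\<forall>\<^sub>F k in sequentially. \<zeta> k \<in> A k)" if "i < m" for i
  proof -
    have "(x i, y i) \<in> L" using L that by simp
    then show ?thesis by (rule kuratowski_limit_sequence[OF A]) blast
  qed
  then obtain \<zeta> where \<zeta>: "\<And>i. i < m \<Longrightarrow> \<zeta> i \<longlonglongrightarrow> (x i, y i)"
    "\<And>i. i < m \<Longrightarrow> \<forall>\<^sub>F k in sequentially. \<zeta> i k \<in> A k"
    by metis
  have fs: "(\<lambda>k. fst (\<zeta> i k)) \<longlonglongrightarrow> x i" "(\<lambda>k. snd (\<zeta> i k)) \<longlonglongrightarrow> y i" if "i < m" for i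
    using tendsto_fst[OF \<zeta>(1)[OF that]] tendsto_snd[OF \<zeta>(1)[OF that]] by auto
  have "(\<lambda>k. \<Sum>i<m. fst (\<zeta> i k) \<bullet> snd (\<zeta> (Suc i mod m) k)) \<longlonglongrightarrow> (\<Sum>i<m. x i \<bullet> y (Suc i mod m))"
    using m by (intro tendsto_sum tendsto_inner fs) auto
  moreover have "(\<lambda>k. \<Sum>i<m. fst (\<zeta> i k) \<bullet> snd (\<zeta> i k)) \<longlonglongrightarrow> (\<Sum>i<m. x i \<bullet> y i)"
    by (intro tendsto_sum tendsto_inner fs) auto
  moreover have "\<forall>\<^sub>F k in sequentially. \<forall>i\<in>{..<m}. \<zeta> i k \<in> A k"
    using \<zeta>(2) by (intro eventually_ball_finite) auto
  then have "\<forall>\<^sub>F k in sequentially. (\<Sum>i<m. fst (\<zeta> i k) \<bullet> snd (\<zeta> (Suc i mod m) k)) \<le>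
      (\<Sum>i<m. fst (\<zeta> i k) \<bullet> snd (\<zeta> i k))"
  proof eventually_elim
    case (elim k)
    then show ?case
      using mono[of k, unfolded cyclically_monotone_def, rule_format, of m
          "\<lambda>i. fst (\<zeta> i k)" "\<lambda>i. snd (\<zeta> i k)"] m by simp
  qed
  ultimately show "(\<Sum>i<m. x i \<bullet> y (Suc i mod m)) \<le> (\<Sum>i<m. x i \<bullet> y i)"
    using tendsto_le[OF sequentially_bot] by blast
qed

text \<open>A point of \<open>L\<close> supplies convergent points of \<open>A k\<close>, and these
  anchor the solutions of \<open>x + t y = z\<close>, which therefore have a cluster point. It
  belongs to \<open>L\<close>.\<close>

lemma kuratowski_limit_minty:
  fixes A :: "nat \<Rightarrow> ('a::euclidean_space \<times> 'a) set"
  assumes A: "kuratowski_limit A L" and mono: "\<And>k. minty (A k)" and ne: "L \<noteq> {}"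
  shows "minty L"
  unfolding minty_def
proof (intro conjI allI impI)
  show "monotone_graph L"
    using kuratowski_limit_monotone[OF A] mono minty_monotone by blast
  fix t :: real and z :: 'a assume t: "t > 0"
  obtain a b where ab: "(a, b) \<in> L" using ne by auto
  obtain \<zeta> where \<zeta>: "\<zeta> \<longlonglongrightarrow> (a, b)" "\<forall>\<^sub>F k in sequentially. \<zeta> k \<in> A k"
    by (rule kuratowski_limit_sequence[OF A ab])
  obtain N where N: "\<And>k. k \<ge> N \<Longrightarrow> \<zeta> k \<in> A k"
    using \<zeta>(2) by (auto simp: eventually_sequentially)
  have "\<exists>x y. (x, y) \<in> A k \<and> x + t *\<^sub>R y = z" for k
    using mono[of k] t unfolding minty_def by blast
  then obtain x y where xy: "\<And>k. (x k, y k) \<in> A k" "\<And>k. x k + t *\<^sub>R y k = z"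
    by metis
  let ?a = "\<lambda>k. fst (\<zeta> (k + N))" and ?b = "\<lambda>k. snd (\<zeta> (k + N))"
  have "(\<lambda>k. norm (?a k) + norm (z - ?a k - t *\<^sub>R ?b k)) \<longlonglongrightarrow>
      norm (fst (a, b)) + norm (z - fst (a, b) - t *\<^sub>R snd (a, b))"
    by (intro tendsto_intros LIMSEQ_ignore_initial_segment \<zeta>(1))
  then have "Bseq (\<lambda>k. norm (?a k) + norm (z - ?a k - t *\<^sub>R ?b k))"
    by (intro convergent_imp_Bseq convergentI)
  then obtain M where "\<And>k. norm (norm (?a k) + norm (z - ?a k - t *\<^sub>R ?b k)) \<le> M"
    unfolding Bseq_def by blast
  then have M: "norm (?a k) + norm (z - ?a k - t *\<^sub>R ?b k) \<le> M" for k
    by (metis abs_le_D1 real_norm_def)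
  have "norm (x (k + N)) \<le> M" for k
  proof -
    let ?x = "x (k + N)" and ?y = "y (k + N)"
    have "(?a k, ?b k) \<in> A (k + N)"
      using N[of "k + N"] by simp
    then have "0 \<le> (?x - ?a k) \<bullet> (?y - ?b k)"
      using monotone_graphD[OF minty_monotone[OF mono] xy(1)] by blast
    then have "0 \<le> t * ((?x - ?a k) \<bullet> (?y - ?b k))"
      using t by simp
    also have "\<dots> = (?x - ?a k) \<bullet> (t *\<^sub>R ?y - t *\<^sub>R ?b k)"
      by (simp add: inner_diff_right right_diff_distrib)
    also have "t *\<^sub>R ?y = z - ?x"
      using xy(2)[of "k + N"] by (simp add: eq_diff_eq add.commute)
    also have "(?x - ?a k) \<bullet> (z - ?x - t *\<^sub>R ?b k) =
        (?x - ?a k) \<bullet> (z - ?a k - t *\<^sub>R ?b k) - (norm (?x - ?a k))\<^sup>2"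
      unfolding power2_norm_eq_inner by (simp add: inner_diff_right)
    finally have "norm (?x - ?a k) * norm (?x - ?a k) \<le> norm (?x - ?a k) * norm (z - ?a k - t *\<^sub>R ?b k)"
      using norm_cauchy_schwarz[of "?x - ?a k" "z - ?a k - t *\<^sub>R ?b k"]
      by (simp add: power2_eq_square)
    \<comment> \<open>Nonexpansiveness of the resolvent: \<open>?x\<close> and \<open>?a k\<close>
      are the resolvents of \<open>z\<close> and of \<open>?a k + t *\<^sub>R ?b k\<close>.\<close>
    then have "norm (?x - ?a k) \<le> norm (z - ?a k - t *\<^sub>R ?b k)"
      by (cases "?x = ?a k") (auto simp: mult_le_cancel_left)
    then show ?thesis
      using M[of k] norm_triangle_sub[of ?x "?a k"] by linarith
  qed
  then have "bounded (range (\<lambda>k. x (k + N)))"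
    by (auto simp: bounded_iff)
  then obtain r x' where r: "strict_mono (r :: nat \<Rightarrow> nat)" and "((\<lambda>k. x (k + N)) \<circ> r) \<longlonglongrightarrow> x'"
    using bounded_imp_convergent_subsequence by blast
  then have x': "(\<lambda>k. x (r k + N)) \<longlonglongrightarrow> x'" by (simp add: o_def)
  have "y (r k + N) = (1 / t) *\<^sub>R (z - x (r k + N))" for k
    using t unfolding xy(2)[of "r k + N", symmetric] by simp
  then have y': "(\<lambda>k. y (r k + N)) \<longlonglongrightarrow> (1 / t) *\<^sub>R (z - x')"
    by (simp only:) (intro tendsto_intros x')
  have "(x', (1 / t) *\<^sub>R (z - x')) \<in> L"
  proof (rule kuratowski_limit_contains[OF A])
    show "strict_mono (\<lambda>k. r k + N)"
      using r by (simp add: strict_mono_def)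
    show "(x (r k + N), y (r k + N)) \<in> A (r k + N)" for k
      by (rule xy(1))
    show "(\<lambda>k. (x (r k + N), y (r k + N))) \<longlonglongrightarrow> (x', (1 / t) *\<^sub>R (z - x'))"
      by (intro tendsto_Pair x' y')
  qed
  then show "\<exists>x y. (x, y) \<in> L \<and> x + t *\<^sub>R y = z"
    using t by (intro exI[of _ x'] exI[of _ "(1 / t) *\<^sub>R (z - x')"]) simp
qed

section \<open>Uniform convergence of monotone graphs\<close>

lemma tendsto_0_ennrealI:
  fixes f :: "nat \<Rightarrow> ennreal"
  assumes "\<And>e::real. e > 0 \<Longrightarrow> \<forall>\<^sub>F n in sequentially. f n \<le> ennreal e"
  shows "f \<longlonglongrightarrow> 0"
proof (rule order_tendstoI)
  fix a :: ennreal assume "0 < a"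
  then obtain e where e: "0 < e" "ennreal e < a"
  proof (cases a)
    case (real r)
    then show ?thesis
      using that[of "r / 2"] \<open>0 < a\<close> by (simp add: ennreal_less_iff)
  next
    case top
    then show ?thesis
      using that[of 1] by simp
  qed
  show "\<forall>\<^sub>F n in sequentially. f n < a"
    using assms[OF e(1)] by eventually_elim (use e(2) in auto)
qed simp

lemma single_valued_atD: "single_valued_at T x \<Longrightarrow> T `` {x} = {val T x}"
  unfolding single_valued_at_def val_def by (simp add: is_singleton_the_elem)

lemma single_valued_at_eq: "single_valued_at T x \<Longrightarrow> (x, y) \<in> T \<longleftrightarrow> y = val T x"
  using single_valued_atD[of T x] by blast

lemma Image_eq_snd_image: "T `` K \<subseteq> B \<Longrightarrow> T `` K = snd ` (T \<inter> K \<times> B)"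
proof -
  assume "T `` K \<subseteq> B"
  then have "y \<in> T `` K \<longleftrightarrow> y \<in> snd ` (T \<inter> K \<times> B)" for y
    by (auto simp: image_iff Bex_def)
  then show ?thesis by blast
qed

lemma compact_Image:
  fixes T :: "('a::euclidean_space \<times> 'a) set"
  assumes "closed T" "compact K" "bounded (T `` K)"
  shows "compact (T `` K)"
proof -
  obtain B where "T `` K \<subseteq> cball 0 B"
    using assms(3) by (force simp: bounded_iff subset_eq)
  moreover have "compact (T \<inter> K \<times> cball 0 B)"
    using assms by (simp add: closed_Int_compact compact_Times)
  ultimately show ?thesis
    using Image_eq_snd_image[of T K "cball 0 B"] by (simp add: compact_continuous_image continuous_on_snd)
qed

text \<open>The set is the projection of a compact set of triples \<open>(x, y, z)\<close> with
  \<open>(x, z)\<close> in \<open>T\<close>. Closedness of the graph thus replaces an argument by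
  continuity of \<open>val T\<close>.\<close>

lemma compact_deviation:
  fixes T :: "('a::euclidean_space \<times> 'a) set"
  assumes T: "closed T" and K: "compact K" "bounded (T `` K)" "\<And>x. x \<in> K \<Longrightarrow> single_valued_at T x"
  shows "compact {(x, y). x \<in> K \<and> norm y \<le> B \<and> e \<le> norm (y - val T x)}"
proof -
  obtain C where C: "T `` K \<subseteq> cball 0 C"
    using K(2) by (force simp: bounded_iff subset_eq)
  let ?S = "((\<lambda>z. (fst z, snd (snd z))) -` T \<inter> {z. e \<le> norm (fst (snd z) - snd (snd z))}) \<inter>
      (K \<times> cball 0 B \<times> cball 0 C)"
  have "closed ((\<lambda>z. (fst z, snd (snd z))) -` T)"
    by (intro closed_vimage T continuous_intros)
  moreover have "closed {z :: 'a \<times> 'a \<times> 'a. e \<le> norm (fst (snd z) - snd (snd z))}"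
    by (intro closed_Collect_le continuous_intros)
  ultimately have "compact ?S"
    using K(1) by (intro closed_Int_compact closed_Int compact_Times) auto
  then have "compact ((\<lambda>z. (fst z, fst (snd z))) ` ?S)"
    by (intro compact_continuous_image continuous_intros)
  also have "(\<lambda>z. (fst z, fst (snd z))) ` ?S =
      {(x, y). x \<in> K \<and> norm y \<le> B \<and> e \<le> norm (y - val T x)}"
  proof (intro set_eqI iffI)
    fix p assume "p \<in> (\<lambda>z. (fst z, fst (snd z))) ` ?S"
    then obtain x y z where p: "p = (x, y)" "(x, z) \<in> T" "x \<in> K" "norm y \<le> B" "e \<le> norm (y - z)"
      by auto
    then have "z = val T x"
      using single_valued_at_eq[OF K(3)] by simp
    then show "p \<in> {(x, y). x \<in> K \<and> norm y \<le> B \<and> e \<le> norm (y - val T x)}"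
      using p by simp
  next
    fix p assume "p \<in> {(x, y). x \<in> K \<and> norm y \<le> B \<and> e \<le> norm (y - val T x)}"
    then obtain x y where p: "p = (x, y)" "x \<in> K" "norm y \<le> B" "e \<le> norm (y - val T x)"
      by auto
    then have x: "(x, val T x) \<in> T"
      using single_valued_at_eq[OF K(3)] by simp
    then have "val T x \<in> cball 0 C"
      using C p(2) by blast
    then have "(x, y, val T x) \<in> ?S"
      using p x by simp
    then show "p \<in> (\<lambda>z. (fst z, fst (snd z))) ` ?S"
      using p(1) by (intro image_eqI[of _ _ "(x, y, val T x)"]) auto
  qed
  finally show ?thesis .
qed

text \<open>Only sets over \<open>V\<close> are to be hit or missed, because subsequential limits
  are identified with \<open>T\<close> only there. The constant sequence is an instance, which
  yields the bounds for \<open>T\<close> itself.\<close>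

locale graph_convergence =
  fixes A :: "nat \<Rightarrow> ('a::euclidean_space \<times> 'a) set" and T V
  assumes minty_seq: "\<And>n. minty (A n)" and minty_lim: "minty T"
    and open_V: "open V" and V_Domain: "V \<subseteq> Domain T"
    and hit: "\<And>G. open G \<Longrightarrow> G \<subseteq> V \<times> UNIV \<Longrightarrow> T \<inter> G \<noteq> {} \<Longrightarrow> \<forall>\<^sub>F n in sequentially. A n \<inter> G \<noteq> {}"
    and miss: "\<And>K. compact K \<Longrightarrow> K \<subseteq> V \<times> UNIV \<Longrightarrow> T \<inter> K = {} \<Longrightarrow> \<forall>\<^sub>F n in sequentially. A n \<inter> K = {}"
begin

text \<open>Finitely many points of \<open>T\<close> whose base points surround \<open>x\<close> are
  eventually approximated by points of \<open>A n\<close>. Their base points surround every point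
  near \<open>x\<close>, which gives membership in the domain and a bound on the values at
  once.\<close>

lemma eventually_locally_bounded:
  assumes x: "x \<in> V"
  obtains \<delta> B where "\<delta> > 0" "\<forall>\<^sub>F n in sequentially. ball x \<delta> \<subseteq> Domain (A n) \<and> A n `` ball x \<delta> \<subseteq> cball 0 B"
proof -
  obtain F \<rho> where F: "finite F" "F \<subseteq> V \<inter> V" "\<rho> > 0" "surrounds \<rho> x F"
    by (rule surrounds_dense[OF open_V x closure_subset])
  have "\<forall>a\<in>F. \<exists>b. (a, b) \<in> T" using F(2) V_Domain by blast
  then obtain g where g: "\<And>a. a \<in> F \<Longrightarrow> (a, g a) \<in> T"
    by metis
  obtain \<alpha> where \<alpha>: "\<alpha> > 0" "\<And>a. a \<in> F \<Longrightarrow> norm (a - x) \<le> \<alpha>"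
    using finite_norm_bound[OF F(1), of "\<lambda>a. a - x"] by blast
  obtain \<beta> where \<beta>: "\<beta> > 0" "\<And>a. a \<in> F \<Longrightarrow> norm (g a) \<le> \<beta>"
    using finite_norm_bound[OF F(1), of g] by blast
  \<comment> \<open>The radius \<open>\<rho>\<close> loses one \<open>\<delta>\<close> to the centre
    and one to the surrounding points; half of it remains.\<close>
  define \<delta> where "\<delta> = \<rho> / 4"
  have \<delta>: "\<delta> > 0" using F(3) by (simp add: \<delta>_def)
  let ?G = "\<lambda>a. (ball a \<delta> \<inter> V) \<times> ball (g a) 1"
  have "\<forall>\<^sub>F n in sequentially. A n \<inter> ?G a \<noteq> {}" if a: "a \<in> F" for a
  proof (rule hit)
    show "open (?G a)" using open_V by (intro open_Times) auto
    show "?G a \<subseteq> V \<times> UNIV" by blast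
    have "(a, g a) \<in> ?G a" using a F(2) \<delta> by auto
    then show "T \<inter> ?G a \<noteq> {}" using g[OF a] by blast
  qed
  then have "\<forall>\<^sub>F n in sequentially. \<forall>a\<in>F. A n \<inter> ?G a \<noteq> {}"
    using F(1) by (intro eventually_ball_finite) auto
  then have "\<forall>\<^sub>F n in sequentially. ball x \<delta> \<subseteq> Domain (A n) \<and>
      A n `` ball x \<delta> \<subseteq> cball 0 ((\<alpha> + \<delta> + \<delta>) * (\<beta> + 1) / (\<rho> - \<delta> - \<delta>))"
  proof eventually_elim
    case (elim n)
    have "\<forall>a\<in>F. \<exists>z. z \<in> A n \<inter> ?G a" using elim by blast
    then obtain \<zeta> where \<zeta>: "\<forall>a\<in>F. \<zeta> a \<in> A n \<inter> ?G a"
      by (rule bchoice[THEN exE])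
    define p q where "p a = fst (\<zeta> a)" and "q a = snd (\<zeta> a)" for a
    have pq: "(p a, q a) \<in> A n \<and> dist a (p a) < \<delta> \<and> dist (g a) (q a) < 1" if "a \<in> F" for a
      using bspec[OF \<zeta> that] by (auto simp: p_def q_def mem_Times_iff)
    have sur: "surrounds (\<rho> - \<delta> - \<delta>) x' (p ` F)" if "x' \<in> ball x \<delta>" for x'
      using that pq by (intro surrounds_perturb[OF F(4)]) (auto intro: less_imp_le)
    have pos: "\<rho> - \<delta> - \<delta> > 0" using F(3) by (simp add: \<delta>_def)
    have "p ` F \<subseteq> Domain (A n)"
      using pq by blast
    then have "ball x \<delta> \<subseteq> Domain (A n)"
      using minty_surrounds_in_Domain[OF minty_seq sur pos finite_imageI[OF F(1)]] by blast
    moreover have "norm y \<le> (\<alpha> + \<delta> + \<delta>) * (\<beta> + 1) / (\<rho> - \<delta> - \<delta>)"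
      if x': "x' \<in> ball x \<delta>" and y: "(x', y) \<in> A n" for x' y
    proof (rule monotone_bound[OF minty_monotone[OF minty_seq] sur[OF x'] _ y])
      fix a' assume "a' \<in> p ` F"
      then obtain a where a: "a \<in> F" "a' = p a" by blast
      have "norm (p a - x') \<le> norm (a - x) + dist a (p a) + dist x x'"
        using norm_triangle_ineq4[of "a - x" "a - p a"] norm_triangle_ineq[of "p a - x" "x - x'"]
        by (simp add: dist_norm)
      then have "norm (p a - x') \<le> \<alpha> + \<delta> + \<delta>"
        using \<alpha>(2)[OF a(1)] pq[OF a(1)] x' by simp
      moreover have "norm (q a) \<le> \<beta> + 1"
        using \<beta>(2)[OF a(1)] pq[OF a(1)] norm_triangle_ineq4[of "g a" "g a - q a"]
        by (simp add: dist_norm)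
      ultimately show "\<exists>b. (a', b) \<in> A n \<and> norm (a' - x') \<le> \<alpha> + \<delta> + \<delta> \<and> norm b \<le> \<beta> + 1"
        using a pq[OF a(1)] by blast
    qed (use \<alpha> \<beta> \<delta> pos in auto)
    ultimately show ?case by auto
  qed
  then show ?thesis using that \<delta> by blast
qed

lemma eventually_bounded_on_compact:
  assumes K: "compact K" "K \<subseteq> V"
  obtains B where "\<forall>\<^sub>F n in sequentially. K \<subseteq> interior (Domain (A n)) \<and> A n `` K \<subseteq> cball 0 B"
proof -
  let ?R = "\<lambda>x \<delta> B. \<forall>\<^sub>F n in sequentially. ball x \<delta> \<subseteq> Domain (A n) \<and> A n `` ball x \<delta> \<subseteq> cball 0 B"
  have "\<forall>x\<in>K. \<exists>d. fst d > 0 \<and> ?R x (fst d) (snd d)"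
  proof
    fix x assume "x \<in> K"
    then have "x \<in> V" using K by blast
    then obtain \<delta> B where "\<delta> > 0" "?R x \<delta> B" by (rule eventually_locally_bounded)
    then show "\<exists>d. fst d > 0 \<and> ?R x (fst d) (snd d)"
      by (intro exI[of _ "(\<delta>, B)"]) simp
  qed
  then obtain d where d: "\<forall>x\<in>K. fst (d x) > 0 \<and> ?R x (fst (d x)) (snd (d x))"
    by (rule bchoice[THEN exE])
  define \<delta> B where "\<delta> x = fst (d x)" and "B x = snd (d x)" for x
  have \<delta>: "\<delta> x > 0" "?R x (\<delta> x) (B x)" if "x \<in> K" for x
    using bspec[OF d that] by (simp_all add: \<delta>_def B_def)
  obtain C where C: "C \<subseteq> K" "finite C" "K \<subseteq> (\<Union>x\<in>C. ball x (\<delta> x))"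
    by (rule compactE_image[OF K(1), of K "\<lambda>x. ball x (\<delta> x)"]) (use \<delta>(1) in auto)
  obtain M where M: "\<And>x. x \<in> C \<Longrightarrow> norm (B x) \<le> M"
    using finite_norm_bound[OF C(2), of B] by blast
  have "\<forall>\<^sub>F n in sequentially. \<forall>x\<in>C. ball x (\<delta> x) \<subseteq> Domain (A n) \<and> A n `` ball x (\<delta> x) \<subseteq> cball 0 (B x)"
    using C \<delta>(2) by (intro eventually_ball_finite) auto
  then have "\<forall>\<^sub>F n in sequentially. K \<subseteq> interior (Domain (A n)) \<and> A n `` K \<subseteq> cball 0 M"
  proof eventually_elim
    case (elim n)
    have "x' \<in> interior (Domain (A n)) \<and> (\<forall>y. (x', y) \<in> A n \<longrightarrow> y \<in> cball 0 M)" if x': "x' \<in> K" for x'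
    proof -
      obtain x where x: "x \<in> C" "x' \<in> ball x (\<delta> x)" using C(3) x' by blast
      then have "ball x (\<delta> x) \<subseteq> interior (Domain (A n))"
        using elim by (intro interior_maximal) auto
      moreover have "y \<in> cball 0 M" if "(x', y) \<in> A n" for y
      proof -
        have "y \<in> cball 0 (B x)" using elim x that by blast
        then show ?thesis using M[OF x(1)] by simp
      qed
      ultimately show ?thesis using x by blast
    qed
    then show ?case by blast
  qed
  then show ?thesis by (rule that)
qed

lemma limit_bounded_on_compact:
  assumes K: "compact K" "K \<subseteq> V"
  shows "bounded (T `` K)" "compact (T `` K)"
proof -
  \<comment> \<open>Hits and misses of a constant sequence are immediate.\<close>
  interpret const: graph_convergence "\<lambda>_. T" T V
    by unfold_locales (use minty_lim open_V V_Domain in auto)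
  obtain B where "\<forall>\<^sub>F n in sequentially. K \<subseteq> interior (Domain T) \<and> T `` K \<subseteq> cball 0 B"
    by (rule const.eventually_bounded_on_compact[OF K])
  then have "T `` K \<subseteq> cball 0 B" by simp
  then show "bounded (T `` K)"
    using bounded_cball bounded_subset by blast
  then show "compact (T `` K)"
    using compact_Image[OF minty_closed[OF minty_lim] K(1)] by blast
qed

lemma eventually_in_interior_Domain:
  assumes K: "compact K" "K \<subseteq> V"
  shows "\<forall>\<^sub>F n in sequentially. K \<subseteq> interior (Domain (A n)) \<and> compact (A n `` K)"
proof -
  obtain B where "\<forall>\<^sub>F n in sequentially. K \<subseteq> interior (Domain (A n)) \<and> A n `` K \<subseteq> cball 0 B"
    by (rule eventually_bounded_on_compact[OF K])
  then show ?thesis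
    by eventually_elim
      (use compact_Image[OF minty_closed[OF minty_seq] K(1)] bounded_subset[OF bounded_cball] in blast)
qed

text \<open>Values of \<open>A n\<close> over \<open>K\<close> far from \<open>T(K)\<close> lie in a
  compact set missed by \<open>T\<close>. Conversely, a value over the interior of \<open>K\<close>
  is approached because an open set over that interior is hit. At a frontier point the nearby points
  of \<open>A n\<close> may lie over the outside of \<open>K\<close>; there single-valuedness forces
  the values of \<open>A n\<close> at the same point towards that of \<open>T\<close>.\<close>

lemma hausdorff_convergence:
  assumes K: "compact K" "K \<subseteq> V" and sv: "\<And>x. x \<in> frontier K \<Longrightarrow> single_valued_at T x"
  shows "(\<lambda>n. hausdorff_dist (A n `` K) (T `` K)) \<longlonglongrightarrow> 0"
proof (rule tendsto_0_ennrealI)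
  fix e :: real assume e: "e > 0"
  obtain B where B: "\<forall>\<^sub>F n in sequentially. K \<subseteq> interior (Domain (A n)) \<and> A n `` K \<subseteq> cball 0 B"
    by (rule eventually_bounded_on_compact[OF K])
  have far: "\<forall>\<^sub>F n in sequentially. A n \<inter> K \<times> (cball 0 B \<inter> {y. \<forall>z\<in>T `` K. e \<le> dist y z}) = {}"
  proof (rule miss)
    have "{y. \<forall>z\<in>T `` K. e \<le> dist y z} = (\<Inter>z\<in>T `` K. {y. e \<le> dist y z})" by auto
    moreover have "closed (\<Inter>z\<in>T `` K. {y. e \<le> dist y z})"
      by (intro closed_INT ballI closed_Collect_le continuous_intros)
    ultimately have "closed {y. \<forall>z\<in>T `` K. e \<le> dist y z}" by simp
    then show "compact (K \<times> (cball 0 B \<inter> {y. \<forall>z\<in>T `` K. e \<le> dist y z}))"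
      using K by (intro compact_Times compact_Int_closed) auto
    show "K \<times> (cball 0 B \<inter> {y. \<forall>z\<in>T `` K. e \<le> dist y z}) \<subseteq> V \<times> UNIV"
      using K by blast
    show "T \<inter> K \<times> (cball 0 B \<inter> {y. \<forall>z\<in>T `` K. e \<le> dist y z}) = {}"
      using e by force
  qed
  have near: "\<forall>\<^sub>F n in sequentially. \<exists>w\<in>A n `` K. dist y w < e / 2" if y: "y \<in> T `` K" for y
  proof -
    obtain x where x: "x \<in> K" "(x, y) \<in> T" using y by blast
    show ?thesis
    proof (cases "x \<in> interior K")
      case True
      have "\<forall>\<^sub>F n in sequentially. A n \<inter> interior K \<times> ball y (e / 2) \<noteq> {}"
      proof (rule hit)
        show "interior K \<times> ball y (e / 2) \<subseteq> V \<times> UNIV"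
          using K interior_subset by blast
        show "T \<inter> interior K \<times> ball y (e / 2) \<noteq> {}"
          using True x e by force
      qed (auto intro: open_Times)
      then show ?thesis
        by eventually_elim (use interior_subset in fastforce)
    next
      case False
      then have "x \<in> frontier K"
        using x(1) closure_subset by (auto simp: frontier_def)
      then have Tx: "z = y" if "(x, z) \<in> T" for z
        using single_valued_at_eq[OF sv] x(2) that by simp
      have "\<forall>\<^sub>F n in sequentially. A n \<inter> {x} \<times> (cball 0 B - ball y (e / 2)) = {}"
      proof (rule miss)
        show "compact ({x} \<times> (cball 0 B - ball y (e / 2)))"
          by (intro compact_Times compact_diff) auto
        show "{x} \<times> (cball 0 B - ball y (e / 2)) \<subseteq> V \<times> UNIV"
          using K x(1) by blast
        show "T \<inter> {x} \<times> (cball 0 B - ball y (e / 2)) = {}"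
          using e Tx by auto
      qed
      then show ?thesis
        using B
      proof eventually_elim
        case (elim n)
        then obtain w where w: "(x, w) \<in> A n"
          using x(1) interior_subset by blast
        then have "w \<in> cball 0 B" using elim x(1) by blast
        then have "w \<in> ball y (e / 2)" using elim(1) w by blast
        then show ?case using w x(1) by auto
      qed
    qed
  qed
  \<comment> \<open>A finite \<open>e / 2\<close>-net of \<open>T(K)\<close> makes the pointwise
    approximation uniform.\<close>
  obtain C where C: "C \<subseteq> T `` K" "finite C" "T `` K \<subseteq> (\<Union>y\<in>C. ball y (e / 2))"
    by (rule compactE_image[OF limit_bounded_on_compact(2)[OF K], of "T `` K" "\<lambda>y. ball y (e / 2)"])
      (use e in auto)
  then have "\<forall>\<^sub>F n in sequentially. \<forall>y\<in>C. \<exists>w\<in>A n `` K. dist y w < e / 2"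
    using near by (intro eventually_ball_finite) auto
  then show "\<forall>\<^sub>F n in sequentially. hausdorff_dist (A n `` K) (T `` K) \<le> ennreal e"
    using far B
  proof eventually_elim
    case (elim n)
    have "dist_to a (T `` K) \<le> ennreal e" if a: "a \<in> A n `` K" for a
    proof -
      obtain x where "x \<in> K" "(x, a) \<in> A n" using a by blast
      moreover have "a \<in> cball 0 B" using elim a by blast
      ultimately have "\<not> (\<forall>z\<in>T `` K. e \<le> dist a z)"
        using elim(2) by blast
      then obtain z where z: "z \<in> T `` K" "dist a z < e"
        by (auto simp: not_le)
      have "dist_to a (T `` K) \<le> ennreal (dist a z)"
        unfolding dist_to_def by (rule INF_lower[OF z(1)])
      also have "\<dots> \<le> ennreal e" using z(2) by (intro ennreal_leI) simp
      finally show ?thesis .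
    qed
    moreover have "dist_to b (A n `` K) \<le> ennreal e" if b: "b \<in> T `` K" for b
    proof -
      obtain y where y: "y \<in> C" "dist y b < e / 2" using C(3) b by auto
      obtain w where w: "w \<in> A n `` K" "dist y w < e / 2" using elim(1) y(1) by blast
      have "dist_to b (A n `` K) \<le> ennreal (dist b w)"
        unfolding dist_to_def by (rule INF_lower[OF w(1)])
      also have "\<dots> \<le> ennreal e"
        using y(2) w(2) dist_triangle3[of b w y] by (intro ennreal_leI) simp
      finally show ?thesis .
    qed
    ultimately show ?case
      unfolding hausdorff_dist_def by (intro max.boundedI SUP_least) auto
  qed
qed

text \<open>The eventual bound \<open>B\<close> confines all violations to a compact set over
  \<open>K\<close>, which \<open>T\<close> misses by single-valuedness.\<close>

lemma sup_deviation_convergence: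
  assumes K: "compact K" "K \<subseteq> V" and sv: "\<And>x. x \<in> K \<Longrightarrow> single_valued_at T x"
  shows "(\<lambda>n. sup_deviation (A n) T K) \<longlonglongrightarrow> 0"
proof (rule tendsto_0_ennrealI)
  fix e :: real assume e: "e > 0"
  obtain B where B: "\<forall>\<^sub>F n in sequentially. K \<subseteq> interior (Domain (A n)) \<and> A n `` K \<subseteq> cball 0 B"
    by (rule eventually_bounded_on_compact[OF K])
  let ?D = "{(x, y). x \<in> K \<and> norm y \<le> B \<and> e \<le> norm (y - val T x)}"
  have "\<forall>\<^sub>F n in sequentially. A n \<inter> ?D = {}"
  proof (rule miss)
    show "compact ?D"
      by (intro compact_deviation minty_closed[OF minty_lim] K limit_bounded_on_compact sv)
    show "?D \<subseteq> V \<times> UNIV" using K by blast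
    have "y = val T x" if "x \<in> K" "(x, y) \<in> T" for x y
      using single_valued_at_eq[OF sv] that by simp
    then show "T \<inter> ?D = {}" using e by fastforce
  qed
  then show "\<forall>\<^sub>F n in sequentially. sup_deviation (A n) T K \<le> ennreal e"
    using B
  proof eventually_elim
    case (elim n)
    have "norm (y - val T x) \<le> e" if "x \<in> K" "(x, y) \<in> A n" for x y
    proof (rule ccontr)
      assume "\<not> ?thesis"
      moreover have "y \<in> cball 0 B" using elim(2) that by blast
      ultimately have "(x, y) \<in> ?D" using that by simp
      then show False using elim(1) that(2) by blast
    qed
    then show ?case
      unfolding sup_deviation_def by (auto intro!: SUP_least ennreal_leI)
  qed
qed

end

section \<open>Graphs with bounded range\<close>

text \<open>For the inverses, \<open>S\<close> has a domain dense in the interior of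
  \<open>Range T\<close>, so they agree over that interior. The inclusion of \<open>Range L\<close>
  in the closure of \<open>Range T\<close> allows extension to the boundary, giving
  \<open>L \<subseteq> T\<close>; maximality of \<open>L\<close> gives the rest.\<close>

lemma minty_eq_of_dense_Range:
  fixes T L :: "('a::euclidean_space \<times> 'a) set"
  assumes T: "minty T" and L: "minty L" and S: "S \<subseteq> T" "S \<subseteq> L"
    and rge: "Range S \<subseteq> interior (Range T)" "Range T \<subseteq> closure (Range S)" "Range L \<subseteq> closure (Range T)"
  shows "L = T"
proof -
  let ?V = "interior (Range T)"
  have minty: "minty (T\<inverse>)" "minty (L\<inverse>)"
    using T L by (auto intro: minty_converse)
  have dense: "?V \<subseteq> closure (Domain (S\<inverse>))"
    using subset_trans[OF interior_subset rge(2)] by simp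
  have "(v, x) \<in> L\<inverse> \<longleftrightarrow> (v, x) \<in> T\<inverse>" if v: "v \<in> ?V" for v x
    using minty_contains_monotone[OF minty(1) minty_monotone[OF minty(2)] _ _ open_interior dense v]
      minty_contains_monotone[OF minty(2) minty_monotone[OF minty(1)] _ _ open_interior dense v] S
    by blast
  have eq: "(x, v) \<in> L \<longleftrightarrow> (x, v) \<in> T" if "v \<in> ?V" for v x
    using \<open>\<And>v x. v \<in> ?V \<Longrightarrow> (v, x) \<in> L\<inverse> \<longleftrightarrow> (v, x) \<in> T\<inverse>\<close>[OF that] by simp
  have cl: "Range T \<subseteq> closure ?V"
    using rge(1,2) closure_mono by blast
  then have cl': "Range L \<subseteq> closure ?V"
    using rge(3) closure_minimal closed_closure by blast
  have ne: "?V \<noteq> {}"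
    using cl minty_nonempty[OF T] by fastforce
  have conv: "convex ?V"
    using minty_Domain_convex_interior[OF minty(1)] by simp
  have "L\<inverse> \<subseteq> T\<inverse>"
  proof (rule minty_eq_on_interior_imp_subset[of _ _ ?V])
    show "?V \<subseteq> Domain (T\<inverse>)" using interior_subset by (simp add: Domain_converse)
  qed (use minty minty_monotone conv ne cl cl' eq in auto)
  moreover have "(x, y) \<in> L" if xy: "(x, y) \<in> T" for x y
  proof (rule minty_maximal[OF L])
    fix a b assume "(a, b) \<in> L"
    then have "(a, b) \<in> T" using \<open>L\<inverse> \<subseteq> T\<inverse>\<close> by blast
    then show "0 \<le> (x - a) \<bullet> (y - b)"
      using monotone_graphD[OF minty_monotone[OF T] xy] by blast
  qed
  ultimately show ?thesis by auto
qed

text \<open>Divide the monotonicity inequality by \<open>norm (x n)\<close>: the convergent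
  \<open>\<alpha> n\<close> become negligible and only the direction \<open>u\<close>
  remains.\<close>

lemma limit_value_in_arg_max:
  fixes A :: "nat \<Rightarrow> ('a::euclidean_space \<times> 'a) set"
  assumes mono: "\<And>n. monotone_graph (A n)" and ab: "\<alpha> \<longlonglongrightarrow> a" "\<beta> \<longlonglongrightarrow> b"
    "\<forall>\<^sub>F n in sequentially. (\<alpha> n, \<beta> n) \<in> A n"
    and xy: "\<And>n. (x n, y n) \<in> A n" "y \<longlonglongrightarrow> y'"
    and x: "filterlim (\<lambda>n. norm (x n)) at_top sequentially" "(\<lambda>n. x n /\<^sub>R norm (x n)) \<longlonglongrightarrow> u"
  shows "b \<bullet> u \<le> y' \<bullet> u"
proof -
  have inv: "(\<lambda>n. inverse (norm (x n))) \<longlonglongrightarrow> 0"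
    by (rule tendsto_inverse_0_at_top[OF x(1)])
  have "(\<lambda>n. (x n /\<^sub>R norm (x n) - inverse (norm (x n)) *\<^sub>R \<alpha> n) \<bullet> (y n - \<beta> n)) \<longlonglongrightarrow>
      (u - 0 *\<^sub>R a) \<bullet> (y' - b)"
    by (intro tendsto_intros x(2) inv ab xy(2))
  moreover have "\<forall>\<^sub>F n in sequentially. 0 \<le> (x n /\<^sub>R norm (x n) - inverse (norm (x n)) *\<^sub>R \<alpha> n) \<bullet> (y n - \<beta> n)"
    using ab(3)
  proof eventually_elim
    case (elim n)
    have "0 \<le> inverse (norm (x n)) * ((x n - \<alpha> n) \<bullet> (y n - \<beta> n))"
      using monotone_graphD[OF mono xy(1) elim] by simp
    then show ?case by (simp flip: scaleR_right_diff_distrib)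
  qed
  ultimately have "0 \<le> (u - 0 *\<^sub>R a) \<bullet> (y' - b)"
    by (intro tendsto_lowerbound[of _ "(u - 0 *\<^sub>R a) \<bullet> (y' - b)" sequentially]) auto
  then show ?thesis by (simp add: inner_diff_right inner_commute)
qed

text \<open>Along points of \<open>E\<close> escaping to infinity in direction \<open>u\<close>, both \<open>A n\<close> and \<open>T\<close> take values
  converging to the unique maximiser of \<open>c \<mapsto> c \<bullet> u\<close> over \<open>closure (Range T)\<close>.\<close>

lemma sup_deviation_convergence_unbounded:
  fixes A :: "nat \<Rightarrow> ('a::euclidean_space \<times> 'a) set"
  assumes minty: "\<And>n. minty (A n)" "minty T" and lim: "kuratowski_limit A T"
    and rge: "\<And>n. Range (A n) \<subseteq> closure (Range T)" "bounded (Range T)"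
    and sv: "\<And>x. x \<in> closure E \<Longrightarrow> single_valued_at T x"
    and dir: "\<And>u. norm u = 1 \<Longrightarrow> recedes_in_direction E u \<Longrightarrow>
      strictly_convex_in_direction (closure (Range T)) u"
  shows "(\<lambda>n. sup_deviation (A n) T E) \<longlonglongrightarrow> 0"
proof (rule tendsto_0_ennrealI)
  fix e :: real assume e: "e > 0"
  show "\<forall>\<^sub>F n in sequentially. sup_deviation (A n) T E \<le> ennreal e"
  proof (rule ccontr)
    assume "\<not> ?thesis"
    then obtain s :: "nat \<Rightarrow> nat" where s: "strict_mono s" "\<And>k. \<not> sup_deviation (A (s k)) T E \<le> ennreal e"
      by (rule not_eventually_subseq) blast
    have "\<exists>x y. x \<in> E \<and> (x, y) \<in> A (s k) \<and> e < norm (y - val T x)" for k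
    proof (rule ccontr)
      assume "\<not> ?thesis"
      then have "sup_deviation (A (s k)) T E \<le> ennreal e"
        unfolding sup_deviation_def by (auto intro!: SUP_least ennreal_leI simp: not_less)
      then show False using s(2) by blast
    qed
    then obtain x y where xy: "\<And>k. x k \<in> E" "\<And>k. (x k, y k) \<in> A (s k)" "\<And>k. e < norm (y k - val T (x k))"
      by metis
    have xT: "(x k, val T (x k)) \<in> T" for k
      using single_valued_at_eq[OF sv, of "x k"] xy(1) closure_subset by blast
    have bcl: "bounded (closure (Range T))" using rge(2) by (rule bounded_closure)
    have ycl: "y k \<in> closure (Range T)" and wcl: "val T (x k) \<in> closure (Range T)" for k
      using rge(1)[of "s k"] xy(2)[of k] xT[of k] closure_subset[of "Range T"] by blast+
    have "bounded (range (\<lambda>k. (y k, val T (x k))))"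
      by (rule bounded_subset[OF bounded_Times[OF bcl bcl]]) (use ycl wcl in auto)
    then obtain q where q: "strict_mono (q :: nat \<Rightarrow> nat)" "\<exists>l. ((\<lambda>k. (y k, val T (x k))) \<circ> q) \<longlonglongrightarrow> l"
      using bounded_imp_convergent_subsequence by blast
    then obtain l where l: "(\<lambda>k. (y (q k), val T (x (q k)))) \<longlonglongrightarrow> l" by (auto simp: o_def)
    define y' w' where "y' = fst l" and "w' = snd l"
    have yw: "(\<lambda>k. y (q k)) \<longlonglongrightarrow> y'" "(\<lambda>k. val T (x (q k))) \<longlonglongrightarrow> w'"
      using tendsto_fst[OF l] tendsto_snd[OF l] by (simp_all add: y'_def w'_def)
    have "e \<le> norm (y' - w')"
      by (rule tendsto_lowerbound[OF tendsto_norm[OF tendsto_diff[OF yw]]])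
        (simp_all add: less_imp_le[OF xy(3)])
    then have neq: "y' \<noteq> w'" using e by auto
    have sq: "strict_mono (\<lambda>k. s (q k))"
      using s(1) q(1) by (simp add: strict_mono_def)
    \<comment> \<open>If base points converged along a subsequence, both limits \<open>y'\<close>
      and \<open>w'\<close> would be values of \<open>T\<close> at a point of
      \<open>closure E\<close>, against single-valuedness there.\<close>
    have x_bounded: False if p: "strict_mono (p :: nat \<Rightarrow> nat)" "(\<lambda>k. x (q (p k))) \<longlonglongrightarrow> x'" for p x'
    proof -
      have yw': "(\<lambda>k. y (q (p k))) \<longlonglongrightarrow> y'" "(\<lambda>k. val T (x (q (p k)))) \<longlonglongrightarrow> w'"
        using yw[THEN LIMSEQ_subseq_LIMSEQ, OF p(1)] by (simp_all add: o_def)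
      have "(x', y') \<in> T"
        by (rule kuratowski_limit_contains[OF lim, of "\<lambda>k. s (q (p k))" "\<lambda>k. (x (q (p k)), y (q (p k)))"])
          (use sq p xy(2) yw' in \<open>auto simp: strict_mono_def intro: tendsto_Pair\<close>)
      moreover have "(x', w') \<in> T"
        by (rule minty_limit[OF minty(2) xT p(2) yw'(2)])
      moreover have "x' \<in> closure E"
        unfolding closure_sequential using xy(1) p(2) by (intro exI[of _ "\<lambda>k. x (q (p k))"]) simp
      note single_valued_at_eq[OF sv[OF this]]
      ultimately show False using neq by simp
    qed
    have "filterlim (\<lambda>k. norm (x (q k))) at_top sequentially"
      unfolding filterlim_at_top
    proof (rule ccontr)
      assume "\<not> (\<forall>Z. \<forall>\<^sub>F k in sequentially. Z \<le> norm (x (q k)))"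
      then obtain Z where "\<not> (\<forall>\<^sub>F k in sequentially. Z \<le> norm (x (q k)))" by blast
      then obtain p :: "nat \<Rightarrow> nat" where p: "strict_mono p" "\<And>k. \<not> Z \<le> norm (x (q (p k)))"
        by (rule not_eventually_subseq) blast
      have "bounded (range (\<lambda>k. x (q (p k))))"
        using p(2) by (auto simp: bounded_iff not_le intro!: exI[of _ Z] less_imp_le)
      then obtain p' x' where p': "strict_mono (p' :: nat \<Rightarrow> nat)" "((\<lambda>k. x (q (p k))) \<circ> p') \<longlonglongrightarrow> x'"
        using bounded_imp_convergent_subsequence by blast
      have "strict_mono (\<lambda>k. p (p' k))"
        using p(1) p'(1) by (simp add: strict_mono_def)
      then show False
        using p'(2) x_bounded[of "\<lambda>k. p (p' k)" x'] by (simp add: o_def)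
    qed
    note xinf = this
    have "bounded (range (\<lambda>k. x (q k) /\<^sub>R norm (x (q k))))"
      by (auto simp: bounded_iff field_simps intro!: exI[of _ 1])
    then obtain p u where p: "strict_mono (p :: nat \<Rightarrow> nat)"
        "((\<lambda>k. x (q k) /\<^sub>R norm (x (q k))) \<circ> p) \<longlonglongrightarrow> u"
      using bounded_imp_convergent_subsequence by blast
    let ?r = "\<lambda>k. q (p k)"
    have u: "(\<lambda>k. x (?r k) /\<^sub>R norm (x (?r k))) \<longlonglongrightarrow> u"
      using p(2) by (simp add: o_def)
    have inf: "filterlim (\<lambda>k. norm (x (?r k))) at_top sequentially"
      using filterlim_compose[OF xinf filterlim_subseq[OF p(1)]] by simp
    have "\<forall>\<^sub>F k in sequentially. norm (x (?r k)) \<ge> 1"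
      using inf by (simp add: filterlim_at_top)
    then have "\<forall>\<^sub>F k in sequentially. norm (x (?r k) /\<^sub>R norm (x (?r k))) = 1"
    proof eventually_elim
      case (elim k)
      then have "norm (x (?r k)) \<noteq> 0" by linarith
      then show ?case by simp
    qed
    then have "(\<lambda>k. norm (x (?r k) /\<^sub>R norm (x (?r k)))) \<longlonglongrightarrow> 1"
      by (rule tendsto_eventually)
    then have nu: "norm u = 1"
      using tendsto_norm[OF u] LIMSEQ_unique by blast
    have "recedes_in_direction E u"
      unfolding recedes_in_direction_def using u inf xy(1) by (intro exI[of _ "\<lambda>k. x (?r k)"]) auto
    then have sc: "strictly_convex_in_direction (closure (Range T)) u"
      using dir nu by blast
    have yw': "(\<lambda>k. y (?r k)) \<longlonglongrightarrow> y'" "(\<lambda>k. val T (x (?r k))) \<longlonglongrightarrow> w'"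
      using yw[THEN LIMSEQ_subseq_LIMSEQ, OF p(1)] by (simp_all add: o_def)
    have srp: "strict_mono (\<lambda>k. s (?r k))"
      using sq p(1) by (simp add: strict_mono_def)
    have max: "b \<bullet> u \<le> y' \<bullet> u \<and> b \<bullet> u \<le> w' \<bullet> u" if b: "b \<in> Range T" for b
    proof
      obtain a where a: "(a, b) \<in> T" using b by blast
      obtain \<zeta> where \<zeta>: "\<zeta> \<longlonglongrightarrow> (a, b)" "\<forall>\<^sub>F k in sequentially. \<zeta> k \<in> A k"
        by (rule kuratowski_limit_sequence[OF lim a])
      have "(\<lambda>k. fst (\<zeta> (s (?r k)))) \<longlonglongrightarrow> a" "(\<lambda>k. snd (\<zeta> (s (?r k)))) \<longlonglongrightarrow> b"
        using LIMSEQ_subseq_LIMSEQ[OF tendsto_fst[OF \<zeta>(1)] srp]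
          LIMSEQ_subseq_LIMSEQ[OF tendsto_snd[OF \<zeta>(1)] srp] by (simp_all add: o_def)
      then show "b \<bullet> u \<le> y' \<bullet> u"
        by (rule limit_value_in_arg_max[of "\<lambda>k. A (s (?r k))", OF minty_monotone[OF minty(1)] _ _ _ xy(2) yw'(1) inf u])
          (use eventually_subseq[OF srp \<zeta>(2)] in auto)
      show "b \<bullet> u \<le> w' \<bullet> u"
        by (rule limit_value_in_arg_max[of "\<lambda>k. T" "\<lambda>_. a" a "\<lambda>_. b", OF minty_monotone[OF minty(2)] _ _ _ xT yw'(2) inf u])
          (use a in auto)
    qed
    have "closure (Range T) \<subseteq> {c. u \<bullet> c \<le> y' \<bullet> u}"
      by (intro closure_minimal closed_halfspace_le) (use max in \<open>auto simp: inner_commute[of u]\<close>)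
    moreover have "closure (Range T) \<subseteq> {c. u \<bullet> c \<le> w' \<bullet> u}"
      by (intro closure_minimal closed_halfspace_le) (use max in \<open>auto simp: inner_commute[of u]\<close>)
    moreover have "y' \<in> closure (Range T)"
      by (rule closed_sequentially[OF closed_closure _ yw(1)]) (rule ycl)
    moreover have "w' \<in> closure (Range T)"
      by (rule closed_sequentially[OF closed_closure _ yw(2)]) (rule wcl)
    ultimately have "y' \<in> {c. is_arg_max (\<lambda>c. c \<bullet> u) (\<lambda>c. c \<in> closure (Range T)) c}"
      "w' \<in> {c. is_arg_max (\<lambda>c. c \<bullet> u) (\<lambda>c. c \<in> closure (Range T)) c}"
      by (auto simp: is_arg_max_def not_less inner_commute[of u] subset_iff)
    moreover obtain c where
      "{c. is_arg_max (\<lambda>c. c \<bullet> u) (\<lambda>c. c \<in> closure (Range T)) c} = {c}"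
      using sc unfolding strictly_convex_in_direction_def by (rule is_singletonE)
    ultimately show False
      using neq by (metis singletonD)
  qed
qed

section \<open>Compactness of tight sequences of measures\<close>

text \<open>Digits 0 and 2 in base 3: sequences with nearby codes have a common initial segment.\<close>

definition cantor_code :: "(nat \<Rightarrow> bool) \<Rightarrow> real" where
  "cantor_code p = (\<Sum>i. 2 * of_bool (p i) / 3 ^ Suc i)"

lemma cantor_tail_sums: "(\<lambda>i. 2 / 3 ^ Suc (i + k)) sums (1 / 3 ^ k :: real)"
proof -
  have "(\<lambda>i. (2 / 3 ^ Suc k) * (1 / 3 :: real) ^ i) sums ((2 / 3 ^ Suc k) * (1 / (1 - 1 / 3)))"
    by (intro sums_mult geometric_sums) simp
  then show ?thesis
    by (simp add: power_divide power_add mult_ac)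
qed

lemma cantor_summable: "summable (\<lambda>i. 2 * of_bool (p i) / 3 ^ Suc i :: real)"
proof (rule summable_comparison_test')
  show "summable (\<lambda>i. 2 / 3 ^ Suc i :: real)"
    using cantor_tail_sums[of 0] by (simp add: sums_iff)
  show "norm (2 * of_bool (p n) / 3 ^ Suc n :: real) \<le> 2 / 3 ^ Suc n" for n
    by (auto simp: of_bool_def)
qed

lemma cantor_code_tail:
  "0 \<le> (\<Sum>i. 2 * of_bool (p (i + k)) / 3 ^ Suc (i + k) :: real)"
  "(\<Sum>i. 2 * of_bool (p (i + k)) / 3 ^ Suc (i + k) :: real) \<le> 1 / 3 ^ k"
proof -
  have s: "summable (\<lambda>i. 2 * of_bool (p (i + k)) / 3 ^ Suc (i + k) :: real)"
    using summable_ignore_initial_segment[OF cantor_summable[of p], of k] by simp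
  show "0 \<le> (\<Sum>i. 2 * of_bool (p (i + k)) / 3 ^ Suc (i + k) :: real)"
    by (intro suminf_nonneg s) simp
  have "(\<Sum>i. 2 * of_bool (p (i + k)) / 3 ^ Suc (i + k) :: real) \<le> (\<Sum>i. 2 / 3 ^ Suc (i + k))"
    by (intro suminf_le s) (use cantor_tail_sums[of k] in \<open>auto simp: of_bool_def sums_iff\<close>)
  also have "\<dots> = 1 / 3 ^ k"
    using cantor_tail_sums[of k] by (simp add: sums_iff)
  finally show "(\<Sum>i. 2 * of_bool (p (i + k)) / 3 ^ Suc (i + k) :: real) \<le> 1 / 3 ^ k" .
qed

lemma cantor_code_split:
  "cantor_code p = (\<Sum>i. 2 * of_bool (p (i + k)) / 3 ^ Suc (i + k)) + (\<Sum>i<k. 2 * of_bool (p i) / 3 ^ Suc i)"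
  unfolding cantor_code_def by (rule suminf_split_initial_segment[OF cantor_summable])

lemma cantor_code_bounds: "0 \<le> cantor_code p" "cantor_code p \<le> 1"
  using cantor_code_tail[of p 0] cantor_code_split[of p 0] by auto

text \<open>The differing digit contributes \<open>2 / 3 ^ Suc m\<close>, and the later digits can
  take back at most \<open>1 / 3 ^ Suc m\<close>.\<close>

lemma cantor_code_first_difference:
  assumes "\<And>i. i < m \<Longrightarrow> p i = q i" "p m" "\<not> q m"
  shows "1 / 3 ^ Suc m \<le> cantor_code p - cantor_code q"
proof -
  have "(\<Sum>i<m. 2 * of_bool (p i) / 3 ^ Suc i :: real) = (\<Sum>i<m. 2 * of_bool (q i) / 3 ^ Suc i)"
    using assms(1) by (intro sum.cong) auto
  then show ?thesis
    using cantor_code_split[of p "Suc m"] cantor_code_split[of q "Suc m"]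
      cantor_code_tail[of p "Suc m"] cantor_code_tail[of q "Suc m"] assms(2,3) by simp
qed

lemma cantor_code_close:
  assumes close: "\<bar>cantor_code p - cantor_code q\<bar> < 1 / 3 ^ m" and "i < m"
  shows "p i = q i"
proof (rule ccontr)
  assume "p i \<noteq> q i"
  define j where "j = (LEAST j. p j \<noteq> q j)"
  have j: "p j \<noteq> q j" "j \<le> i"
    unfolding j_def using \<open>p i \<noteq> q i\<close> by (rule LeastI, rule Least_le)
  have "p k = q k" if "k < j" for k
    using not_less_Least that unfolding j_def by blast
  then have "1 / 3 ^ Suc j \<le> \<bar>cantor_code p - cantor_code q\<bar>"
    using cantor_code_first_difference[of j p q] cantor_code_first_difference[of j q p] j(1) by fastforce
  moreover have "(1 :: real) / 3 ^ m \<le> 1 / 3 ^ Suc j"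
    using j(2) \<open>i < m\<close> by (intro divide_left_mono power_increasing) auto
  ultimately show False using close by simp
qed

text \<open>The cell index determines the integer parts, the parities the binary digits, of all
  coordinates.\<close>

definition basis_list :: "'b::euclidean_space list" where
  "basis_list = (SOME bs. set bs = Basis)"

lemma set_basis_list: "set basis_list = (Basis :: 'b::euclidean_space set)"
  unfolding basis_list_def using finite_list[OF finite_Basis] by (rule someI_ex)

text \<open>The index encodes a binary level \<open>k\<close> and a coordinate \<open>l\<close>;
  reducing \<open>l\<close> modulo the dimension makes every index meaningful, at the harmless price
  of repetitions.\<close>

definition grid_parity :: "'b::euclidean_space \<Rightarrow> nat \<Rightarrow> bool" where
  "grid_parity x i = (case prod_decode i of (k, l) \<Rightarrow>
     odd \<lfloor>2 ^ k * (x \<bullet> (basis_list ! (l mod length (basis_list :: 'b list))))\<rfloor>)"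

definition grid_cell :: "'b::euclidean_space \<Rightarrow> nat" where
  "grid_cell x = to_nat (map (\<lambda>b. \<lfloor>x \<bullet> b\<rfloor>) basis_list)"

text \<open>Cantor codes lie in \<open>[0, 1]\<close>, so the factor 2 keeps the codes of different
  cells at distance at least 1.\<close>

definition grid_code :: "'b::euclidean_space \<Rightarrow> real" where
  "grid_code x = 2 * real (grid_cell x) + cantor_code (grid_parity x)"

lemma grid_code_measurable: "(grid_code :: 'b::euclidean_space \<Rightarrow> real) \<in> borel_measurable borel"
proof -
  have "(\<lambda>x. map (\<lambda>b. \<lfloor>x \<bullet> b\<rfloor>) bs) \<in> borel \<rightarrow>\<^sub>M count_space UNIV" for bs :: "'b list"
  proof (induction bs)
    case (Cons b bs)
    have "(\<lambda>x. z # map (\<lambda>b. \<lfloor>x \<bullet> b\<rfloor>) bs) \<in> borel \<rightarrow>\<^sub>M count_space UNIV" for z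
      using measurable_compose[OF Cons.IH, of "(#) z" "count_space UNIV"] by simp
    then have "(\<lambda>x. \<lfloor>x \<bullet> b\<rfloor> # map (\<lambda>b. \<lfloor>x \<bullet> b\<rfloor>) bs) \<in> borel \<rightarrow>\<^sub>M count_space UNIV"
      by (rule measurable_compose_countable) measurable
    then show ?case by simp
  qed simp
  then have "(\<lambda>x :: 'b. to_nat (map (\<lambda>b. \<lfloor>x \<bullet> b\<rfloor>) basis_list)) \<in> borel \<rightarrow>\<^sub>M count_space UNIV"
    by (rule measurable_compose) simp
  then have [measurable]: "(grid_cell :: 'b \<Rightarrow> nat) \<in> borel \<rightarrow>\<^sub>M count_space UNIV"
    unfolding grid_cell_def[abs_def] .
  have [measurable]: "Measurable.pred borel (\<lambda>x :: 'b. grid_parity x i)" for i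
  proof -
    obtain k l where kl: "prod_decode i = (k, l)" by fastforce
    have "(\<lambda>x :: 'b. \<lfloor>2 ^ k * (x \<bullet> (basis_list ! (l mod length (basis_list :: 'b list))))\<rfloor>)
        \<in> borel \<rightarrow>\<^sub>M count_space UNIV"
      by measurable
    then have "Measurable.pred borel (\<lambda>x :: 'b. odd \<lfloor>2 ^ k * (x \<bullet> (basis_list ! (l mod length (basis_list :: 'b list))))\<rfloor>)"
      by (rule measurable_compose) simp
    then show ?thesis by (simp add: grid_parity_def kl)
  qed
  show ?thesis
    unfolding grid_code_def[abs_def] cantor_code_def of_bool_def by measurable
qed

lemma floor_double: "\<lfloor>2 * t\<rfloor> = 2 * \<lfloor>t\<rfloor> + of_bool (odd \<lfloor>2 * t\<rfloor>)" for t :: real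
proof -
  have "\<lfloor>2 * t\<rfloor> = 2 * \<lfloor>t\<rfloor> \<or> \<lfloor>2 * t\<rfloor> = 2 * \<lfloor>t\<rfloor> + 1"
    by linarith
  then show ?thesis by auto
qed

text \<open>Close codes share the cell and an initial segment of parities. The floor at level
  \<open>k + 1\<close> is determined by the floor at level \<open>k\<close> and one parity, so all
  floors up to level \<open>K\<close> agree and each coordinate is known up to
  \<open>1 / 2 ^ K\<close>.\<close>

lemma grid_code_close:
  assumes "e > 0"
  shows "\<exists>d>0. \<forall>x y :: 'b::euclidean_space. \<bar>grid_code x - grid_code y\<bar> < d \<longrightarrow> dist x y < e"
proof -
  let ?bs = "basis_list :: 'b list"
  obtain K where K: "real DIM('b) / e < 2 ^ K"
    using real_arch_pow[of 2 "real DIM('b) / e"] by auto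
  \<comment> \<open>Large enough that the first \<open>m\<close> parities contain all coordinates at
    all levels up to \<open>K\<close>.\<close>
  define m where "m = Suc (Max ((\<lambda>(k, l). prod_encode (k, l)) ` ({..K} \<times> {..<length ?bs})))"
  have m: "prod_encode (k, l) < m" if "k \<le> K" "l < length ?bs" for k l
    unfolding m_def using that by (intro le_imp_less_Suc Max_ge) auto
  have "dist x y < e" if close: "\<bar>grid_code x - grid_code y\<bar> < 1 / 3 ^ m" for x y :: 'b
  proof -
    have "\<bar>grid_code x - grid_code y\<bar> < 1"
      by (rule order.strict_trans2[OF close]) simp
    then have "\<bar>2 * real (grid_cell x) - 2 * real (grid_cell y)\<bar> < 2"
      using cantor_code_bounds[of "grid_parity x"] cantor_code_bounds[of "grid_parity y"]
      unfolding grid_code_def by linarith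
    then have cell: "grid_cell x = grid_cell y" by linarith
    then have par: "grid_parity x i = grid_parity y i" if "i < m" for i
      using close that cantor_code_close[of "grid_parity x" "grid_parity y" m i]
      by (simp add: grid_code_def)
    have floors: "\<lfloor>2 ^ k * (x \<bullet> b)\<rfloor> = \<lfloor>2 ^ k * (y \<bullet> b)\<rfloor>" if b: "b \<in> Basis" and k: "k \<le> K" for b k
      using k
    proof (induction k)
      case 0
      have "map (\<lambda>b. \<lfloor>x \<bullet> b\<rfloor>) ?bs = map (\<lambda>b. \<lfloor>y \<bullet> b\<rfloor>) ?bs"
        using cell by (simp add: grid_cell_def)
      then show ?case
        using b set_basis_list[where 'b='b] by (auto simp: map_eq_conv)
    next
      case (Suc k)
      obtain l where l: "l < length ?bs" "?bs ! l = b"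
        using b set_basis_list[where 'b='b] by (metis in_set_conv_nth)
      have "odd \<lfloor>2 ^ Suc k * (x \<bullet> b)\<rfloor> = odd \<lfloor>2 ^ Suc k * (y \<bullet> b)\<rfloor>"
        using par[OF m[OF Suc.prems l(1)]] l by (simp add: grid_parity_def)
      then show ?case
        using floor_double[of "2 ^ k * (x \<bullet> b)"] floor_double[of "2 ^ k * (y \<bullet> b)"] Suc
        by (simp add: mult.assoc)
    qed
    have "\<bar>(x - y) \<bullet> b\<bar> < 1 / 2 ^ K" if b: "b \<in> Basis" for b
    proof -
      have "\<bar>2 ^ K * (x \<bullet> b) - 2 ^ K * (y \<bullet> b)\<bar> < 1"
        using floors[OF b order.refl] by linarith
      then have "2 ^ K * \<bar>(x - y) \<bullet> b\<bar> < 1"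
        by (simp add: inner_diff_left abs_mult flip: right_diff_distrib)
      then show ?thesis by (simp add: field_simps)
    qed
    then have "(\<Sum>b\<in>Basis. \<bar>(x - y) \<bullet> b\<bar>) < (\<Sum>b\<in>(Basis :: 'b set). 1 / 2 ^ K)"
      by (intro sum_strict_mono) auto
    also have "\<dots> < e"
      using K assms by (simp add: field_simps)
    finally show ?thesis
      using norm_le_l1[of "x - y"] by (simp add: dist_norm)
  qed
  then show ?thesis by (intro exI[of _ "1 / 3 ^ m"]) simp
qed

text \<open>Carries tightness over to the image measures: only finitely many cells meet a
  ball.\<close>

lemma grid_code_bounded:
  obtains a where "\<And>x :: 'b::euclidean_space. norm x \<le> R \<Longrightarrow> grid_code x \<le> a"
proof -
  let ?bs = "basis_list :: 'b list"
  let ?L = "{ls. set ls \<subseteq> {\<lfloor>-R\<rfloor>..\<lfloor>R\<rfloor>} \<and> length ls = length ?bs}"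
  have fin: "finite ?L" by (rule finite_lists_length_eq) simp
  have "map (\<lambda>b. \<lfloor>x \<bullet> b\<rfloor>) ?bs \<in> ?L" if x: "norm x \<le> R" for x :: 'b
  proof -
    have "\<lfloor>-R\<rfloor> \<le> \<lfloor>x \<bullet> b\<rfloor> \<and> \<lfloor>x \<bullet> b\<rfloor> \<le> \<lfloor>R\<rfloor>" if "b \<in> set ?bs" for b
      using Basis_le_norm[of b x] that x set_basis_list[where 'b='b] by (intro conjI floor_mono) auto
    then show ?thesis by auto
  qed
  then have "grid_cell x \<le> Max (to_nat ` ?L)" if "norm x \<le> R" for x :: 'b
    unfolding grid_cell_def using fin that by (intro Max_ge) auto
  then have "grid_code x \<le> 2 * real (Max (to_nat ` ?L)) + 1" if "norm x \<le> R" for x :: 'b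
    unfolding grid_code_def using cantor_code_bounds[of "grid_parity x"] that
    by (intro add_mono mult_left_mono) auto
  then show ?thesis using that by blast
qed

text \<open>The code itself is merely Borel, but its inverse is uniformly continuous on the range.
  It extends to the closure of the range, and by Tietze to the whole line.\<close>

lemma grid_decode:
  obtains g :: "real \<Rightarrow> 'b::euclidean_space" where "continuous_on UNIV g" "\<And>x. g (grid_code x) = x"
proof -
  let ?s = "grid_code :: 'b \<Rightarrow> real"
  define h where "h = inv_into UNIV ?s"
  have inj: "inj ?s"
  proof (rule injI)
    fix x y :: 'b assume eq: "?s x = ?s y"
    have "dist x y < e" if "e > 0" for e
      using grid_code_close[OF that, where 'b='b] eq by auto
    then show "x = y" by (metis less_irrefl zero_less_dist_iff)
  qed
  then have h: "h (?s x) = x" for x by (simp add: h_def)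
  have "uniformly_continuous_on (range ?s) h"
    unfolding uniformly_continuous_on_def
  proof (intro allI impI)
    fix e :: real assume "e > 0"
    then obtain d where d: "d > 0" "\<And>x y :: 'b. \<bar>?s x - ?s y\<bar> < d \<Longrightarrow> dist x y < e"
      using grid_code_close[where 'b='b] by blast
    then show "\<exists>d>0. \<forall>x\<in>range ?s. \<forall>x'\<in>range ?s. dist x' x < d \<longrightarrow> dist (h x') (h x) < e"
      by (intro exI[of _ d]) (auto simp: h dist_real_def)
  qed
  then obtain k where k: "uniformly_continuous_on (closure (range ?s)) k"
    "\<And>t. t \<in> range ?s \<Longrightarrow> h t = k t"
    by (rule uniformly_continuous_on_extension_on_closure) blast
  then obtain g where g: "continuous_on UNIV g" "\<And>t. t \<in> closure (range ?s) \<Longrightarrow> g t = k t"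
    using Tietze_unbounded[of "closure (range ?s)" k UNIV] uniformly_continuous_imp_continuous
    by (metis closed_closedin closed_closure subtopology_UNIV)
  have "g (?s x) = x" for x
    using g(2)[of "?s x"] k(2)[of "?s x"] h closure_subset by (metis rangeI subsetD)
  then show ?thesis using that g(1) by blast
qed

text \<open>One half of Prokhorov's theorem. The codes push the measures to a tight sequence on the
  line, where a subsequence converges weakly; the limit is pushed back by the decoder
  \<open>g\<close>. Since \<open>g\<close> is continuous, \<open>f \<circ> g\<close> is an
  admissible test function, and it recovers the integrals of \<open>f\<close> because
  \<open>g\<close> undoes the code.\<close>

theorem tight_convergent_subsequence:
  fixes \<mu> :: "nat \<Rightarrow> 'b::euclidean_space measure"
  assumes prob: "\<And>n. prob_space (\<mu> n)" and sets: "\<And>n. sets (\<mu> n) = sets borel"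
    and tight: "\<And>e. e > 0 \<Longrightarrow> \<exists>R. \<forall>n. measure (\<mu> n) (cball 0 R) > 1 - e"
  obtains r \<nu> where "strict_mono (r :: nat \<Rightarrow> nat)" "prob_space \<nu>" "sets \<nu> = sets borel"
    "\<And>f B. continuous_on UNIV f \<Longrightarrow> (\<And>x. \<bar>f x\<bar> \<le> B) \<Longrightarrow>
      (\<lambda>n. \<integral>x. f x \<partial>\<mu> (r n)) \<longlonglongrightarrow> (\<integral>x. f x \<partial>\<nu> :: real)"
proof -
  let ?s = "grid_code :: 'b \<Rightarrow> real"
  obtain g :: "real \<Rightarrow> 'b" where g: "continuous_on UNIV g" "\<And>x. g (?s x) = x"
    by (rule grid_decode) blast
  have s: "?s \<in> \<mu> n \<rightarrow>\<^sub>M borel" for n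
    using grid_code_measurable measurable_cong_sets[OF sets refl] by blast
  define \<kappa> where "\<kappa> n = distr (\<mu> n) borel ?s" for n
  have rd: "real_distribution (\<kappa> n)" for n
    unfolding \<kappa>_def real_distribution_def real_distribution_axioms_def
    using prob_space.prob_space_distr[OF prob s] by simp
  have "tight \<kappa>"
    unfolding tight_def
  proof (intro conjI allI impI rd)
    fix e :: real assume "e > 0"
    then obtain R where R: "\<And>n. measure (\<mu> n) (cball 0 R) > 1 - e"
      using tight by blast
    obtain a where a: "\<And>x :: 'b. norm x \<le> R \<Longrightarrow> ?s x \<le> a"
      by (rule grid_code_bounded) blast
    have pos: "0 \<le> ?s x" for x
      using cantor_code_bounds[of "grid_parity x"] by (simp add: grid_code_def)
    have "1 - e < measure (\<kappa> n) {-1<..max a 0}" for n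
    proof -
      interpret prob_space "\<mu> n" by (rule prob)
      have "cball 0 R \<subseteq> ?s -` {-1<..max a 0} \<inter> space (\<mu> n)"
        using a pos sets_eq_imp_space_eq[OF sets[of n]]
        by (auto simp: le_max_iff_disj order.strict_trans2[of "-1" 0])
      then have "measure (\<mu> n) (cball 0 R) \<le> measure (\<mu> n) (?s -` {-1<..max a 0} \<inter> space (\<mu> n))"
        by (rule finite_measure_mono) (rule measurable_sets[OF s], simp)
      then show ?thesis
        using R[of n] by (simp add: \<kappa>_def measure_distr[OF s])
    qed
    then show "\<exists>a b. a < b \<and> (\<forall>n. 1 - e < measure (\<kappa> n) {a<..b})"
      by (intro exI[of _ "-1"] exI[of _ "max a 0"]) auto
  qed
  then obtain r \<eta> where r: "strict_mono r" and \<eta>: "real_distribution \<eta>"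
    and conv: "weak_conv_m (\<kappa> \<circ> id \<circ> r) \<eta>"
    using tight_imp_convergent_subsubsequence[of \<kappa> id] by (auto simp: strict_mono_def)
  interpret \<eta>: real_distribution \<eta> by (rule \<eta>)
  have gm: "g \<in> borel_measurable borel"
    using g(1) by (rule borel_measurable_continuous_onI)
  then have gm': "g \<in> \<eta> \<rightarrow>\<^sub>M borel" by simp
  show ?thesis
  proof (rule that[OF r])
    show "prob_space (distr \<eta> borel g)"
      by (rule \<eta>.prob_space_distr[OF gm'])
    fix f :: "'b \<Rightarrow> real" and B assume f: "continuous_on UNIV f" "\<And>x. \<bar>f x\<bar> \<le> B"
    have fm: "f \<in> borel_measurable borel"
      using f(1) by (rule borel_measurable_continuous_onI)
    have fg: "continuous_on UNIV (\<lambda>t. f (g t))"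
      using continuous_on_compose2[OF f(1) g(1)] by simp
    have "(\<lambda>n. \<integral>t. f (g t) \<partial>(\<kappa> \<circ> id \<circ> r) n) \<longlonglongrightarrow> (\<integral>t. f (g t) \<partial>\<eta>)"
      using weak_conv_imp_integral_bdd_continuous_conv[OF _ \<eta> conv, of "\<lambda>t. f (g t)" B] rd fg f(2)
      by (simp add: continuous_on_eq_continuous_at)
    moreover have "(\<integral>t. f (g t) \<partial>(\<kappa> \<circ> id \<circ> r) n) = (\<integral>x. f x \<partial>\<mu> (r n))" for n
    proof -
      have "(\<integral>t. f (g t) \<partial>distr (\<mu> (r n)) borel ?s) = (\<integral>x. f (g (?s x)) \<partial>\<mu> (r n))"
        by (rule integral_distr[OF s]) (use measurable_compose[OF gm fm] in simp)
      then show ?thesis by (simp add: \<kappa>_def g(2))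
    qed
    moreover have "(\<integral>t. f (g t) \<partial>\<eta>) = (\<integral>x. f x \<partial>distr \<eta> borel g)"
      by (rule integral_distr[OF gm' fm, symmetric])
    ultimately show "(\<lambda>n. \<integral>x. f x \<partial>\<mu> (r n)) \<longlonglongrightarrow> (\<integral>x. f x \<partial>distr \<eta> borel g)"
      by simp
  qed simp
qed

section \<open>Test functions\<close>

lemma prob_measures_euclidean_iff: "\<mu> \<in> prob_measures euclidean \<longleftrightarrow> prob_space \<mu> \<and> sets \<mu> = sets borel"
  by (simp add: prob_measures_def borel_of_euclidean)

lemma integrable_bounded_continuous:
  fixes f :: "'b::topological_space \<Rightarrow> real"
  assumes "prob_space \<mu>" "sets \<mu> = sets borel" "continuous_on UNIV f" "\<And>x. \<bar>f x\<bar> \<le> B"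
  shows "integrable \<mu> f"
proof -
  interpret prob_space \<mu> by fact
  have "f \<in> borel_measurable \<mu>"
    using borel_measurable_continuous_onI[OF assms(3)] measurable_cong_sets[OF assms(2) refl] by blast
  then show ?thesis
    using assms(4) by (intro integrable_const_bound[of _ B]) auto
qed

text \<open>Continuous approximations of the indicator of an open \<open>U\<close> from below,
  increasing in \<open>k\<close>. The distance to the empty set is 0 here, so the bump of
  \<open>UNIV\<close> vanishes; this accounts for the condition \<open>U \<noteq> UNIV\<close> in
  what follows.\<close>

definition bump :: "'b::metric_space set \<Rightarrow> nat \<Rightarrow> 'b \<Rightarrow> real" where
  "bump U k x = min 1 (real k * infdist x (- U))"

lemma bump_range: "0 \<le> bump U k x" "bump U k x \<le> 1" "\<bar>bump U k x\<bar> \<le> 1"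
  by (auto simp: bump_def infdist_nonneg)

lemma bump_continuous: "continuous_on UNIV (bump U k)"
  unfolding bump_def by (intro continuous_intros)

lemma bump_outside: "x \<notin> U \<Longrightarrow> bump U k x = 0"
  by (simp add: bump_def)

lemma bump_le_indicator: "bump U k x \<le> indicator U x"
  using bump_outside[of x U k] bump_range[of U k x] by (auto simp: indicator_def)

lemma bump_positive:
  assumes "open U" "U \<noteq> UNIV" "x \<in> U" "k > 0"
  shows "bump U k x > 0"
proof -
  have "infdist x (- U) > 0"
    using assms infdist_pos_not_in_closed[of "- U" x] by auto
  then show ?thesis
    using assms(4) by (simp add: bump_def)
qed

lemma bump_tendsto_indicator:
  assumes "open U" "U \<noteq> UNIV"
  shows "(\<lambda>k. bump U k x) \<longlonglongrightarrow> indicator U x"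
proof (cases "x \<in> U")
  case True
  have d: "infdist x (- U) > 0"
    using assms True infdist_pos_not_in_closed[of "- U" x] by auto
  obtain N where N: "1 / infdist x (- U) < real N"
    using reals_Archimedean2 by blast
  have "bump U k x = 1" if "k \<ge> N" for k
  proof -
    have "1 / infdist x (- U) \<le> real k" using N that by linarith
    then have "1 \<le> real k * infdist x (- U)" using d by (simp add: field_simps)
    then show ?thesis by (simp add: bump_def)
  qed
  then have "\<forall>\<^sub>F k in sequentially. bump U k x = indicator U x"
    using True by (auto simp: eventually_sequentially)
  then show ?thesis by (rule tendsto_eventually)
qed (simp add: bump_outside)

lemma bump_integral_tendsto:
  fixes \<mu> :: "'b::metric_space measure"
  assumes \<mu>: "prob_space \<mu>" "sets \<mu> = sets borel" and U: "open U" "U \<noteq> UNIV"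
  shows "(\<lambda>k. \<integral>x. bump U k x \<partial>\<mu>) \<longlonglongrightarrow> measure \<mu> U"
proof -
  interpret prob_space \<mu> by fact
  have "(\<lambda>k. \<integral>x. bump U k x \<partial>\<mu>) \<longlonglongrightarrow> (\<integral>x. indicator U x \<partial>\<mu>)"
  proof (rule integral_dominated_convergence[where w = "\<lambda>_. 1"])
    show "(indicator U :: 'b \<Rightarrow> real) \<in> borel_measurable \<mu>"
      using U \<mu>(2) by (intro borel_measurable_indicator) auto
    show "bump U k \<in> borel_measurable \<mu>" for k
      using integrable_bounded_continuous[OF \<mu> bump_continuous bump_range(3)] by blast
  qed (simp_all add: bump_tendsto_indicator[OF U] bump_range)
  then show ?thesis
    using sets_eq_imp_space_eq[OF \<mu>(2)] by simp
qed

lemma bump_integral_le: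
  fixes \<mu> :: "'b::metric_space measure"
  assumes \<mu>: "prob_space \<mu>" "sets \<mu> = sets borel" and U: "open U"
  shows "(\<integral>x. bump U k x \<partial>\<mu>) \<le> measure \<mu> U"
proof -
  interpret prob_space \<mu> by fact
  have "(\<integral>x. bump U k x \<partial>\<mu>) \<le> (\<integral>x. indicator U x \<partial>\<mu>)"
  proof (rule integral_mono)
    show "integrable \<mu> (indicator U :: 'b \<Rightarrow> real)"
      using U \<mu>(2) by (simp add: emeasure_eq_measure)
  qed (use integrable_bounded_continuous[OF \<mu> bump_continuous bump_range(3)] bump_le_indicator in auto)
  then show ?thesis
    using sets_eq_imp_space_eq[OF \<mu>(2)] by simp
qed

section \<open>A countable family of test functions\<close>

definition countable_base :: "'b::second_countable_topology set set" where
  "countable_base = (SOME B. countable B \<and> topological_basis B)"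

lemma countable_base: "countable (countable_base :: 'b::second_countable_topology set set)"
  "topological_basis (countable_base :: 'b::second_countable_topology set set)"
  using someI_ex[OF ex_countable_basis] unfolding countable_base_def by auto

text \<open>Finite intersections of base sets form a countable generator stable under intersection,
  which determines a measure; the balls are added for tightness.\<close>

definition test_opens :: "'b::euclidean_space set set" where
  "test_opens = Inter ` {F. finite F \<and> F \<subseteq> countable_base} \<union> range (\<lambda>n. ball 0 (real n))"

definition test_function :: "nat \<Rightarrow> 'b::euclidean_space \<Rightarrow> real" where
  "test_function j = (case prod_decode j of (i, k) \<Rightarrow> bump (from_nat_into test_opens i) k)"

lemma countable_test_opens: "countable (test_opens :: 'b::euclidean_space set set)"
  unfolding test_opens_def
  using countable_Collect_finite_subset[OF countable_base(1)]
  by (intro countable_Un countable_image) auto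

lemma test_function_bump:
  assumes "U \<in> test_opens"
  obtains j where "test_function j = bump U k"
proof -
  obtain i where "from_nat_into test_opens i = U"
    using from_nat_into_surj[OF countable_test_opens assms] by blast
  then show ?thesis
    using that[of "prod_encode (i, k)"] by (simp add: test_function_def)
qed

lemma test_function_continuous: "continuous_on UNIV (test_function j)"
  unfolding test_function_def by (simp add: bump_continuous split: prod.split)

lemma test_function_bound: "\<bar>test_function j x\<bar> \<le> 1"
  unfolding test_function_def by (simp add: bump_range split: prod.split)

text \<open>Integrals of bumps determine the measures of the generating open sets, and uniqueness on
  an intersection-stable generator does the rest. The whole space has vanishing bumps and is treated
  by its total mass 1.\<close>

lemma measure_eq_by_test_functions:
  fixes \<mu> \<nu> :: "'b::euclidean_space measure"
  assumes \<mu>: "prob_space \<mu>" "sets \<mu> = sets borel" and \<nu>: "prob_space \<nu>" "sets \<nu> = sets borel"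
    and eq: "\<And>j. (\<integral>x. test_function j x \<partial>\<mu>) = (\<integral>x. test_function j x \<partial>\<nu>)"
  shows "\<mu> = \<nu>"
proof -
  interpret \<mu>: prob_space \<mu> by fact
  interpret \<nu>: prob_space \<nu> by fact
  let ?E = "Inter ` {F. finite F \<and> F \<subseteq> (countable_base :: 'b set set)}"
  have E_open: "open U" if "U \<in> ?E" for U
    using that topological_basis_open[OF countable_base(2)] by (auto intro!: open_Inter)
  show ?thesis
  proof (rule measure_eqI_generator_eq[where E = ?E and \<Omega> = UNIV and A = "\<lambda>_. UNIV"])
    show "Int_stable ?E"
    proof (rule Int_stableI)
      fix a b assume "a \<in> ?E" "b \<in> ?E"
      then obtain F G where "a = \<Inter>F" "b = \<Inter>G" "finite F" "finite G" "F \<subseteq> countable_base" "G \<subseteq> countable_base"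
        by auto
      then show "a \<inter> b \<in> ?E"
        by (intro image_eqI[of _ _ "F \<union> G"]) auto
    qed
    have "borel = sigma UNIV ?E"
    proof (rule borel_eq_countable_basis)
      show "countable ?E"
        using countable_Collect_finite_subset[OF countable_base(1)] by (intro countable_image) auto
      have "countable_base \<subseteq> ?E"
      proof
        fix U :: "'b set" assume "U \<in> countable_base"
        then show "U \<in> ?E" by (intro image_eqI[of _ _ "{U}"]) auto
      qed
      then show "topological_basis ?E"
        using countable_base(2) E_open unfolding topological_basis_def by (metis subset_trans)
    qed
    then have "sets (borel :: 'b measure) = sets (sigma UNIV ?E)"
      by (rule arg_cong)
    also have "\<dots> = sigma_sets UNIV ?E"
      by (rule sets_measure_of) simp
    finally show "sets \<mu> = sigma_sets UNIV ?E" "sets \<nu> = sigma_sets UNIV ?E"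
      using \<mu> \<nu> by simp_all
    show "range (\<lambda>_. UNIV) \<subseteq> ?E"
      by (auto intro: image_eqI[of _ _ "{}"])
    fix U assume U: "U \<in> ?E"
    show "emeasure \<mu> U = emeasure \<nu> U"
    proof (cases "U = UNIV")
      case True
      then show ?thesis
        using \<mu>.emeasure_space_1 \<nu>.emeasure_space_1 sets_eq_imp_space_eq[OF \<mu>(2)] sets_eq_imp_space_eq[OF \<nu>(2)]
        by simp
    next
      case False
      have "(\<integral>x. bump U k x \<partial>\<mu>) = (\<integral>x. bump U k x \<partial>\<nu>)" for k
      proof -
        have "U \<in> test_opens" using U by (simp add: test_opens_def)
        then obtain j where "test_function j = bump U k" by (rule test_function_bump)
        then show ?thesis using eq[of j] by simp
      qed
      then have "measure \<mu> U = measure \<nu> U"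
        using bump_integral_tendsto[OF \<mu> E_open[OF U] False] bump_integral_tendsto[OF \<nu> E_open[OF U] False]
          LIMSEQ_unique by simp
      then show ?thesis
        by (simp add: \<mu>.emeasure_eq_measure \<nu>.emeasure_eq_measure)
    qed
  qed auto
qed

lemma measure_ball_tendsto:
  fixes \<mu> :: "'b::euclidean_space measure"
  assumes \<mu>: "prob_space \<mu>" "sets \<mu> = sets borel" and "e > 0"
  obtains R :: nat where "measure \<mu> (ball 0 (real R)) > 1 - e"
proof -
  interpret prob_space \<mu> by fact
  have "(\<lambda>n. measure \<mu> (ball 0 (real n))) \<longlonglongrightarrow> measure \<mu> (\<Union>n. ball 0 (real n))"
  proof (rule finite_Lim_measure_incseq)
    show "range (\<lambda>n. ball 0 (real n)) \<subseteq> sets \<mu>"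
      unfolding \<mu>(2) by auto
    show "incseq (\<lambda>n. ball (0 :: 'b) (real n))"
      by (intro incseq_SucI subset_ball) simp
  qed
  also have "(\<Union>n. ball 0 (real n)) = space \<mu>"
  proof -
    have "\<exists>n. norm x < real n" for x :: 'b by (rule reals_Archimedean2)
    then show ?thesis using sets_eq_imp_space_eq[OF \<mu>(2)] by auto
  qed
  finally have "(\<lambda>n. measure \<mu> (ball 0 (real n))) \<longlonglongrightarrow> 1"
    by (simp add: prob_space)
  then have "\<forall>\<^sub>F n in sequentially. measure \<mu> (ball 0 (real n)) > 1 - e"
    using assms(3) by (intro order_tendstoD) auto
  then show ?thesis
    using that by (auto simp: eventually_sequentially)
qed

text \<open>One bump of a large ball has a large integral under \<open>\<nu>\<close>, hence under
  all but finitely many \<open>\<mu> n\<close>; each of the remaining measures has a ball of its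
  own.\<close>

lemma tight_by_test_functions:
  fixes \<mu> :: "nat \<Rightarrow> 'b::euclidean_space measure" and \<nu> :: "'b measure"
  assumes \<mu>n: "\<And>n. prob_space (\<mu> n)" "\<And>n. sets (\<mu> n) = sets borel"
    and \<nu>: "prob_space \<nu>" "sets \<nu> = sets borel"
    and conv: "\<And>j. (\<lambda>n. \<integral>x. test_function j x \<partial>\<mu> n) \<longlonglongrightarrow> (\<integral>x. test_function j x \<partial>\<nu>)"
    and e: "e > 0"
  obtains R where "\<And>n. measure (\<mu> n) (cball 0 R) > 1 - e"
proof -
  obtain R0 :: nat where R0: "measure \<nu> (ball 0 (real R0)) > 1 - e"
    by (rule measure_ball_tendsto[OF \<nu> e])
  have ne: "ball (0 :: 'b) (real R0) \<noteq> UNIV"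
  proof
    assume "ball (0 :: 'b) (real R0) = UNIV"
    then show False
      using bounded_ball[of "0 :: 'b" "real R0"] by simp
  qed
  have "(\<lambda>k. \<integral>x. bump (ball 0 (real R0)) k x \<partial>\<nu>) \<longlonglongrightarrow> measure \<nu> (ball 0 (real R0))"
    by (rule bump_integral_tendsto[OF \<nu> _ ne]) simp
  then have "\<forall>\<^sub>F k in sequentially. (\<integral>x. bump (ball 0 (real R0)) k x \<partial>\<nu>) > 1 - e"
    using R0 by (rule order_tendstoD)
  then obtain k where k: "(\<integral>x. bump (ball 0 (real R0)) k x \<partial>\<nu>) > 1 - e"
    by (auto simp: eventually_sequentially)
  have "ball (0 :: 'b) (real R0) \<in> test_opens" by (simp add: test_opens_def)
  then obtain j where j: "test_function j = bump (ball (0 :: 'b) (real R0)) k"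
    by (rule test_function_bump)
  have "\<forall>\<^sub>F n in sequentially. (\<integral>x. test_function j x \<partial>\<mu> n) > 1 - e"
    using conv[of j] k unfolding j by (rule order_tendstoD)
  then obtain N where N: "\<And>n. n \<ge> N \<Longrightarrow> (\<integral>x. bump (ball 0 (real R0)) k x \<partial>\<mu> n) > 1 - e"
    unfolding j by (auto simp: eventually_sequentially)
  have "\<exists>R. measure (\<mu> n) (ball 0 (real R)) > 1 - e" for n
    using measure_ball_tendsto[OF \<mu>n[of n] e] by blast
  then obtain R where R: "\<And>n. measure (\<mu> n) (ball 0 (real (R n))) > 1 - e"
    by metis
  define M where "M = Max (insert R0 (R ` {..<N}))"
  have "measure (\<mu> n) (cball 0 (real M)) > 1 - e" for n
  proof -
    interpret prob_space "\<mu> n" by (rule \<mu>n)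
    obtain R' where R': "R' \<le> M" "measure (\<mu> n) (ball 0 (real R')) > 1 - e"
    proof (cases "n < N")
      case True
      then show ?thesis using that[of "R n"] R by (simp add: M_def)
    next
      case False
      then show ?thesis
        using that[of R0] N[of n] bump_integral_le[OF \<mu>n open_ball, of n 0 "real R0" k] by (simp add: M_def)
    qed
    have "measure (\<mu> n) (ball 0 (real R')) \<le> measure (\<mu> n) (cball 0 (real M))"
      using R'(1) \<mu>n(2) by (intro finite_measure_mono) auto
    then show ?thesis using R'(2) by linarith
  qed
  then show ?thesis by (rule that)
qed

section \<open>Supports\<close>

text \<open>The complement of the support is covered by null sets of the countable base.\<close>

lemma AE_in_spt:
  fixes \<mu> :: "'b::second_countable_topology measure"
  assumes "sets \<mu> = sets borel"
  shows "AE x in \<mu>. x \<in> spt \<mu>"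
proof -
  let ?N = "\<Union>U\<in>{U \<in> countable_base. emeasure \<mu> U = 0}. U"
  have "?N \<in> null_sets \<mu>"
  proof (rule null_sets_UN')
    show "countable {U \<in> (countable_base :: 'b set set). emeasure \<mu> U = 0}"
      using countable_base(1) by (rule countable_subset[rotated]) auto
    show "U \<in> null_sets \<mu>" if "U \<in> {U \<in> countable_base. emeasure \<mu> U = 0}" for U
      using that assms borel_open[OF topological_basis_open[OF countable_base(2)]] by (intro null_setsI) auto
  qed
  moreover have "x \<in> ?N" if x: "x \<notin> spt \<mu>" for x
  proof -
    obtain U where U: "open U" "x \<in> U" "emeasure \<mu> U = 0"
      using x unfolding spt_def by auto
    obtain B where B: "B \<in> countable_base" "x \<in> B" "B \<subseteq> U"
      by (rule topological_basisE[OF countable_base(2) U(1,2)])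
    then have "emeasure \<mu> B \<le> emeasure \<mu> U"
      using U(1) assms by (intro emeasure_mono) auto
    then show ?thesis using B U(3) by auto
  qed
  ultimately show ?thesis
    by (intro AE_I'[of ?N]) auto
qed

lemma spt_Int_nonempty:
  fixes \<mu> :: "'b::second_countable_topology measure"
  assumes "sets \<mu> = sets borel" "open G" "emeasure \<mu> G > 0"
  shows "spt \<mu> \<inter> G \<noteq> {}"
proof
  assume disj: "spt \<mu> \<inter> G = {}"
  have "AE x in \<mu>. x \<notin> G"
    using AE_in_spt[OF assms(1)] by (rule eventually_mono) (use disj in blast)
  then have "emeasure \<mu> {x \<in> space \<mu>. x \<in> G} = 0"
    using assms(1,2) by (subst (asm) AE_iff_measurable[OF _ refl]) (simp_all add: sets_eq_imp_space_eq[OF assms(1)])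
  then show False
    using assms(3) sets_eq_imp_space_eq[OF assms(1)] by simp
qed

section \<open>Margins of couplings\<close>

lemma couplingsD:
  assumes "\<pi> \<in> couplings P Q"
  shows "prob_space \<pi>" "sets \<pi> = sets borel" "distr \<pi> borel fst = P" "distr \<pi> borel snd = Q"
  using assms by (auto simp: couplings_def prob_measures_euclidean_iff)

lemma fst_snd_measurable_borel:
  fixes \<pi> :: "('b::topological_space \<times> 'b) measure"
  assumes "sets \<pi> = sets borel"
  shows "fst \<in> \<pi> \<rightarrow>\<^sub>M borel" "snd \<in> \<pi> \<rightarrow>\<^sub>M borel"
  unfolding measurable_cong_sets[OF assms refl]
  by (intro borel_measurable_continuous_onI continuous_on_fst continuous_on_snd continuous_on_id)+

text \<open>The strip over a ball around a point of \<open>spt P\<close> has positive mass under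
  \<open>\<pi>\<close>, so it meets \<open>spt \<pi>\<close>. The projection of a support need not
  be closed, hence the closure.\<close>

lemma spt_fst_dense:
  fixes P :: "'a::euclidean_space measure"
  assumes "\<pi> \<in> couplings P Q"
  shows "spt P \<subseteq> closure (Domain (spt \<pi>))"
proof
  fix x assume x: "x \<in> spt P"
  note \<pi> = couplingsD[OF assms]
  show "x \<in> closure (Domain (spt \<pi>))"
    unfolding closure_approachable
  proof (intro allI impI)
    fix e :: real assume "e > 0"
    then have "emeasure P (ball x e) > 0"
      using x by (simp add: spt_def)
    also have "emeasure P (ball x e) = emeasure \<pi> (fst -` ball x e \<inter> space \<pi>)"
      unfolding \<pi>(3)[symmetric] by (rule emeasure_distr[OF fst_snd_measurable_borel(1)[OF \<pi>(2)]]) simp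
    also have "fst -` ball x e \<inter> space \<pi> = ball x e \<times> UNIV"
      using sets_eq_imp_space_eq[OF \<pi>(2)] by auto
    finally have "spt \<pi> \<inter> ball x e \<times> UNIV \<noteq> {}"
      by (intro spt_Int_nonempty[OF \<pi>(2)] open_Times) auto
    then obtain y z where "(y, z) \<in> spt \<pi>" "dist x y < e"
      by auto
    then show "\<exists>y\<in>Domain (spt \<pi>). dist y x < e"
      by (intro bexI[of _ y]) (auto simp: dist_commute)
  qed
qed

section \<open>Stability of optimal transport plans for deterministic sequences\<close>

text \<open>The hypotheses on a single sample as a deterministic predicate, applicable also to
  quadruples that no random element takes as its value.\<close>

definition admissible ::
  "'a::euclidean_space measure \<Rightarrow> 'a measure \<Rightarrow> ('a \<times> 'a) measure \<Rightarrow> ('a \<times> 'a) set \<Rightarrow> bool" where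
  "admissible P Q \<pi> T \<longleftrightarrow> P \<in> prob_measures euclidean \<and> Q \<in> prob_measures euclidean \<and>
     \<pi> \<in> couplings P Q \<and> maximal_cyclically_monotone T \<and> spt \<pi> \<subseteq> T"

lemma admissibleD:
  assumes "admissible P Q \<pi> T"
  shows "prob_space P" "sets P = sets borel" "prob_space Q" "sets Q = sets borel"
    "\<pi> \<in> couplings P Q" "maximal_cyclically_monotone T" "minty T" "cyclically_monotone T" "spt \<pi> \<subseteq> T"
  using assms maximal_cyclically_monotone_imp_minty
  by (auto simp: admissible_def prob_measures_euclidean_iff maximal_cyclically_monotone_def)

lemma coupling_integral:
  fixes f :: "'a::euclidean_space \<Rightarrow> real"
  assumes "\<pi> \<in> couplings P Q" "continuous_on UNIV f"
  shows "(\<integral>z. f (fst z) \<partial>\<pi>) = (\<integral>x. f x \<partial>P)" "(\<integral>z. f (snd z) \<partial>\<pi>) = (\<integral>y. f y \<partial>Q)"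
proof -
  note \<pi> = couplingsD[OF assms(1)]
  have f: "f \<in> borel_measurable borel"
    using assms(2) by (rule borel_measurable_continuous_onI)
  show "(\<integral>z. f (fst z) \<partial>\<pi>) = (\<integral>x. f x \<partial>P)"
    unfolding \<pi>(3)[symmetric] by (rule integral_distr[OF fst_snd_measurable_borel(1)[OF \<pi>(2)] f, symmetric])
  show "(\<integral>z. f (snd z) \<partial>\<pi>) = (\<integral>y. f y \<partial>Q)"
    unfolding \<pi>(4)[symmetric] by (rule integral_distr[OF fst_snd_measurable_borel(2)[OF \<pi>(2)] f, symmetric])
qed

text \<open>Outside the product of the two balls at most the masses missing in the two margins are
  lost, and the product lies in the ball of radius \<open>R + R'\<close>.\<close>

lemma coupling_tight:
  fixes P Q :: "'a::euclidean_space measure"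
  assumes "\<pi> \<in> couplings P Q" "measure P (cball 0 R) > 1 - e" "measure Q (cball 0 R') > 1 - e"
  shows "measure \<pi> (cball 0 (R + R')) > 1 - 2 * e"
proof -
  note \<pi> = couplingsD[OF assms(1)]
  interpret prob_space \<pi> by (rule \<pi>)
  have sp: "space \<pi> = UNIV" using sets_eq_imp_space_eq[OF \<pi>(2)] by simp
  have mP: "measure P (cball 0 R) = measure \<pi> (cball 0 R \<times> UNIV)"
    unfolding \<pi>(3)[symmetric]
    by (subst measure_distr[OF fst_snd_measurable_borel(1)[OF \<pi>(2)]]) (auto simp: sp intro!: arg_cong[where f = "measure \<pi>"])
  have mQ: "measure Q (cball 0 R') = measure \<pi> (UNIV \<times> cball 0 R')"
    unfolding \<pi>(4)[symmetric]
    by (subst measure_distr[OF fst_snd_measurable_borel(2)[OF \<pi>(2)]]) (auto simp: sp intro!: arg_cong[where f = "measure \<pi>"])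
  have meas: "cball (0 :: 'a) R \<times> UNIV \<in> sets \<pi>" "UNIV \<times> cball (0 :: 'a) R' \<in> sets \<pi>"
    unfolding \<pi>(2) by (intro borel_closed closed_Times; simp)+
  have meas': "cball (0 :: 'a \<times> 'a) (R + R') \<in> sets \<pi>"
    by (simp add: \<pi>(2))
  have "cball (0 :: 'a) R \<times> UNIV \<subseteq> cball 0 (R + R') \<union> (space \<pi> - UNIV \<times> cball 0 R')"
  proof
    fix z :: "'a \<times> 'a" assume z: "z \<in> cball 0 R \<times> UNIV"
    show "z \<in> cball 0 (R + R') \<union> (space \<pi> - UNIV \<times> cball 0 R')"
    proof (cases "snd z \<in> cball 0 R'")
      case True
      then have "norm z \<le> R + R'"
        using z norm_Pair_le[of "fst z" "snd z"] by auto
      then show ?thesis by simp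
    qed (auto simp: sp)
  qed
  then have "measure \<pi> (cball 0 R \<times> UNIV) \<le> measure \<pi> (cball 0 (R + R') \<union> (space \<pi> - UNIV \<times> cball 0 R'))"
    by (intro finite_measure_mono sets.Un sets.Diff sets.top meas meas')
  also have "\<dots> \<le> measure \<pi> (cball 0 (R + R')) + measure \<pi> (space \<pi> - UNIV \<times> cball 0 R')"
    by (intro measure_Un_le sets.Diff sets.top meas meas')
  also have "measure \<pi> (space \<pi> - UNIV \<times> cball 0 R') = 1 - measure \<pi> (UNIV \<times> cball 0 R')"
    by (rule prob_compl[OF meas(2)])
  finally show ?thesis
    using assms(2,3) mP mQ by simp
qed

text \<open>Near a point outside \<open>L\<close> the sets \<open>A k\<close>, and with them the
  supports, are eventually absent. A bump there has integral 0 along the sequence and hence in the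
  limit.\<close>

lemma spt_subset_kuratowski_limit:
  fixes \<nu> :: "'b::euclidean_space measure"
  assumes \<mu>: "\<And>n. prob_space (\<mu> n)" "\<And>n. sets (\<mu> n) = sets borel" "\<And>n. spt (\<mu> n) \<subseteq> A n"
    and \<nu>: "prob_space \<nu>" "sets \<nu> = sets borel"
    and conv: "\<And>f B. continuous_on UNIV f \<Longrightarrow> (\<And>x. \<bar>f x\<bar> \<le> B) \<Longrightarrow>
      (\<lambda>n. \<integral>x. f x \<partial>\<mu> n) \<longlonglongrightarrow> (\<integral>x. f x \<partial>\<nu> :: real)"
    and A: "kuratowski_limit A L"
  shows "spt \<nu> \<subseteq> L"
proof (rule subsetI, rule ccontr)
  fix z assume z: "z \<in> spt \<nu>" "z \<notin> L"
  obtain G where G: "open G" "z \<in> G" "\<forall>\<^sub>F k in sequentially. A k \<inter> G = {}"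
    by (rule kuratowski_limit_missed_nhd[OF A z(2)])
  \<comment> \<open>Cutting down to a bounded set ensures \<open>U \<noteq> UNIV\<close>, so that
    the bump is positive on \<open>U\<close>.\<close>
  define U where "U = G \<inter> ball z 1"
  have "bounded U" unfolding U_def by (intro bounded_Int) simp
  then have U: "open U" "U \<noteq> UNIV" "z \<in> U"
    using G not_bounded_UNIV by (auto simp: U_def)
  have "\<forall>\<^sub>F k in sequentially. (\<integral>x. bump U 1 x \<partial>\<mu> k) = 0"
    using G(3)
  proof eventually_elim
    case (elim k)
    have "AE x in \<mu> k. bump U 1 x = 0"
      using AE_in_spt[OF \<mu>(2)[of k]]
      by (rule eventually_mono) (use \<mu>(3)[of k] elim in \<open>auto intro!: bump_outside simp: U_def\<close>)
    then show ?case by (rule integral_eq_zero_AE)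
  qed
  then have "(\<lambda>k. \<integral>x. bump U 1 x \<partial>\<mu> k) \<longlonglongrightarrow> 0"
    by (rule tendsto_eventually)
  then have "(\<integral>x. bump U 1 x \<partial>\<nu>) = 0"
    using LIMSEQ_unique conv[OF bump_continuous bump_range(3)] by blast
  then have "AE x in \<nu>. bump U 1 x = 0"
    using integral_nonneg_eq_0_iff_AE[OF integrable_bounded_continuous[OF \<nu> bump_continuous bump_range(3)]]
    by (simp add: bump_range)
  then have "AE x in \<nu>. x \<notin> U"
    by (rule eventually_mono) (use bump_positive[OF U(1,2), of _ 1] in force)
  then have "emeasure \<nu> {x \<in> space \<nu>. x \<in> U} = 0"
    using \<nu>(2) U(1) by (subst (asm) AE_iff_measurable[OF _ refl]) (simp_all add: sets_eq_imp_space_eq[OF \<nu>(2)])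
  then have "emeasure \<nu> U = 0"
    by (simp add: sets_eq_imp_space_eq[OF \<nu>(2)])
  then show False
    using z(1) U unfolding spt_def by fastforce
qed

lemma spt_nonempty:
  fixes \<mu> :: "'b::second_countable_topology measure"
  assumes "prob_space \<mu>" "sets \<mu> = sets borel"
  shows "spt \<mu> \<noteq> {}"
  using spt_Int_nonempty[OF assms(2) open_UNIV] prob_space.emeasure_space_1[OF assms(1)]
    sets_eq_imp_space_eq[OF assms(2)] by auto

locale stable_plan =
  fixes P Q :: "'a::euclidean_space measure" and \<pi> T
  assumes limit_admissible: "admissible P Q \<pi> T"
    and unique: "\<And>\<pi>'. \<pi>' \<in> couplings P Q \<Longrightarrow> cyclically_monotone (spt \<pi>') \<Longrightarrow> \<pi>' = \<pi>"

text \<open>Convergence of the margins is required for countably many test functions only. This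
  suffices for tightness and for identifying the limit, and it is what finitely many conditions at
  each stage can produce.\<close>

locale plan_sequence = stable_plan P Q \<pi> T
  for P Q :: "'a::euclidean_space measure" and \<pi> T +
  fixes Pn Qn :: "nat \<Rightarrow> 'a measure" and \<pi>n Tn
  assumes seq_admissible: "\<And>n. admissible (Pn n) (Qn n) (\<pi>n n) (Tn n)"
    and P_conv: "\<And>j. (\<lambda>n. \<integral>x. test_function j x \<partial>Pn n) \<longlonglongrightarrow> (\<integral>x. test_function j x \<partial>P)"
    and Q_conv: "\<And>j. (\<lambda>n. \<integral>x. test_function j x \<partial>Qn n) \<longlonglongrightarrow> (\<integral>x. test_function j x \<partial>Q)"
begin

lemma subsequence:
  assumes "strict_mono (s :: nat \<Rightarrow> nat)"
  shows "plan_sequence P Q \<pi> T (Pn \<circ> s) (Qn \<circ> s) (\<pi>n \<circ> s) (Tn \<circ> s)"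
  by unfold_locales
    (use seq_admissible LIMSEQ_subseq_LIMSEQ[OF P_conv assms] LIMSEQ_subseq_LIMSEQ[OF Q_conv assms]
      in \<open>simp_all add: o_def\<close>)

lemma subsequential_limit:
  obtains r L where "strict_mono (r :: nat \<Rightarrow> nat)" "kuratowski_limit (Tn \<circ> r) L" "minty L" "spt \<pi> \<subseteq> L"
    "\<And>f B. continuous_on UNIV f \<Longrightarrow> (\<And>x. \<bar>f x\<bar> \<le> B) \<Longrightarrow>
      (\<lambda>n. \<integral>x. f x \<partial>\<pi>n (r n)) \<longlonglongrightarrow> (\<integral>x. f x \<partial>\<pi> :: real)"
proof -
  note lim = admissibleD[OF limit_admissible] and sq = admissibleD[OF seq_admissible]
  have \<pi>n: "prob_space (\<pi>n n)" "sets (\<pi>n n) = sets borel" for n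
    using couplingsD[OF sq(5)[of n]] by auto
  have "\<exists>R. \<forall>n. measure (\<pi>n n) (cball 0 R) > 1 - e" if "e > 0" for e
  proof -
    have e: "e / 2 > 0" using that by simp
    obtain R where R: "\<And>n. measure (Pn n) (cball 0 R) > 1 - e / 2"
      by (rule tight_by_test_functions[of Pn P, OF sq(1,2) lim(1,2) P_conv e]) blast
    obtain R' where R': "\<And>n. measure (Qn n) (cball 0 R') > 1 - e / 2"
      by (rule tight_by_test_functions[of Qn Q, OF sq(3,4) lim(3,4) Q_conv e]) blast
    show ?thesis
      using coupling_tight[OF sq(5) R R'] by (intro exI[of _ "R + R'"]) simp
  qed
  then obtain r \<nu> where r: "strict_mono (r :: nat \<Rightarrow> nat)" and \<nu>: "prob_space \<nu>" "sets \<nu> = sets borel"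
    and conv: "\<And>f B. continuous_on UNIV f \<Longrightarrow> (\<And>x. \<bar>f x\<bar> \<le> B) \<Longrightarrow>
      (\<lambda>n. \<integral>x. f x \<partial>\<pi>n (r n)) \<longlonglongrightarrow> (\<integral>x. f x \<partial>\<nu> :: real)"
    by (rule tight_convergent_subsequence[of \<pi>n, OF \<pi>n]) blast+
  obtain q L where q: "strict_mono (q :: nat \<Rightarrow> nat)" and L: "kuratowski_limit ((Tn \<circ> r) \<circ> q) L"
    by (rule kuratowski_limit_compact)
  have conv': "(\<lambda>n. \<integral>x. f x \<partial>\<pi>n ((r \<circ> q) n)) \<longlonglongrightarrow> (\<integral>x. f x \<partial>\<nu> :: real)"
    if "continuous_on UNIV f" "\<And>x. \<bar>f x\<bar> \<le> B" for f B
    using LIMSEQ_subseq_LIMSEQ[OF conv[OF that] q] by (simp add: o_def)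
  have rq: "strict_mono (r \<circ> q)" using r q by (rule strict_mono_o)
  have marg: "distr \<nu> borel fst = P" "distr \<nu> borel snd = Q"
  proof -
    have ps: "prob_space (distr \<nu> borel fst)" "prob_space (distr \<nu> borel snd)"
      using prob_space.prob_space_distr[OF \<nu>(1)] fst_snd_measurable_borel[OF \<nu>(2)] by auto
    have tm: "test_function j \<in> borel_measurable (borel :: 'a measure)" for j
      using test_function_continuous by (rule borel_measurable_continuous_onI)
    have c: "continuous_on UNIV (\<lambda>z :: 'a \<times> 'a. test_function j (fst z) :: real)"
      "continuous_on UNIV (\<lambda>z :: 'a \<times> 'a. test_function j (snd z) :: real)" for j
      by (auto intro!: continuous_on_compose2[OF test_function_continuous[of j]] continuous_intros)
    show "distr \<nu> borel fst = P"
    proof (rule measure_eq_by_test_functions[OF ps(1) _ lim(1,2)])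
      fix j
      have "(\<integral>x. test_function j x \<partial>distr \<nu> borel fst) = (\<integral>z. test_function j (fst z) \<partial>\<nu>)"
        by (rule integral_distr[OF fst_snd_measurable_borel(1)[OF \<nu>(2)] tm])
      moreover have "(\<lambda>n. \<integral>z. test_function j (fst z) \<partial>\<pi>n (r n)) \<longlonglongrightarrow> (\<integral>z. test_function j (fst z) \<partial>\<nu>)"
        by (rule conv[OF c(1) test_function_bound])
      then have "(\<lambda>n. \<integral>x. test_function j x \<partial>Pn (r n)) \<longlonglongrightarrow> (\<integral>z. test_function j (fst z) \<partial>\<nu>)"
        by (simp add: coupling_integral(1)[OF sq(5) test_function_continuous])
      ultimately show "(\<integral>x. test_function j x \<partial>distr \<nu> borel fst) = (\<integral>x. test_function j x \<partial>P)"
        using LIMSEQ_unique LIMSEQ_subseq_LIMSEQ[OF P_conv r] by (simp add: o_def) blast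
    qed simp
    show "distr \<nu> borel snd = Q"
    proof (rule measure_eq_by_test_functions[OF ps(2) _ lim(3,4)])
      fix j
      have "(\<integral>x. test_function j x \<partial>distr \<nu> borel snd) = (\<integral>z. test_function j (snd z) \<partial>\<nu>)"
        by (rule integral_distr[OF fst_snd_measurable_borel(2)[OF \<nu>(2)] tm])
      moreover have "(\<lambda>n. \<integral>z. test_function j (snd z) \<partial>\<pi>n (r n)) \<longlonglongrightarrow> (\<integral>z. test_function j (snd z) \<partial>\<nu>)"
        by (rule conv[OF c(2) test_function_bound])
      then have "(\<lambda>n. \<integral>x. test_function j x \<partial>Qn (r n)) \<longlonglongrightarrow> (\<integral>z. test_function j (snd z) \<partial>\<nu>)"
        by (simp add: coupling_integral(2)[OF sq(5) test_function_continuous])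
      ultimately show "(\<integral>x. test_function j x \<partial>distr \<nu> borel snd) = (\<integral>x. test_function j x \<partial>Q)"
        using LIMSEQ_unique LIMSEQ_subseq_LIMSEQ[OF Q_conv r] by (simp add: o_def) blast
    qed simp
  qed
  have L': "kuratowski_limit (\<lambda>n. Tn ((r \<circ> q) n)) L"
    using L by (simp add: o_def)
  have spt_L: "spt \<nu> \<subseteq> L"
    by (rule spt_subset_kuratowski_limit[OF \<pi>n sq(9) \<nu> conv' L'])
  moreover have "cyclically_monotone L"
    by (rule kuratowski_limit_cyclically_monotone[OF L' sq(8)])
  ultimately have eq: "\<nu> = \<pi>"
    using \<nu> marg cyclically_monotone_subset
    by (intro unique) (auto simp: couplings_def prob_measures_euclidean_iff)
  \<comment> \<open>The graphs cannot escape to infinity: \<open>L\<close> contains the support of a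
    probability measure and is therefore non-empty.\<close>
  have minty_L: "minty L"
    using spt_L spt_nonempty[OF \<nu>] by (intro kuratowski_limit_minty[OF L' sq(7)]) auto
  show ?thesis
  proof (rule that[OF rq _ minty_L])
    show "kuratowski_limit (Tn \<circ> (r \<circ> q)) L"
      using L by (simp only: comp_assoc)
    show "spt \<pi> \<subseteq> L"
      using spt_L eq by simp
    show "(\<lambda>n. \<integral>x. f x \<partial>\<pi>n ((r \<circ> q) n)) \<longlonglongrightarrow> (\<integral>x. f x \<partial>\<pi> :: real)"
      if "continuous_on UNIV f" "\<And>x. \<bar>f x\<bar> \<le> B" for f B
      using conv'[OF that] eq by simp
  qed
qed

lemma subsubsequential_limit:
  assumes "strict_mono (s :: nat \<Rightarrow> nat)"
  obtains r L where "strict_mono (r :: nat \<Rightarrow> nat)" "kuratowski_limit (\<lambda>n. Tn (s (r n))) L" "minty L" "spt \<pi> \<subseteq> L"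
    "\<And>f B. continuous_on UNIV f \<Longrightarrow> (\<And>x. \<bar>f x\<bar> \<le> B) \<Longrightarrow>
      (\<lambda>n. \<integral>x. f x \<partial>\<pi>n (s (r n))) \<longlonglongrightarrow> (\<integral>x. f x \<partial>\<pi> :: real)"
proof -
  interpret sub: plan_sequence P Q \<pi> T "Pn \<circ> s" "Qn \<circ> s" "\<pi>n \<circ> s" "Tn \<circ> s"
    by (rule subsequence[OF assms])
  show ?thesis
  proof (rule sub.subsequential_limit)
    fix r L
    assume "strict_mono (r :: nat \<Rightarrow> nat)" "kuratowski_limit (Tn \<circ> s \<circ> r) L" "minty L" "spt \<pi> \<subseteq> L"
      "\<And>f B. continuous_on UNIV f \<Longrightarrow> (\<And>x. \<bar>f x\<bar> \<le> B) \<Longrightarrow>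
        (\<lambda>n. \<integral>x. f x \<partial>(\<pi>n \<circ> s) (r n)) \<longlonglongrightarrow> (\<integral>x. f x \<partial>\<pi> :: real)"
    then show ?thesis
      unfolding o_def by (rule that)
  qed
qed

lemma plan_convergence:
  assumes f: "continuous_on UNIV f" "\<And>x. \<bar>f x\<bar> \<le> B"
  shows "(\<lambda>n. \<integral>x. f x \<partial>\<pi>n n) \<longlonglongrightarrow> (\<integral>x. f x \<partial>\<pi> :: real)"
proof (rule topological_tendstoI, rule eventually_by_subsequences)
  fix U and s :: "nat \<Rightarrow> nat" assume U: "open U" "(\<integral>x. f x \<partial>\<pi>) \<in> U" and s: "strict_mono s"
  show "\<exists>r :: nat \<Rightarrow> nat. strict_mono r \<and> (\<forall>\<^sub>F k in sequentially. (\<integral>x. f x \<partial>\<pi>n (s (r k))) \<in> U)"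
    by (rule subsubsequential_limit[OF s]) (use topological_tendstoD[OF _ U] f in blast)
qed

end

section \<open>Agreement over the interior of the support\<close>

context stable_plan
begin

abbreviation "V \<equiv> interior (spt P)"

lemma V_dense: "V \<subseteq> closure (Domain (spt \<pi>))"
  using interior_subset spt_fst_dense[OF admissibleD(5)[OF limit_admissible]] by (rule subset_trans)

lemma V_Domain: "V \<subseteq> Domain T"
proof
  fix x assume "x \<in> V"
  then obtain A \<rho> where A: "finite A" "A \<subseteq> Domain (spt \<pi>) \<inter> V" "\<rho> > 0" "surrounds \<rho> x A"
    by (rule surrounds_dense[OF open_interior _ V_dense])
  then have "A \<subseteq> Domain T" using admissibleD(9)[OF limit_admissible] by blast
  then show "x \<in> Domain T"
    by (rule minty_surrounds_in_Domain[OF admissibleD(7)[OF limit_admissible] A(4,3,1)])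
qed

lemma same_on_V:
  assumes L: "minty L" "spt \<pi> \<subseteq> L" and x: "x \<in> V"
  shows "(x, y) \<in> L \<longleftrightarrow> (x, y) \<in> T"
  using minty_contains_monotone[OF L(1) minty_monotone[OF admissibleD(7)[OF limit_admissible]] L(2)
      admissibleD(9)[OF limit_admissible] open_interior V_dense x]
    minty_contains_monotone[OF admissibleD(7)[OF limit_admissible] minty_monotone[OF L(1)]
      admissibleD(9)[OF limit_admissible] L(2) open_interior V_dense x] by blast

end

context plan_sequence
begin

lemma graph_convergence_on_V: "graph_convergence Tn T V"
proof
  show "minty (Tn n)" for n by (rule admissibleD(7)[OF seq_admissible])
  show "minty T" by (rule admissibleD(7)[OF limit_admissible])
  show "open V" "V \<subseteq> Domain T" using V_Domain by auto
  show "\<forall>\<^sub>F n in sequentially. Tn n \<inter> G \<noteq> {}" if G: "open G" "G \<subseteq> V \<times> UNIV" "T \<inter> G \<noteq> {}" for G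
  proof (rule eventually_by_subsequences)
    fix s :: "nat \<Rightarrow> nat" assume s: "strict_mono s"
    obtain r L where r: "strict_mono (r :: nat \<Rightarrow> nat)" "kuratowski_limit (\<lambda>n. Tn (s (r n))) L" "minty L" "spt \<pi> \<subseteq> L"
      by (rule subsubsequential_limit[OF s]) blast
    have "L \<inter> G \<noteq> {}" using G(2,3) same_on_V[OF r(3,4)] by fastforce
    then show "\<exists>r :: nat \<Rightarrow> nat. strict_mono r \<and> (\<forall>\<^sub>F k in sequentially. Tn (s (r k)) \<inter> G \<noteq> {})"
      using kuratowski_limit_hit[OF r(2) G(1)] r(1) by blast
  qed
  show "\<forall>\<^sub>F n in sequentially. Tn n \<inter> K = {}" if K: "compact K" "K \<subseteq> V \<times> UNIV" "T \<inter> K = {}" for K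
  proof (rule eventually_by_subsequences)
    fix s :: "nat \<Rightarrow> nat" assume s: "strict_mono s"
    obtain r L where r: "strict_mono (r :: nat \<Rightarrow> nat)" "kuratowski_limit (\<lambda>n. Tn (s (r n))) L" "minty L" "spt \<pi> \<subseteq> L"
      by (rule subsubsequential_limit[OF s]) blast
    have "L \<inter> K = {}" using K(2,3) same_on_V[OF r(3,4)] by fastforce
    then show "\<exists>r :: nat \<Rightarrow> nat. strict_mono r \<and> (\<forall>\<^sub>F k in sequentially. Tn (s (r k)) \<inter> K = {})"
      using kuratowski_limit_miss[OF r(2) K(1)] r(1) by blast
  qed
qed

text \<open>Every subsequential limit \<open>L\<close> agrees with \<open>T\<close> over
  \<open>U\<close>. This common part has range \<open>T(U)\<close>, which lies in the interior of
  \<open>Range T\<close> and is dense in \<open>Range T\<close>; the comparison by inverses then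
  identifies \<open>L\<close> with \<open>T\<close> everywhere.\<close>

lemma graph_convergence_bounded_range:
  assumes U: "open U" "U \<subseteq> spt P" "T `` U \<subseteq> interior (Range T)" "Range T \<subseteq> closure (T `` U)"
    and rge: "\<And>n. Range (Tn n) \<subseteq> closure (Range T)"
  shows "kuratowski_limit Tn T"
proof -
  have T: "minty T" by (rule admissibleD(7)[OF limit_admissible])
  have UV: "U \<subseteq> V" using U(1,2) by (rule interior_maximal[rotated])
  have sub: "\<exists>r :: nat \<Rightarrow> nat. strict_mono r \<and> kuratowski_limit (\<lambda>n. Tn (s (r n))) T"
    if s: "strict_mono (s :: nat \<Rightarrow> nat)" for s
  proof -
    obtain r L where r: "strict_mono (r :: nat \<Rightarrow> nat)" "kuratowski_limit (\<lambda>n. Tn (s (r n))) L" "minty L" "spt \<pi> \<subseteq> L"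
      by (rule subsubsequential_limit[OF s]) blast
    have "Range L \<subseteq> closure (Range T)"
    proof
      fix y assume "y \<in> Range L"
      then obtain x where xy: "(x, y) \<in> L" by blast
      obtain \<zeta> where \<zeta>: "\<zeta> \<longlonglongrightarrow> (x, y)" "\<forall>\<^sub>F k in sequentially. \<zeta> k \<in> Tn (s (r k))"
        by (rule kuratowski_limit_sequence[OF r(2) xy])
      have "\<forall>\<^sub>F k in sequentially. snd (\<zeta> k) \<in> closure (Range T)"
        using \<zeta>(2) by eventually_elim (metis Range.intros prod.collapse rge subsetD)
      then show "y \<in> closure (Range T)"
        using Lim_in_closed_set[OF closed_closure _ sequentially_bot tendsto_snd[OF \<zeta>(1)]] by simp
    qed
    moreover have "Range (T \<inter> U \<times> UNIV) = T `` U" by auto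
    ultimately have "L = T"
      using U UV same_on_V[OF r(3,4)]
      by (intro minty_eq_of_dense_Range[OF T r(3), of "T \<inter> U \<times> UNIV"]) auto
    then show ?thesis using r by blast
  qed
  show ?thesis
    unfolding kuratowski_limit_def
  proof (intro conjI allI impI)
    fix z G assume z: "z \<in> T" "open G" "z \<in> G"
    show "\<forall>\<^sub>F k in sequentially. Tn k \<inter> G \<noteq> {}"
      by (rule eventually_by_subsequences) (use sub kuratowski_limit_hit z in blast)
  next
    fix z assume "z \<notin> T"
    \<comment> \<open>Misses along subsequences are available for compact sets, hence a closed ball;
      its open ball is the required neighbourhood.\<close>
    then obtain e where e: "e > 0" "cball z e \<subseteq> - T"
      using minty_closed[OF T] open_contains_cball[of "- T"] by auto
    have "\<forall>\<^sub>F k in sequentially. Tn k \<inter> cball z e = {}"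
      by (rule eventually_by_subsequences) (use sub kuratowski_limit_miss[OF _ compact_cball] e in blast)
    then have "\<forall>\<^sub>F k in sequentially. Tn k \<inter> ball z e = {}"
      by eventually_elim (use ball_subset_cball in blast)
    then show "\<exists>G. open G \<and> z \<in> G \<and> (\<forall>\<^sub>F k in sequentially. Tn k \<inter> G = {})"
      using e(1) by (intro exI[of _ "ball z e"]) simp
  qed
qed

end

section \<open>Random elements and modes of convergence\<close>

lemma space_borel_of [simp]: "space (borel_of X) = topspace X"
  unfolding borel_of_def by (rule space_measure_of) (auto dest: openin_subset)

lemma openin_in_sets_borel_of: "openin X U \<Longrightarrow> U \<in> sets (borel_of X)"
  unfolding borel_of_def by (subst sets_measure_of) (auto dest: openin_subset)

lemma measurable_borel_ofI:
  assumes "f \<in> space M \<rightarrow> topspace X" "\<And>U. openin X U \<Longrightarrow> f -` U \<inter> space M \<in> sets M"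
  shows "f \<in> M \<rightarrow>\<^sub>M borel_of X"
  unfolding borel_of_def by (rule measurable_measure_of) (use assms in \<open>auto dest: openin_subset\<close>)

lemma continuous_map_measurable:
  assumes "continuous_map X Y g"
  shows "g \<in> borel_of X \<rightarrow>\<^sub>M borel_of Y"
proof (rule measurable_borel_ofI)
  show "g \<in> space (borel_of X) \<rightarrow> topspace Y"
    using continuous_map_funspace[OF assms] by simp
  fix U assume "openin Y U"
  then have "openin X {x \<in> topspace X. g x \<in> U}"
    by (rule openin_continuous_map_preimage[OF assms])
  moreover have "{x \<in> topspace X. g x \<in> U} = g -` U \<inter> space (borel_of X)" by auto
  ultimately show "g -` U \<inter> space (borel_of X) \<in> sets (borel_of X)"
    using openin_in_sets_borel_of by metis
qed

section \<open>Convergence in generated topologies and in distribution\<close>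

lemma limitin_generatedI:
  assumes "L \<in> \<Union>S" "\<And>B. B \<in> S \<Longrightarrow> L \<in> B \<Longrightarrow> \<forall>\<^sub>F n in F. f n \<in> B"
  shows "limitin (topology_generated_by S) f L F"
proof -
  have "L \<in> U \<longrightarrow> (\<forall>\<^sub>F n in F. f n \<in> U)" if "generate_topology_on S U" for U
    using that
  proof induction
    case (UN K)
    show ?case
    proof
      assume "L \<in> \<Union>K"
      then obtain k where k: "k \<in> K" "L \<in> k" by blast
      then have "\<forall>\<^sub>F n in F. f n \<in> k" using UN by blast
      then show "\<forall>\<^sub>F n in F. f n \<in> \<Union>K" by eventually_elim (use k in blast)
    qed
  qed (use assms(2) in \<open>auto simp: eventually_conj_iff\<close>)
  then show ?thesis
    using assms(1) unfolding limitin_def openin_topology_generated_by_iff by auto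
qed

lemma weak_evaluation_continuous:
  assumes "continuous_map X euclideanreal f" "bounded (f ` topspace X)"
  shows "continuous_map (weak_topology X) euclideanreal (\<lambda>\<mu>. integral\<^sup>L \<mu> f)"
  unfolding continuous_map_def
proof (intro conjI allI impI)
  fix U :: "real set" assume "openin euclideanreal U"
  then show "openin (weak_topology X) {\<mu> \<in> topspace (weak_topology X). integral\<^sup>L \<mu> f \<in> U}"
    unfolding topspace_weak_topology unfolding weak_topology_def
    using assms by (intro topology_generated_by_Basis) auto
qed auto

lemma limitin_weakI:
  assumes "\<And>n. \<mu> n \<in> prob_measures X" "\<nu> \<in> prob_measures X"
    and "\<And>f. continuous_map X euclideanreal f \<Longrightarrow> bounded (f ` topspace X) \<Longrightarrow>
      (\<lambda>n. integral\<^sup>L (\<mu> n) f) \<longlonglongrightarrow> integral\<^sup>L \<nu> f"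
  shows "limitin (weak_topology X) \<mu> \<nu> sequentially"
  unfolding weak_topology_def
proof (rule limitin_generatedI)
  show "\<nu> \<in> \<Union>{{\<mu> \<in> prob_measures X. integral\<^sup>L \<mu> f \<in> U} | f U.
      continuous_map X euclideanreal f \<and> bounded (f ` topspace X) \<and> open U}"
    using assms(2) topspace_weak_topology[of X] unfolding weak_topology_def topology_generated_by_topspace
    by blast
next
  fix B assume B: "B \<in> {{\<mu> \<in> prob_measures X. integral\<^sup>L \<mu> f \<in> U} | f U.
      continuous_map X euclideanreal f \<and> bounded (f ` topspace X) \<and> open U}" "\<nu> \<in> B"
  then obtain f U where f: "continuous_map X euclideanreal f" "bounded (f ` topspace X)" "open U"
    and B': "B = {\<mu> \<in> prob_measures X. integral\<^sup>L \<mu> f \<in> U}"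
    by auto
  have "integral\<^sup>L \<nu> f \<in> U" using B(2) B' by simp
  then have "\<forall>\<^sub>F n in sequentially. integral\<^sup>L (\<mu> n) f \<in> U"
    by (rule topological_tendstoD[OF assms(3)[OF f(1,2)] f(3)])
  then show "\<forall>\<^sub>F n in sequentially. \<mu> n \<in> B"
    using assms(1) B' by simp
qed

lemma limitin_weakD:
  assumes "limitin (weak_topology X) \<mu> \<nu> sequentially"
    and "continuous_map X euclideanreal f" "bounded (f ` topspace X)"
  shows "(\<lambda>n. integral\<^sup>L (\<mu> n) f) \<longlonglongrightarrow> integral\<^sup>L \<nu> f"
  using continuous_map_limit[OF weak_evaluation_continuous[OF assms(2,3)] assms(1)]
  by (simp add: o_def)

lemma measurable_real_borel_of:
  assumes "continuous_map X euclideanreal f"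
  shows "f \<in> borel_measurable (borel_of X)"
  using continuous_map_measurable[OF assms] by (simp add: borel_of_euclidean)

text \<open>The bounded continuous function \<open>min 1 \<bar>h x - h L\<bar>\<close> vanishes at
  \<open>L\<close>, so its expectations tend to 0, and Markov's inequality applies.\<close>

lemma in_distributionD:
  assumes M: "\<And>n. prob_space (M n)" and Y: "\<And>n. Y n \<in> M n \<rightarrow>\<^sub>M borel_of X" and L: "L \<in> topspace X"
    and lim: "limitin (weak_topology X) (\<lambda>n. distr (M n) (borel_of X) (Y n)) (return (borel_of X) L) sequentially"
    and h: "continuous_map X euclideanreal h" and e: "e > 0"
  shows "(\<lambda>n. measure (M n) {\<omega> \<in> space (M n). \<bar>h (Y n \<omega>) - h L\<bar> < e}) \<longlonglongrightarrow> 1"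
proof -
  define g where "g x = min 1 \<bar>h x - h L\<bar>" for x
  \<comment> \<open>Because \<open>g\<close> is truncated at 1, a deviation of \<open>h\<close> by
    at least \<open>e\<close> guarantees only the value \<open>min 1 e\<close>.\<close>
  define d where "d = min 1 e"
  have d: "d > 0" using e by (simp add: d_def)
  have g: "continuous_map X euclideanreal g"
    unfolding g_def
    by (intro continuous_map_real_min continuous_map_real_abs continuous_map_diff h continuous_map_const[THEN iffD2]) auto
  have g_range: "0 \<le> g x" "g x \<le> 1" for x by (auto simp: g_def)
  have "bounded (g ` topspace X)"
    using g_range by (auto simp: bounded_iff intro!: exI[of _ 1])
  then have "(\<lambda>n. integral\<^sup>L (distr (M n) (borel_of X) (Y n)) g) \<longlonglongrightarrow> integral\<^sup>L (return (borel_of X) L) g"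
    by (rule limitin_weakD[OF lim g])
  moreover have "integral\<^sup>L (distr (M n) (borel_of X) (Y n)) g = (\<integral>\<omega>. g (Y n \<omega>) \<partial>M n)" for n
    by (rule integral_distr[OF Y measurable_real_borel_of[OF g]])
  moreover have "integral\<^sup>L (return (borel_of X) L) g = 0"
    using L measurable_real_borel_of[OF g] by (subst integral_return) (auto simp: g_def)
  ultimately have E: "(\<lambda>n. \<integral>\<omega>. g (Y n \<omega>) \<partial>M n) \<longlonglongrightarrow> 0"
    by simp
  have lower: "1 - (\<integral>\<omega>. g (Y n \<omega>) \<partial>M n) / d \<le> measure (M n) {\<omega> \<in> space (M n). \<bar>h (Y n \<omega>) - h L\<bar> < e}"
    and upper: "measure (M n) {\<omega> \<in> space (M n). \<bar>h (Y n \<omega>) - h L\<bar> < e} \<le> 1" for n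
  proof -
    interpret prob_space "M n" by (rule M)
    let ?B = "{\<omega> \<in> space (M n). \<bar>h (Y n \<omega>) - h L\<bar> < e}"
    have hY: "(\<lambda>\<omega>. h (Y n \<omega>)) \<in> borel_measurable (M n)"
      by (rule measurable_compose[OF Y measurable_real_borel_of[OF h]])
    have gY: "(\<lambda>\<omega>. g (Y n \<omega>)) \<in> borel_measurable (M n)"
      by (rule measurable_compose[OF Y measurable_real_borel_of[OF g]])
    have B: "?B \<in> sets (M n)"
      using hY by measurable
    have "(\<integral>\<omega>. d * indicator (space (M n) - ?B) \<omega> \<partial>M n) \<le> (\<integral>\<omega>. g (Y n \<omega>) \<partial>M n)"
    proof (rule integral_mono)
      show "integrable (M n) (\<lambda>\<omega>. d * indicator (space (M n) - ?B) \<omega>)"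
        using B by (intro integrable_mult_right) (auto simp: emeasure_eq_measure)
      show "integrable (M n) (\<lambda>\<omega>. g (Y n \<omega>))"
        using g_range by (intro integrable_const_bound[of _ 1] gY) auto
      show "d * indicator (space (M n) - ?B) \<omega> \<le> g (Y n \<omega>)" for \<omega>
        using g_range[of "Y n \<omega>"] by (auto simp: indicator_def g_def d_def)
    qed
    moreover have "(\<integral>\<omega>. d * indicator (space (M n) - ?B) \<omega> \<partial>M n) = d * (1 - measure (M n) ?B)"
      using prob_compl[OF B] by (simp add: Int_absorb2)
    ultimately show "1 - (\<integral>\<omega>. g (Y n \<omega>) \<partial>M n) / d \<le> measure (M n) ?B"
      using d by (simp add: field_simps)
    show "measure (M n) ?B \<le> 1" by (rule prob_le_1)
  qed
  have "(\<lambda>n. 1 - (\<integral>\<omega>. g (Y n \<omega>) \<partial>M n) / d) \<longlonglongrightarrow> 1 - 0 / d"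
    using d by (intro tendsto_intros E) auto
  then have "(\<lambda>n. 1 - (\<integral>\<omega>. g (Y n \<omega>) \<partial>M n) / d) \<longlonglongrightarrow> 1" by simp
  then show ?thesis
    by (rule tendsto_sandwich[OF _ _ _ tendsto_const, rotated 2]) (use lower upper in auto)
qed

text \<open>A bounded continuous \<open>f\<close> is close to \<open>f L\<close> on a neighbourhood
  of \<open>L\<close>; the complementary event has small probability and costs at most twice the
  bound of \<open>f\<close>.\<close>

lemma in_distributionI:
  assumes M: "\<And>n. prob_space (M n)" and Y: "\<And>n. Y n \<in> M n \<rightarrow>\<^sub>M borel_of X" and L: "L \<in> topspace X"
    and lim: "\<And>U. openin X U \<Longrightarrow> L \<in> U \<Longrightarrow> (\<lambda>n. measure (M n) {\<omega> \<in> space (M n). Y n \<omega> \<in> U}) \<longlonglongrightarrow> 1"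
  shows "limitin (weak_topology X) (\<lambda>n. distr (M n) (borel_of X) (Y n)) (return (borel_of X) L) sequentially"
proof (rule limitin_weakI)
  show "distr (M n) (borel_of X) (Y n) \<in> prob_measures X" for n
    using prob_space.prob_space_distr[OF M Y] by (simp add: prob_measures_def)
  show "return (borel_of X) L \<in> prob_measures X"
    using L by (simp add: prob_measures_def prob_space_return)
next
  fix f assume f: "continuous_map X euclideanreal f" "bounded (f ` topspace X)"
  have fm: "f \<in> borel_measurable (borel_of X)"
    by (rule measurable_real_borel_of[OF f(1)])
  obtain B where B: "B > 0" "\<And>x. x \<in> topspace X \<Longrightarrow> \<bar>f x\<bar> \<le> B"
    using f(2) by (auto simp: bounded_pos)
  have ret: "integral\<^sup>L (return (borel_of X) L) f = f L"
    using L fm by (subst integral_return) auto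
  have dist: "integral\<^sup>L (distr (M n) (borel_of X) (Y n)) f = (\<integral>\<omega>. f (Y n \<omega>) \<partial>M n)" for n
    by (rule integral_distr[OF Y fm])
  show "(\<lambda>n. integral\<^sup>L (distr (M n) (borel_of X) (Y n)) f) \<longlonglongrightarrow> integral\<^sup>L (return (borel_of X) L) f"
    unfolding ret dist
  proof (rule tendstoI)
    fix e :: real assume e: "e > 0"
    define U where "U = {x \<in> topspace X. f x \<in> ball (f L) (e / 2)}"
    have U: "openin X U" "L \<in> U"
      unfolding U_def using openin_continuous_map_preimage[OF f(1), of "ball (f L) (e / 2)"] L e by auto
    \<comment> \<open>Off the event the difference is at most \<open>2 * B\<close>, so a probability
      below \<open>e / (4 * B)\<close> contributes less than the remaining
      \<open>e / 2\<close>.\<close>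
    have "1 - e / (4 * B) < 1" using e B by simp
    then have "\<forall>\<^sub>F n in sequentially. measure (M n) {\<omega> \<in> space (M n). Y n \<omega> \<in> U} > 1 - e / (4 * B)"
      by (rule order_tendstoD(1)[OF lim[OF U]])
    then show "\<forall>\<^sub>F n in sequentially. dist (\<integral>\<omega>. f (Y n \<omega>) \<partial>M n) (f L) < e"
    proof eventually_elim
      case (elim n)
      interpret prob_space "M n" by (rule M)
      let ?A = "{\<omega> \<in> space (M n). Y n \<omega> \<in> U}"
      have A: "?A \<in> sets (M n)"
        using measurable_sets[OF Y openin_in_sets_borel_of[OF U(1)], of n] by (simp add: vimage_def Int_def conj_commute)
      have Yt: "Y n \<omega> \<in> topspace X" if "\<omega> \<in> space (M n)" for \<omega>
        using measurable_space[OF Y that] by simp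
      have fY: "(\<lambda>\<omega>. f (Y n \<omega>)) \<in> borel_measurable (M n)"
        by (rule measurable_compose[OF Y fm])
      have int: "integrable (M n) (\<lambda>\<omega>. f (Y n \<omega>))"
        using B(2) Yt by (intro integrable_const_bound[of _ B] fY) auto
      have "dist (\<integral>\<omega>. f (Y n \<omega>) \<partial>M n) (f L) = norm (\<integral>\<omega>. f (Y n \<omega>) - f L \<partial>M n)"
        using int by (simp add: dist_real_def prob_space)
      also have "\<dots> \<le> (\<integral>\<omega>. norm (f (Y n \<omega>) - f L) \<partial>M n)"
        by (rule integral_norm_bound)
      also have "\<dots> \<le> (\<integral>\<omega>. e / 2 + 2 * B * indicator (space (M n) - ?A) \<omega> \<partial>M n)"
      proof (rule integral_mono)
        show "integrable (M n) (\<lambda>\<omega>. norm (f (Y n \<omega>) - f L))"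
          using int by auto
        show "integrable (M n) (\<lambda>\<omega>. e / 2 + 2 * B * indicator (space (M n) - ?A) \<omega>)"
          using A by (intro Bochner_Integration.integrable_add integrable_mult_right) (auto simp: emeasure_eq_measure)
        show "norm (f (Y n \<omega>) - f L) \<le> e / 2 + 2 * B * indicator (space (M n) - ?A) \<omega>"
          if \<omega>: "\<omega> \<in> space (M n)" for \<omega>
        proof (cases "Y n \<omega> \<in> U")
          case True
          then show ?thesis using \<omega> by (auto simp: U_def dist_real_def abs_minus_commute)
        next
          case False
          then show ?thesis
            using B(2)[OF Yt[OF \<omega>]] B(2)[OF L] e \<omega> by (simp add: indicator_def)
        qed
      qed
      also have "\<dots> = e / 2 + 2 * B * (1 - measure (M n) ?A)"
        using A prob_compl[OF A]
        by (subst Bochner_Integration.integral_add) (auto simp: prob_space emeasure_eq_measure Int_absorb2)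
      also have "\<dots> < e / 2 + 2 * B * (e / (4 * B))"
        using elim B(1) by (intro add_strict_left_mono mult_strict_left_mono) auto
      also have "\<dots> = e" using B(1) by simp
      finally show ?case .
    qed
  qed
qed

lemma tendsto_measure_Int_1:
  assumes M: "\<And>n. prob_space (M n)" and sets: "\<And>n. A n \<in> sets (M n)" "\<And>n. B n \<in> sets (M n)"
    and A: "(\<lambda>n. measure (M n) (A n)) \<longlonglongrightarrow> 1" and B: "(\<lambda>n. measure (M n) (B n)) \<longlonglongrightarrow> 1"
  shows "(\<lambda>n. measure (M n) (A n \<inter> B n)) \<longlonglongrightarrow> 1"
proof -
  have lower: "measure (M n) (A n) + measure (M n) (B n) - 1 \<le> measure (M n) (A n \<inter> B n)"
    and upper: "measure (M n) (A n \<inter> B n) \<le> 1" for n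
  proof -
    interpret prob_space "M n" by (rule M)
    show "measure (M n) (A n) + measure (M n) (B n) - 1 \<le> measure (M n) (A n \<inter> B n)"
      using measure_Un3[of "A n" "M n" "B n"] sets prob_le_1[of "A n \<union> B n"] by (simp add: fmeasurable_eq_sets)
    show "measure (M n) (A n \<inter> B n) \<le> 1" by (rule prob_le_1)
  qed
  have "(\<lambda>n. measure (M n) (A n) + measure (M n) (B n) - 1) \<longlonglongrightarrow> 1 + 1 - 1"
    by (intro tendsto_intros A B)
  then have "(\<lambda>n. measure (M n) (A n) + measure (M n) (B n) - 1) \<longlonglongrightarrow> 1" by simp
  then show ?thesis
    by (rule tendsto_sandwich[OF _ _ _ tendsto_const, rotated 2]) (use lower upper in auto)
qed

lemma tendsto_measure_INT_1:
  assumes M: "\<And>n. prob_space (M n)" and I: "finite I" and sets: "\<And>n i. i \<in> I \<Longrightarrow> A i n \<in> sets (M n)"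
    and A: "\<And>i. i \<in> I \<Longrightarrow> (\<lambda>n. measure (M n) (A i n)) \<longlonglongrightarrow> 1"
  shows "(\<lambda>n. measure (M n) ({\<omega> \<in> space (M n). \<forall>i\<in>I. \<omega> \<in> A i n})) \<longlonglongrightarrow> 1 \<and>
    (\<forall>n. {\<omega> \<in> space (M n). \<forall>i\<in>I. \<omega> \<in> A i n} \<in> sets (M n))"
  using I sets A
proof (induction I)
  case empty
  then show ?case using prob_space.prob_space[OF M] by simp
next
  case (insert i I)
  have eq: "{\<omega> \<in> space (M n). \<forall>j\<in>insert i I. \<omega> \<in> A j n} = A i n \<inter> {\<omega> \<in> space (M n). \<forall>j\<in>I. \<omega> \<in> A j n}" for n
    using sets.sets_into_space[OF insert.prems(1)[of i n]] by auto
  have IH: "(\<lambda>n. measure (M n) {\<omega> \<in> space (M n). \<forall>i\<in>I. \<omega> \<in> A i n}) \<longlonglongrightarrow> 1"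
    "\<And>n. {\<omega> \<in> space (M n). \<forall>i\<in>I. \<omega> \<in> A i n} \<in> sets (M n)"
    using insert by auto
  show ?case
    unfolding eq using tendsto_measure_Int_1[OF M _ IH(2) _ IH(1), of "A i"] insert.prems IH(2) by auto
qed

lemma sets_completion_AE_iff:
  assumes "{\<omega> \<in> space M. Q \<omega>} \<in> sets M" "AE \<omega> in M. R \<omega> \<longleftrightarrow> Q \<omega>"
  shows "{\<omega> \<in> space M. R \<omega>} \<in> sets (completion M)"
proof -
  obtain N where N: "{\<omega> \<in> space M. \<not> (R \<omega> \<longleftrightarrow> Q \<omega>)} \<subseteq> N" "N \<in> null_sets M"
    using assms(2) unfolding eventually_ae_filter by blast
  have "{\<omega> \<in> space M. R \<omega>} = ({\<omega> \<in> space M. Q \<omega>} - N) \<union> ({\<omega> \<in> space M. R \<omega>} \<inter> N)"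
    using N(1) by auto
  then show ?thesis
    by (rule sets_completionI[OF _ _ N(2)]) (use assms(1) N(2) in auto)
qed

section \<open>Transfer from deterministic sequences to random elements\<close>

locale random_plans = stable_plan P Q \<pi> T
  for P Q :: "'a::euclidean_space measure" and \<pi> T +
  fixes mode :: mode and M :: "nat \<Rightarrow> 'w measure" and Pn Qn :: "nat \<Rightarrow> 'w \<Rightarrow> 'a measure"
    and \<pi>n :: "nat \<Rightarrow> 'w \<Rightarrow> ('a \<times> 'a) measure" and Tn :: "nat \<Rightarrow> 'w \<Rightarrow> ('a \<times> 'a) set"
  assumes prob: "\<And>n. prob_space (M n)"
    and common_space: "mode = Almost_Surely \<Longrightarrow> M n = M 0"
    and measurable_plan: "\<And>n. \<pi>n n \<in> M n \<rightarrow>\<^sub>M borel_of (weak_topology euclidean)"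
    and measurable_graph: "\<And>n. Tn n \<in> M n \<rightarrow>\<^sub>M borel_of (fell_topology euclidean)"
    and AE_admissible: "\<And>n. AE \<omega> in M n. admissible (Pn n \<omega>) (Qn n \<omega>) (\<pi>n n \<omega>) (Tn n \<omega>)"
    and P_converges: "converges mode M (weak_topology euclidean) Pn P"
    and Q_converges: "converges mode M (weak_topology euclidean) Qn Q"
begin

lemma test_function_map:
  "continuous_map euclidean euclideanreal (test_function j :: 'a \<Rightarrow> real)"
  "bounded (test_function j ` topspace (euclidean :: 'a topology))"
  using test_function_continuous[of j] test_function_bound[of j] by (auto simp: bounded_iff)

lemma plan_sequence_AE:
  assumes "mode = Almost_Surely"
  shows "AE \<omega> in M 0. plan_sequence P Q \<pi> T (\<lambda>n. Pn n \<omega>) (\<lambda>n. Qn n \<omega>) (\<lambda>n. \<pi>n n \<omega>) (\<lambda>n. Tn n \<omega>)"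
proof -
  have "AE \<omega> in M 0. admissible (Pn n \<omega>) (Qn n \<omega>) (\<pi>n n \<omega>) (Tn n \<omega>)" for n
    using AE_admissible[of n] unfolding common_space[OF assms, of n] .
  then have "AE \<omega> in M 0. \<forall>n. admissible (Pn n \<omega>) (Qn n \<omega>) (\<pi>n n \<omega>) (Tn n \<omega>)"
    by (simp add: AE_all_countable)
  moreover have "AE \<omega> in M 0. limitin (weak_topology euclidean) (\<lambda>n. Pn n \<omega>) P sequentially"
    "AE \<omega> in M 0. limitin (weak_topology euclidean) (\<lambda>n. Qn n \<omega>) Q sequentially"
    using P_converges Q_converges assms by (auto simp: converges_def)
  ultimately show ?thesis
  proof eventually_elim
    case (elim \<omega>)
    show ?case
      by unfold_locales (use elim limitin_weakD[OF _ test_function_map] in auto)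
  qed
qed

text \<open>The index \<open>k\<close> governs both the number of test functions and the accuracy.
  Choosing one pair of margins for each \<open>k\<close> therefore yields convergence for every
  fixed test function.\<close>

definition close_margins :: "nat \<Rightarrow> 'a measure \<Rightarrow> 'a measure \<Rightarrow> bool" where
  "close_margins k P' Q' \<longleftrightarrow> (\<forall>j\<in>{..k}.
     \<bar>(\<integral>x. test_function j x \<partial>P') - (\<integral>x. test_function j x \<partial>P)\<bar> < 1 / real (Suc k) \<and>
     \<bar>(\<integral>x. test_function j x \<partial>Q') - (\<integral>x. test_function j x \<partial>Q)\<bar> < 1 / real (Suc k))"

lemma close_margins_tendsto:
  assumes "\<And>k. close_margins k (P' k) (Q' k)"
  shows "(\<lambda>k. \<integral>x. test_function j x \<partial>P' k) \<longlonglongrightarrow> (\<integral>x. test_function j x \<partial>P)"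
    "(\<lambda>k. \<integral>x. test_function j x \<partial>Q' k) \<longlonglongrightarrow> (\<integral>x. test_function j x \<partial>Q)"
proof -
  have lim: "(\<lambda>k. 1 / real (Suc k)) \<longlonglongrightarrow> 0"
    using LIMSEQ_inverse_real_of_nat by (simp add: inverse_eq_divide)
  have "\<forall>\<^sub>F k in sequentially. norm ((\<integral>x. test_function j x \<partial>P' k) - (\<integral>x. test_function j x \<partial>P)) \<le> 1 / real (Suc k)"
    using eventually_ge_at_top[of j]
    by eventually_elim (use assms in \<open>force simp: close_margins_def\<close>)
  then show "(\<lambda>k. \<integral>x. test_function j x \<partial>P' k) \<longlonglongrightarrow> (\<integral>x. test_function j x \<partial>P)"
    by (intro LIM_zero_cancel[of "\<lambda>k. \<integral>x. test_function j x \<partial>P' k"] Lim_null_comparison[OF _ lim])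
  have "\<forall>\<^sub>F k in sequentially. norm ((\<integral>x. test_function j x \<partial>Q' k) - (\<integral>x. test_function j x \<partial>Q)) \<le> 1 / real (Suc k)"
    using eventually_ge_at_top[of j]
    by eventually_elim (use assms in \<open>force simp: close_margins_def\<close>)
  then show "(\<lambda>k. \<integral>x. test_function j x \<partial>Q' k) \<longlonglongrightarrow> (\<integral>x. test_function j x \<partial>Q)"
    by (intro LIM_zero_cancel[of "\<lambda>k. \<integral>x. test_function j x \<partial>Q' k"] Lim_null_comparison[OF _ lim])
qed

lemma measurable_margin_event:
  fixes Y :: "nat \<Rightarrow> 'w \<Rightarrow> 'a measure"
  assumes Y: "\<And>n. Y n \<in> M n \<rightarrow>\<^sub>M borel_of (weak_topology euclidean)"
  shows "{\<omega> \<in> space (M n). \<bar>(\<integral>x. test_function j x \<partial>Y n \<omega>) - c\<bar> < (e :: real)} \<in> sets (M n)"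
proof -
  have "(\<lambda>\<omega>. \<integral>x. test_function j x \<partial>Y n \<omega>) \<in> borel_measurable (M n)"
    by (rule measurable_compose[OF Y measurable_real_borel_of[OF weak_evaluation_continuous[OF test_function_map]]])
  then show ?thesis by measurable
qed

lemma close_margins_in_distribution:
  assumes "mode = In_Distribution"
  shows "(\<lambda>n. measure (M n) {\<omega> \<in> space (M n). close_margins k (Pn n \<omega>) (Qn n \<omega>)}) \<longlonglongrightarrow> 1"
    "\<And>n. {\<omega> \<in> space (M n). close_margins k (Pn n \<omega>) (Qn n \<omega>)} \<in> sets (M n)"
proof -
  have conv: "(\<lambda>n. measure (M n) {\<omega> \<in> space (M n).
      \<bar>(\<integral>x. test_function j x \<partial>Y n \<omega>) - (\<integral>x. test_function j x \<partial>L)\<bar> < 1 / real (Suc k)}) \<longlonglongrightarrow> 1"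
    if "converges mode M (weak_topology euclidean) Y L" for Y :: "nat \<Rightarrow> 'w \<Rightarrow> 'a measure" and L j
    using that assms unfolding converges_def
    by (intro in_distributionD[OF prob _ _ _ weak_evaluation_continuous[OF test_function_map]]) auto
  \<comment> \<open>The Boolean component selects the first or second margin, so that one finite
    index set covers both.\<close>
  define A where "A i n = {\<omega> \<in> space (M n).
     \<bar>(\<integral>x. test_function (snd i) x \<partial>(if fst i then Pn n \<omega> else Qn n \<omega>)) -
      (\<integral>x. test_function (snd i) x \<partial>(if fst i then P else Q))\<bar> < 1 / real (Suc k)}" for i :: "bool \<times> nat" and n
  have eq: "{\<omega> \<in> space (M n). close_margins k (Pn n \<omega>) (Qn n \<omega>)} =
      {\<omega> \<in> space (M n). \<forall>i\<in>UNIV \<times> {..k}. \<omega> \<in> A i n}" for n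
    unfolding close_margins_def A_def by (auto simp: UNIV_bool)
  have A: "A i n \<in> sets (M n)" "(\<lambda>n. measure (M n) (A i n)) \<longlonglongrightarrow> 1" for i n
  proof -
    show "A i n \<in> sets (M n)"
      using P_converges Q_converges unfolding A_def converges_def
      by (cases "fst i") (auto intro: measurable_margin_event)
    show "(\<lambda>n. measure (M n) (A i n)) \<longlonglongrightarrow> 1"
      using conv[OF P_converges] conv[OF Q_converges] unfolding A_def by (cases "fst i") simp_all
  qed
  show "(\<lambda>n. measure (M n) {\<omega> \<in> space (M n). close_margins k (Pn n \<omega>) (Qn n \<omega>)}) \<longlonglongrightarrow> 1"
    "\<And>n. {\<omega> \<in> space (M n). close_margins k (Pn n \<omega>) (Qn n \<omega>)} \<in> sets (M n)"
    unfolding eq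
    using tendsto_measure_INT_1[where A = A and I = "UNIV \<times> {..k}" and M = M, OF prob _ A] by simp_all
qed

text \<open>In distribution, a property holding eventually along every deterministic sequence already
  holds on some event \<open>close_margins k\<close>: otherwise counterexamples for all \<open>k\<close> form a sequence
  whose margins converge.\<close>

lemma transfer_eventually:
  assumes det: "\<And>P' Q' \<pi>' T'. plan_sequence P Q \<pi> T P' Q' \<pi>' T' \<Longrightarrow> (\<And>n. C (T' n)) \<Longrightarrow>
      \<forall>\<^sub>F n in sequentially. R (\<pi>' n) (T' n)"
    and C: "\<And>n. AE \<omega> in M n. C (Tn n \<omega>)"
    and meas: "\<And>n. {\<omega> \<in> space (M n). R (\<pi>n n \<omega>) (Tn n \<omega>)} \<in> sets (completion (M n))"
  shows "holds_eventually mode M (\<lambda>n \<omega>. R (\<pi>n n \<omega>) (Tn n \<omega>))"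
proof (cases mode)
  case Almost_Surely
  have "AE \<omega> in M 0. C (Tn n \<omega>)" for n
    using C[of n] unfolding common_space[OF Almost_Surely, of n] .
  then have "AE \<omega> in M 0. \<forall>n. C (Tn n \<omega>)"
    by (simp add: AE_all_countable)
  then have "AE \<omega> in M 0. \<forall>\<^sub>F n in sequentially. R (\<pi>n n \<omega>) (Tn n \<omega>)"
    using plan_sequence_AE[OF Almost_Surely] by eventually_elim (rule det, auto)
  then show ?thesis
    by (simp add: holds_eventually_def Almost_Surely)
next
  case In_Distribution
  have "\<exists>k. \<forall>P' Q' \<pi>' T'. admissible P' Q' \<pi>' T' \<longrightarrow> C T' \<longrightarrow> close_margins k P' Q' \<longrightarrow> R \<pi>' T'"
  proof (rule ccontr)
    assume "\<not> ?thesis"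
    \<comment> \<open>Measures, plan and graph are packed into one nested tuple \<open>z\<close>, so
      that a single choice yields the counterexample sequence.\<close>
    then have "\<forall>k. \<exists>z. admissible (fst z) (fst (snd z)) (fst (snd (snd z))) (snd (snd (snd z))) \<and>
        C (snd (snd (snd z))) \<and> close_margins k (fst z) (fst (snd z)) \<and>
        \<not> R (fst (snd (snd z))) (snd (snd (snd z)))"
      by fastforce
    then obtain z where z: "\<forall>k. admissible (fst (z k)) (fst (snd (z k))) (fst (snd (snd (z k)))) (snd (snd (snd (z k)))) \<and>
        C (snd (snd (snd (z k)))) \<and> close_margins k (fst (z k)) (fst (snd (z k))) \<and>
        \<not> R (fst (snd (snd (z k)))) (snd (snd (snd (z k))))"
      by (rule choice[THEN exE])
    have "plan_sequence P Q \<pi> T (\<lambda>k. fst (z k)) (\<lambda>k. fst (snd (z k))) (\<lambda>k. fst (snd (snd (z k)))) (\<lambda>k. snd (snd (snd (z k))))"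
      using z close_margins_tendsto[of "\<lambda>k. fst (z k)" "\<lambda>k. fst (snd (z k))"] by unfold_locales auto
    then have "\<forall>\<^sub>F k in sequentially. R (fst (snd (snd (z k)))) (snd (snd (snd (z k))))"
      by (rule det) (use z in blast)
    then show False
      using z by (auto simp: eventually_sequentially)
  qed
  then obtain k where k: "\<And>P' Q' \<pi>' T'. admissible P' Q' \<pi>' T' \<Longrightarrow> C T' \<Longrightarrow> close_margins k P' Q' \<Longrightarrow> R \<pi>' T'"
    by blast
  \<comment> \<open>The margin event is measurable in \<open>M n\<close>, the event of
    \<open>R\<close> only in its completion; almost surely the first implies the second.\<close>
  have lower: "measure (M n) {\<omega> \<in> space (M n). close_margins k (Pn n \<omega>) (Qn n \<omega>)} \<le>
      measure (completion (M n)) {\<omega> \<in> space (M n). R (\<pi>n n \<omega>) (Tn n \<omega>)}"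
    and upper: "measure (completion (M n)) {\<omega> \<in> space (M n). R (\<pi>n n \<omega>) (Tn n \<omega>)} \<le> 1" for n
  proof -
    interpret prob_space "M n" by (rule prob)
    interpret c: prob_space "completion (M n)"
      by (rule prob_space_completion)
    have "AE \<omega> in M n. close_margins k (Pn n \<omega>) (Qn n \<omega>) \<longrightarrow> R (\<pi>n n \<omega>) (Tn n \<omega>)"
      using AE_admissible[of n] C[of n] by eventually_elim (use k in blast)
    then have "AE \<omega> in completion (M n). close_margins k (Pn n \<omega>) (Qn n \<omega>) \<longrightarrow> R (\<pi>n n \<omega>) (Tn n \<omega>)"
      by (rule AE_completion)
    then have "c.prob {\<omega> \<in> space (M n). close_margins k (Pn n \<omega>) (Qn n \<omega>)} \<le>
        c.prob {\<omega> \<in> space (M n). R (\<pi>n n \<omega>) (Tn n \<omega>)}"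
      by (intro c.finite_measure_mono_AE meas) (auto elim!: eventually_mono)
    then show "measure (M n) {\<omega> \<in> space (M n). close_margins k (Pn n \<omega>) (Qn n \<omega>)} \<le>
        measure (completion (M n)) {\<omega> \<in> space (M n). R (\<pi>n n \<omega>) (Tn n \<omega>)}"
      using close_margins_in_distribution(2)[OF In_Distribution] by simp
    show "measure (completion (M n)) {\<omega> \<in> space (M n). R (\<pi>n n \<omega>) (Tn n \<omega>)} \<le> 1"
      by (rule c.prob_le_1)
  qed
  have "(\<lambda>n. measure (completion (M n)) {\<omega> \<in> space (M n). R (\<pi>n n \<omega>) (Tn n \<omega>)}) \<longlonglongrightarrow> 1"
    by (rule tendsto_sandwich[OF _ _ close_margins_in_distribution(1)[OF In_Distribution, of k] tendsto_const])
      (use lower upper in auto)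
  then show ?thesis
    by (simp add: holds_eventually_def In_Distribution)
qed

text \<open>In distribution, convergence to a constant amounts to the probability of each open
  neighbourhood tending to 1, and such an event is an eventual property of the deterministic
  kind.\<close>

lemma transfer_converges:
  assumes det: "\<And>P' Q' \<pi>' T'. plan_sequence P Q \<pi> T P' Q' \<pi>' T' \<Longrightarrow> (\<And>n. C (T' n)) \<Longrightarrow>
      limitin X (\<lambda>n. Y (\<pi>' n) (T' n)) L sequentially"
    and C: "\<And>n. AE \<omega> in M n. C (Tn n \<omega>)"
    and meas: "\<And>n. (\<lambda>\<omega>. Y (\<pi>n n \<omega>) (Tn n \<omega>)) \<in> M n \<rightarrow>\<^sub>M borel_of X" and L: "L \<in> topspace X"
  shows "converges mode M X (\<lambda>n \<omega>. Y (\<pi>n n \<omega>) (Tn n \<omega>)) L"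
proof (cases mode)
  case Almost_Surely
  have "AE \<omega> in M 0. C (Tn n \<omega>)" for n
    using C[of n] unfolding common_space[OF Almost_Surely, of n] .
  then have "AE \<omega> in M 0. \<forall>n. C (Tn n \<omega>)"
    by (simp add: AE_all_countable)
  then have "AE \<omega> in M 0. limitin X (\<lambda>n. Y (\<pi>n n \<omega>) (Tn n \<omega>)) L sequentially"
    using plan_sequence_AE[OF Almost_Surely] by eventually_elim (rule det, auto)
  then show ?thesis
    using meas L by (simp add: converges_def Almost_Surely)
next
  case In_Distribution
  have "(\<lambda>n. measure (M n) {\<omega> \<in> space (M n). Y (\<pi>n n \<omega>) (Tn n \<omega>) \<in> U}) \<longlonglongrightarrow> 1"
    if U: "openin X U" "L \<in> U" for U
  proof -
    have event: "{\<omega> \<in> space (M n). Y (\<pi>n n \<omega>) (Tn n \<omega>) \<in> U} \<in> sets (M n)" for n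
      using measurable_sets[OF meas openin_in_sets_borel_of[OF U(1)], of n] by (simp add: vimage_def Int_def conj_commute)
    have "holds_eventually mode M (\<lambda>n \<omega>. Y (\<pi>n n \<omega>) (Tn n \<omega>) \<in> U)"
    proof (rule transfer_eventually[where C = C and R = "\<lambda>p t. Y p t \<in> U", OF _ C])
      show "\<forall>\<^sub>F n in sequentially. Y (\<pi>' n) (T' n) \<in> U"
        if "plan_sequence P Q \<pi> T P' Q' \<pi>' T'" "\<And>n. C (T' n)" for P' Q' \<pi>' T'
        using det[OF that] U by (simp add: limitin_def)
    qed (use event in auto)
    then show ?thesis
      using event by (simp add: holds_eventually_def In_Distribution)
  qed
  then show ?thesis
    using in_distributionI[OF prob meas L] meas L by (simp add: converges_def In_Distribution)
qed

section \<open>Measurability\<close>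

lemma closed_graph: "\<omega> \<in> space (M n) \<Longrightarrow> closed (Tn n \<omega>)"
  using measurable_space[OF measurable_graph] by (simp add: topspace_fell_topology)

lemma hit_open_measurable:
  assumes "open G"
  shows "{\<omega> \<in> space (M n). Tn n \<omega> \<inter> G \<noteq> {}} \<in> sets (M n)"
proof -
  have "openin (fell_topology euclidean) {F. closedin euclidean F \<and> F \<inter> G \<noteq> {}}"
    unfolding fell_topology_def using assms by (intro topology_generated_by_Basis) auto
  from measurable_sets[OF measurable_graph openin_in_sets_borel_of[OF this], of n]
  have "Tn n -` {F. closedin euclidean F \<and> F \<inter> G \<noteq> {}} \<inter> space (M n) \<in> sets (M n)" .
  moreover have "Tn n -` {F. closedin euclidean F \<and> F \<inter> G \<noteq> {}} \<inter> space (M n) =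
      {\<omega> \<in> space (M n). Tn n \<omega> \<inter> G \<noteq> {}}"
    using closed_graph by auto
  ultimately show ?thesis
    by simp
qed

lemma hit_compact_measurable:
  assumes "compact K"
  shows "{\<omega> \<in> space (M n). Tn n \<omega> \<inter> K \<noteq> {}} \<in> sets (M n)" "{\<omega> \<in> space (M n). Tn n \<omega> \<inter> K = {}} \<in> sets (M n)"
proof -
  have "openin (fell_topology euclidean) {F. closedin euclidean F \<and> F \<inter> K = {}}"
    unfolding fell_topology_def using assms by (intro topology_generated_by_Basis) auto
  from measurable_sets[OF measurable_graph openin_in_sets_borel_of[OF this], of n]
  have "Tn n -` {F. closedin euclidean F \<and> F \<inter> K = {}} \<inter> space (M n) \<in> sets (M n)" .
  moreover have "Tn n -` {F. closedin euclidean F \<and> F \<inter> K = {}} \<inter> space (M n) =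
      {\<omega> \<in> space (M n). Tn n \<omega> \<inter> K = {}}"
    using closed_graph by auto
  ultimately show *: "{\<omega> \<in> space (M n). Tn n \<omega> \<inter> K = {}} \<in> sets (M n)"
    by simp
  have "{\<omega> \<in> space (M n). Tn n \<omega> \<inter> K \<noteq> {}} = space (M n) - {\<omega> \<in> space (M n). Tn n \<omega> \<inter> K = {}}"
    by auto
  then show "{\<omega> \<in> space (M n). Tn n \<omega> \<inter> K \<noteq> {}} \<in> sets (M n)"
    using * by simp
qed

lemma hit_union_measurable:
  assumes "\<And>(i :: nat) (j :: nat). compact (K i j)" and eq: "\<And>\<omega>. \<omega> \<in> space (M n) \<Longrightarrow> R \<omega> \<longleftrightarrow> (\<exists>i j. Tn n \<omega> \<inter> K i j \<noteq> {})"
  shows "{\<omega> \<in> space (M n). R \<omega>} \<in> sets (M n)"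
proof -
  have "{\<omega> \<in> space (M n). R \<omega>} = (\<Union>i. \<Union>j. {\<omega> \<in> space (M n). Tn n \<omega> \<inter> K i j \<noteq> {}})"
    using eq by auto
  also have "\<dots> \<in> sets (M n)"
    by (intro sets.countable_UN'' hit_compact_measurable(1) assms(1) countableI_type)
  finally show ?thesis .
qed

lemma in_Domain_measurable: "{\<omega> \<in> space (M n). x \<in> Domain (Tn n \<omega>)} \<in> sets (M n)"
proof (rule hit_union_measurable[of "\<lambda>i j. {x} \<times> cball 0 (real i)"])
  show "x \<in> Domain (Tn n \<omega>) \<longleftrightarrow> (\<exists>i j. Tn n \<omega> \<inter> {x} \<times> cball 0 (real i) \<noteq> {})" for \<omega>
  proof
    assume "x \<in> Domain (Tn n \<omega>)"
    then obtain y where "(x, y) \<in> Tn n \<omega>" by blast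
    moreover obtain i where "norm y \<le> real i" using real_arch_simple by blast
    ultimately have "(x, y) \<in> Tn n \<omega> \<inter> {x} \<times> cball 0 (real i)" by simp
    then show "\<exists>i j. Tn n \<omega> \<inter> {x} \<times> cball 0 (real i) \<noteq> {}" by blast
  qed auto
qed (intro compact_Times; simp)

text \<open>The supremum exceeds \<open>c\<close> exactly when the graph hits one of countably many
  compact sets: the strict inequality is exhausted by margins \<open>1 / real (Suc m)\<close>, the
  values by balls of radius \<open>m\<close>.\<close>

lemma sup_deviation_measurable:
  fixes E :: "nat \<Rightarrow> 'a set"
  assumes T: "closed T" and E: "\<And>k. compact (E k)" "\<And>k. bounded (T `` E k)"
    and sv: "\<And>k x. x \<in> E k \<Longrightarrow> single_valued_at T x"
  shows "(\<lambda>\<omega>. sup_deviation (Tn n \<omega>) T (\<Union>k. E k)) \<in> borel_measurable (M n)"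
proof (rule borel_measurableI_greater)
  fix c :: ennreal
  show "{\<omega> \<in> space (M n). c < sup_deviation (Tn n \<omega>) T (\<Union>k. E k)} \<in> sets (M n)"
  proof (cases c)
    case (real r)
    let ?K = "\<lambda>k m. {(x, y). x \<in> E k \<and> norm y \<le> real m \<and> r + 1 / real (Suc m) \<le> norm (y - val T x)}"
    have "c < sup_deviation (Tn n \<omega>) T (\<Union>k. E k) \<longleftrightarrow> (\<exists>k m. Tn n \<omega> \<inter> ?K k m \<noteq> {})" for \<omega>
    proof -
      have "c < sup_deviation (Tn n \<omega>) T (\<Union>k. E k) \<longleftrightarrow>
          (\<exists>k x y. x \<in> E k \<and> (x, y) \<in> Tn n \<omega> \<and> r < norm (y - val T x))"
        unfolding sup_deviation_def less_SUP_iff using real by (auto simp: ennreal_less_iff)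
      also have "\<dots> \<longleftrightarrow> (\<exists>k m. Tn n \<omega> \<inter> ?K k m \<noteq> {})"
      proof
        assume "\<exists>k x y. x \<in> E k \<and> (x, y) \<in> Tn n \<omega> \<and> r < norm (y - val T x)"
        then obtain k x y where xy: "x \<in> E k" "(x, y) \<in> Tn n \<omega>" "r < norm (y - val T x)" by blast
        obtain i where i: "norm y \<le> real i" using real_arch_simple by blast
        obtain j where j: "inverse (real (Suc j)) < norm (y - val T x) - r"
          using reals_Archimedean[of "norm (y - val T x) - r"] xy(3) by auto
        have "1 / real (Suc (max i j)) \<le> inverse (real (Suc j))"
          by (simp add: inverse_eq_divide frac_le)
        then have "(x, y) \<in> Tn n \<omega> \<inter> ?K k (max i j)"
          using xy i j by auto
        then show "\<exists>k m. Tn n \<omega> \<inter> ?K k m \<noteq> {}" by blast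
      next
        assume "\<exists>k m. Tn n \<omega> \<inter> ?K k m \<noteq> {}"
        then obtain k m x y where "(x, y) \<in> Tn n \<omega>" "x \<in> E k" "r + 1 / real (Suc m) \<le> norm (y - val T x)"
          by auto
        moreover have "r < r + 1 / real (Suc m)" by simp
        ultimately show "\<exists>k x y. x \<in> E k \<and> (x, y) \<in> Tn n \<omega> \<and> r < norm (y - val T x)"
          by (meson order.strict_trans2)
      qed
      finally show ?thesis .
    qed
    then show ?thesis
      by (intro hit_union_measurable[of ?K] compact_deviation T E sv)
  qed simp
qed

text \<open>\<open>K \<times> U\<close> is in general neither open nor compact, but it is a
  countable union of compact sets.\<close>

lemma hit_open_strip_measurable:
  assumes K: "compact K" and U: "open U"
  shows "{\<omega> \<in> space (M n). Tn n \<omega> \<inter> K \<times> U \<noteq> {}} \<in> sets (M n)"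
proof -
  obtain C :: "nat \<Rightarrow> 'a set" where C: "\<And>i. compact (C i)" "\<And>i. C i \<subseteq> U" "\<Union>(range C) = U"
    using open_Union_compact_subsets[OF U] by metis
  show ?thesis
  proof (rule hit_union_measurable[of "\<lambda>i j. K \<times> C i"])
    show "Tn n \<omega> \<inter> K \<times> U \<noteq> {} \<longleftrightarrow> (\<exists>i (j :: nat). Tn n \<omega> \<inter> K \<times> C i \<noteq> {})" for \<omega>
      unfolding C(3)[symmetric] by auto
  qed (intro compact_Times K C(1))
qed

lemma dist_to_triangle: "dist_to x A \<le> ennreal (dist x y) + dist_to y A"
proof (rule ennreal_le_epsilon)
  fix e :: real assume e: "e > 0" and fin: "ennreal (dist x y) + dist_to y A < top"
  then obtain r where r: "dist_to y A = ennreal r" "0 \<le> r"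
    by (cases "dist_to y A") auto
  then have "dist_to y A < ennreal (r + e)"
    using e by (simp add: ennreal_less_iff)
  then obtain a where a: "a \<in> A" "ennreal (dist y a) < ennreal (r + e)"
    unfolding dist_to_def INF_less_iff by blast
  have "dist_to x A \<le> ennreal (dist x a)"
    unfolding dist_to_def by (rule INF_lower[OF a(1)])
  also have "\<dots> \<le> ennreal (dist x y + (r + e))"
    using a(2) dist_triangle[of x a y] by (intro ennreal_leI) (simp add: ennreal_less_iff)
  also have "\<dots> = ennreal (dist x y) + dist_to y A + ennreal e"
    using r e by (simp add: add.assoc)
  finally show "dist_to x A \<le> ennreal (dist x y) + dist_to y A + ennreal e" .
qed

lemma open_dist_to_greater: "open {y :: 'a. c < dist_to y B}"
proof (cases "B = {}")
  case True
  then show ?thesis by (simp add: dist_to_def)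
next
  case False
  have "dist_to y B = ennreal (infdist y B)" for y
  proof (rule antisym)
    show "dist_to y B \<le> ennreal (infdist y B)"
    proof (rule ennreal_le_epsilon)
      fix e :: real assume "e > 0"
      then have "infdist y B < infdist y B + e" by simp
      then obtain b where b: "b \<in> B" "dist y b < infdist y B + e"
        unfolding infdist_notempty[OF False] using cINF_less_iff[OF False bdd_below_image_dist] by blast
      have "dist_to y B \<le> ennreal (dist y b)"
        unfolding dist_to_def by (rule INF_lower[OF b(1)])
      also have "\<dots> \<le> ennreal (infdist y B + e)"
        using b(2) by (intro ennreal_leI) simp
      also have "\<dots> = ennreal (infdist y B) + ennreal e"
        using \<open>e > 0\<close> by (simp add: infdist_nonneg)
      finally show "dist_to y B \<le> ennreal (infdist y B) + ennreal e" .
    qed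
    show "ennreal (infdist y B) \<le> dist_to y B"
      unfolding dist_to_def by (intro INF_greatest ennreal_leI infdist_le)
  qed
  then show ?thesis
    by (simp add: open_Collect_less continuous_on_ennreal continuous_intros)
qed

text \<open>The first supremum exceeds \<open>c\<close> when an open strip over \<open>K\<close> is
  hit. In the second, the distance is Lipschitz in \<open>b\<close>, so \<open>b\<close> may be
  restricted to a countable dense subset of \<open>B\<close>, and each single distance is again
  described by hits of a strip.\<close>

lemma hausdorff_measurable:
  assumes K: "compact K"
  shows "(\<lambda>\<omega>. hausdorff_dist (Tn n \<omega> `` K) B) \<in> borel_measurable (M n)"
proof -
  have m1: "(\<lambda>\<omega>. \<Squnion>a\<in>Tn n \<omega> `` K. dist_to a B) \<in> borel_measurable (M n)"
  proof (rule borel_measurableI_greater)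
    fix c
    have "c < (\<Squnion>a\<in>Tn n \<omega> `` K. dist_to a B) \<longleftrightarrow> Tn n \<omega> \<inter> K \<times> {y. c < dist_to y B} \<noteq> {}" for \<omega>
      unfolding less_SUP_iff by auto
    then show "{\<omega> \<in> space (M n). c < (\<Squnion>a\<in>Tn n \<omega> `` K. dist_to a B)} \<in> sets (M n)"
      using hit_open_strip_measurable[OF K open_dist_to_greater, of n c B] by simp
  qed
  have m2: "(\<lambda>\<omega>. \<Squnion>b\<in>B. dist_to b (Tn n \<omega> `` K)) \<in> borel_measurable (M n)"
  proof -
    obtain D where D: "countable D" "D \<subseteq> B" "B \<subseteq> closure D"
      by (rule separable)
    have "dist_to b (Tn n \<omega> `` K) \<le> (\<Squnion>b\<in>D. dist_to b (Tn n \<omega> `` K))" if b: "b \<in> B" for b \<omega>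
    proof (rule ennreal_le_epsilon)
      fix e :: real assume "e > 0"
      then obtain d where d: "d \<in> D" "dist d b < e"
        using D(3) b closure_approachable by blast
      have "dist_to b (Tn n \<omega> `` K) \<le> ennreal (dist b d) + dist_to d (Tn n \<omega> `` K)"
        by (rule dist_to_triangle)
      also have "\<dots> \<le> ennreal e + (\<Squnion>b\<in>D. dist_to b (Tn n \<omega> `` K))"
        using d by (intro add_mono ennreal_leI SUP_upper) (simp_all add: dist_commute)
      finally show "dist_to b (Tn n \<omega> `` K) \<le> (\<Squnion>b\<in>D. dist_to b (Tn n \<omega> `` K)) + ennreal e"
        by (simp add: add.commute)
    qed
    then have eq: "(\<Squnion>b\<in>B. dist_to b (Tn n \<omega> `` K)) = (\<Squnion>b\<in>D. dist_to b (Tn n \<omega> `` K))" for \<omega>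
      using D(2) by (intro antisym SUP_least SUP_subset_mono) auto
    have "(\<lambda>\<omega>. dist_to b (Tn n \<omega> `` K)) \<in> borel_measurable (M n)" for b
    proof (rule borel_measurableI_less)
      fix c
      have "dist_to b (Tn n \<omega> `` K) < c \<longleftrightarrow> Tn n \<omega> \<inter> K \<times> {y. ennreal (dist b y) < c} \<noteq> {}" for \<omega>
        unfolding dist_to_def INF_less_iff by auto
      moreover have "open {y. ennreal (dist b y) < c}"
        by (intro open_Collect_less continuous_on_ennreal continuous_intros)
      ultimately show "{\<omega> \<in> space (M n). dist_to b (Tn n \<omega> `` K) < c} \<in> sets (M n)"
        using hit_open_strip_measurable[OF K, of "{y. ennreal (dist b y) < c}" n] by simp
    qed
    then show ?thesis
      unfolding eq using D(1) by (intro borel_measurable_SUP) auto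
  qed
  show ?thesis
    unfolding hausdorff_dist_def by (intro borel_measurable_max m1 m2)
qed

end

section \<open>Events about domains\<close>

text \<open>A fixed countable reservoir of points: statements about the domain of a Minty set reduce
  to countably many events that a given point belongs to it.\<close>

definition dense_points :: "'a::euclidean_space set" where
  "dense_points = (SOME D. countable D \<and> closure D = UNIV)"

lemma dense_points: "countable (dense_points :: 'a::euclidean_space set)" "closure (dense_points :: 'a set) = UNIV"
proof -
  obtain D :: "'a set" where "countable D" "D \<subseteq> UNIV" "UNIV \<subseteq> closure D"
    by (rule separable)
  then have "\<exists>D :: 'a set. countable D \<and> closure D = UNIV" by auto
  from someI_ex[OF this] show "countable (dense_points :: 'a set)" "closure (dense_points :: 'a set) = UNIV"
    unfolding dense_points_def by auto
qed

lemma minty_Domain_UNIV_iff: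
  fixes T :: "('a::euclidean_space \<times> 'a) set"
  assumes T: "minty T"
  shows "Domain T = UNIV \<longleftrightarrow> (\<forall>x\<in>dense_points. x \<in> Domain T)"
proof
  assume dom: "\<forall>x\<in>dense_points. x \<in> Domain T"
  have "x \<in> Domain T" for x
  proof -
    obtain A \<rho> where "finite A" "A \<subseteq> dense_points \<inter> UNIV" "\<rho> > 0" "surrounds \<rho> x A"
      by (rule surrounds_dense[of UNIV x dense_points]) (simp_all add: dense_points(2))
    then show ?thesis
      using dom by (intro minty_surrounds_in_Domain[OF T, of \<rho> x A]) auto
  qed
  then show "Domain T = UNIV" by blast
qed simp

text \<open>The right-hand side ranges over a countable family of finite sets, which makes the event
  measurable. Compactness of \<open>K\<close> provides one \<open>A\<close> and one
  \<open>\<rho>\<close> for all its points; conversely, such a surrounding set gives the interior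
  and the bound that makes the image compact.\<close>

lemma minty_interior_Domain_iff:
  fixes T :: "('a::euclidean_space \<times> 'a) set"
  assumes T: "minty T" and K: "compact K"
  shows "K \<subseteq> interior (Domain T) \<and> compact (T `` K) \<longleftrightarrow>
    (\<exists>A\<in>{A. finite A \<and> A \<subseteq> dense_points \<and> (\<exists>\<rho>>0. \<forall>x\<in>K. surrounds \<rho> x A)}. \<forall>a\<in>A. a \<in> Domain T)"
    (is "?L \<longleftrightarrow> ?R")
proof
  assume ?L
  then have KI: "K \<subseteq> interior (Domain T)" by simp
  have "\<forall>x\<in>K. \<exists>d. finite (fst d) \<and> fst d \<subseteq> dense_points \<inter> interior (Domain T) \<and> snd d > 0 \<and>
      surrounds (snd d) x (fst d)"
  proof
    fix x assume "x \<in> K"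
    then have x: "x \<in> interior (Domain T)" using KI by blast
    obtain A \<rho> where "finite A" "A \<subseteq> dense_points \<inter> interior (Domain T)" "\<rho> > 0" "surrounds \<rho> x A"
      by (rule surrounds_dense[OF open_interior x, of dense_points]) (simp_all add: dense_points(2))
    then show "\<exists>d. finite (fst d) \<and> fst d \<subseteq> dense_points \<inter> interior (Domain T) \<and> snd d > 0 \<and>
        surrounds (snd d) x (fst d)"
      by (intro exI[of _ "(A, \<rho>)"]) simp
  qed
  then obtain d where d: "\<forall>x\<in>K. finite (fst (d x)) \<and> fst (d x) \<subseteq> dense_points \<inter> interior (Domain T) \<and>
      snd (d x) > 0 \<and> surrounds (snd (d x)) x (fst (d x))"
    by (rule bchoice[THEN exE])
  obtain C where C: "C \<subseteq> K" "finite C" "K \<subseteq> (\<Union>x\<in>C. ball x (snd (d x) / 2))"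
    by (rule compactE_image[OF K, of K "\<lambda>x. ball x (snd (d x) / 2)"]) (use d in auto)
  define A where "A = (\<Union>x\<in>C. fst (d x))"
  \<comment> \<open>Every point of \<open>K\<close> is within half the radius of some centre in
    \<open>C\<close>, so the other half remains; the element 1 keeps \<open>Min\<close> meaningful
    for empty \<open>C\<close>.\<close>
  define \<rho> where "\<rho> = Min (insert 1 ((\<lambda>x. snd (d x) / 2) ` C))"
  have "\<rho> > 0"
    using C d by (auto simp: \<rho>_def)
  moreover have "\<rho> \<le> snd (d x) / 2" if "x \<in> C" for x
    unfolding \<rho>_def using C(2) that by (intro Min_le) auto
  ultimately have \<rho>: "\<rho> > 0" "\<And>x. x \<in> C \<Longrightarrow> \<rho> \<le> snd (d x) / 2"
    by auto
  have "surrounds \<rho> x' A" if x': "x' \<in> K" for x'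
  proof -
    obtain x where x: "x \<in> C" "dist x x' < snd (d x) / 2" using C(3) x' by auto
    have "surrounds (snd (d x) - snd (d x) / 2 - 0) x' (fst (d x))"
      using x d C(1) by (intro surrounds_perturb[of _ x "fst (d x)"]) auto
    then have "surrounds (snd (d x) / 2) x' A"
      using x(1) by (auto simp: A_def intro: surrounds_mono)
    then show ?thesis
      using \<rho>(2)[OF x(1)] unfolding surrounds_def by (meson order_trans)
  qed
  moreover have "finite A" "A \<subseteq> dense_points" "\<forall>a\<in>A. a \<in> Domain T"
    using C d interior_subset[of "Domain T"] unfolding A_def by blast+
  ultimately show ?R
    using \<rho>(1) by blast
next
  assume ?R
  then obtain A \<rho> where A: "finite A" "\<rho> > 0" "\<And>x. x \<in> K \<Longrightarrow> surrounds \<rho> x A" "A \<subseteq> Domain T"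
    by blast
  have "K \<subseteq> interior (Domain T)"
    using minty_surrounds_in_interior_Domain[OF T A(3,2,1,4)] by blast
  moreover have "bounded (T `` K)"
  proof -
    have "\<forall>a\<in>A. \<exists>b. (a, b) \<in> T" using A(4) by blast
    then obtain g where g: "\<And>a. a \<in> A \<Longrightarrow> (a, g a) \<in> T"
      by metis
    obtain \<alpha> where \<alpha>: "\<alpha> > 0" "\<And>a. a \<in> A \<Longrightarrow> norm a \<le> \<alpha>"
      using finite_norm_bound[OF A(1), of "\<lambda>a. a"] by blast
    obtain \<beta> where \<beta>: "\<beta> > 0" "\<And>a. a \<in> A \<Longrightarrow> norm (g a) \<le> \<beta>"
      using finite_norm_bound[OF A(1), of g] by blast
    obtain \<gamma> where \<gamma>: "\<gamma> > 0" "\<And>x. x \<in> K \<Longrightarrow> norm x \<le> \<gamma>"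
      using compact_imp_bounded[OF K] by (auto simp: bounded_pos)
    have "norm y \<le> (\<alpha> + \<gamma>) * \<beta> / \<rho>" if xy: "x \<in> K" "(x, y) \<in> T" for x y
    proof (rule monotone_bound[OF minty_monotone[OF T] A(3)[OF xy(1)] _ xy(2)])
      fix a assume a: "a \<in> A"
      have "norm (a - x) \<le> \<alpha> + \<gamma>"
        using norm_triangle_ineq4[of a x] \<alpha>(2)[OF a] \<gamma>(2)[OF xy(1)] by linarith
      then show "\<exists>b. (a, b) \<in> T \<and> norm (a - x) \<le> \<alpha> + \<gamma> \<and> norm b \<le> \<beta>"
        using g[OF a] \<beta>(2)[OF a] by blast
    qed (use \<alpha> \<beta> \<gamma> A in auto)
    then show ?thesis by (auto simp: bounded_iff)
  qed
  ultimately show ?L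
    using compact_Image[OF minty_closed[OF T] K] by blast
qed

context random_plans
begin

lemma AE_minty: "AE \<omega> in M n. minty (Tn n \<omega>)"
  using AE_admissible[of n] by eventually_elim (rule admissibleD(7))

lemma interior_Domain_measurable:
  assumes "compact K"
  shows "{\<omega> \<in> space (M n). K \<subseteq> interior (Domain (Tn n \<omega>)) \<and> compact (Tn n \<omega> `` K)} \<in> sets (completion (M n))"
proof (rule sets_completion_AE_iff)
  let ?A = "{A. finite A \<and> A \<subseteq> dense_points \<and> (\<exists>\<rho>>0. \<forall>x\<in>K. surrounds \<rho> x A)}"
  show "AE \<omega> in M n. K \<subseteq> interior (Domain (Tn n \<omega>)) \<and> compact (Tn n \<omega> `` K) \<longleftrightarrow>
      (\<exists>A\<in>?A. \<forall>a\<in>A. a \<in> Domain (Tn n \<omega>))"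
    using AE_minty[of n] by eventually_elim (rule minty_interior_Domain_iff[OF _ assms])
  have "countable {A. finite A \<and> A \<subseteq> (dense_points :: 'a set)}"
    by (rule countable_Collect_finite_subset[OF dense_points(1)])
  then have "countable ?A"
    by (rule countable_subset[rotated]) auto
  moreover have "{\<omega> \<in> space (M n). \<forall>a\<in>A. a \<in> Domain (Tn n \<omega>)} \<in> sets (M n)" if "A \<in> ?A" for A
    using that by (intro sets.sets_Collect_finite_All in_Domain_measurable) auto
  ultimately have "(\<Union>A\<in>?A. {\<omega> \<in> space (M n). \<forall>a\<in>A. a \<in> Domain (Tn n \<omega>)}) \<in> sets (M n)"
    by (rule sets.countable_UN'')
  moreover have "(\<Union>A\<in>?A. {\<omega> \<in> space (M n). \<forall>a\<in>A. a \<in> Domain (Tn n \<omega>)}) =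
      {\<omega> \<in> space (M n). \<exists>A\<in>?A. \<forall>a\<in>A. a \<in> Domain (Tn n \<omega>)}"
    by blast
  ultimately show "{\<omega> \<in> space (M n). \<exists>A\<in>?A. \<forall>a\<in>A. a \<in> Domain (Tn n \<omega>)} \<in> sets (M n)"
    by simp
qed

lemma Domain_UNIV_measurable: "{\<omega> \<in> space (M n). Domain (Tn n \<omega>) = UNIV} \<in> sets (completion (M n))"
proof (rule sets_completion_AE_iff)
  show "AE \<omega> in M n. Domain (Tn n \<omega>) = UNIV \<longleftrightarrow> (\<forall>x\<in>dense_points. x \<in> Domain (Tn n \<omega>))"
    using AE_minty[of n] by eventually_elim (rule minty_Domain_UNIV_iff)
  have "{\<omega> \<in> space (M n). \<forall>x\<in>dense_points. x \<in> Domain (Tn n \<omega>)} =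
      space (M n) - (\<Union>x\<in>dense_points. space (M n) - {\<omega> \<in> space (M n). x \<in> Domain (Tn n \<omega>)})"
    by blast
  also have "\<dots> \<in> sets (M n)"
    by (intro sets.compl_sets sets.countable_UN'' in_Domain_measurable dense_points(1))
  finally show "{\<omega> \<in> space (M n). \<forall>x\<in>dense_points. x \<in> Domain (Tn n \<omega>)} \<in> sets (M n)" .
qed

end

section \<open>The theorem\<close>

context plan_sequence
begin

lemma fell_convergence_on_V:
  "limitin (fell_topology (top_of_set (V \<times> UNIV))) (\<lambda>n. Tn n \<inter> V \<times> UNIV) (T \<inter> V \<times> UNIV) sequentially"
proof -
  interpret graph_convergence Tn T V by (rule graph_convergence_on_V)
  let ?X = "top_of_set (V \<times> (UNIV :: 'a set))"
  have closed: "closedin ?X (T \<inter> V \<times> UNIV)" "closedin ?X (Tn n \<inter> V \<times> UNIV)" for n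
    using minty_closed[OF minty_lim] minty_closed[OF minty_seq[of n]]
    by (auto simp: closedin_closed Int_commute)
  show ?thesis
    unfolding fell_topology_def
  proof (rule limitin_generatedI)
    show "T \<inter> V \<times> UNIV \<in> \<Union>({{F. closedin ?X F \<and> F \<inter> G \<noteq> {}} | G. openin ?X G} \<union>
        {{F. closedin ?X F \<and> F \<inter> K = {}} | K. compactin ?X K})"
      using closed(1) topspace_fell_topology[of ?X]
      unfolding fell_topology_def topology_generated_by_topspace by blast
  next
    fix B assume "B \<in> {{F. closedin ?X F \<and> F \<inter> G \<noteq> {}} | G. openin ?X G} \<union>
        {{F. closedin ?X F \<and> F \<inter> K = {}} | K. compactin ?X K}" and T: "T \<inter> V \<times> UNIV \<in> B"
    then consider G where "openin ?X G" "B = {F. closedin ?X F \<and> F \<inter> G \<noteq> {}}"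
      | K where "compactin ?X K" "B = {F. closedin ?X F \<and> F \<inter> K = {}}" by auto
    then show "\<forall>\<^sub>F n in sequentially. Tn n \<inter> V \<times> UNIV \<in> B"
    proof cases
      case 1
      have G: "open G" "G \<subseteq> V \<times> UNIV"
        using 1(1) open_V by (auto simp: openin_open_eq open_Times)
      have "T \<inter> G \<noteq> {}" using T 1(2) by blast
      then have "\<forall>\<^sub>F n in sequentially. Tn n \<inter> G \<noteq> {}" by (rule hit[OF G])
      then show ?thesis
        by eventually_elim (use G(2) closed(2) 1(2) in blast)
    next
      case 2
      have K: "compact K" "K \<subseteq> V \<times> UNIV"
        using 2(1) by (auto simp: compactin_subtopology)
      have "T \<inter> K = {}" using T 2(2) K(2) by blast
      then have "\<forall>\<^sub>F n in sequentially. Tn n \<inter> K = {}" by (rule miss[OF K])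
      then show ?thesis
        by eventually_elim (use closed(2) 2(2) in blast)
    qed
  qed
qed

end

section \<open>Fell convergence and restriction to open sets\<close>

lemma kuratowski_limit_fell:
  fixes A :: "nat \<Rightarrow> 'b::topological_space set"
  assumes lim: "kuratowski_limit A L" and closed: "\<And>n. closed (A n)" "closed L"
  shows "limitin (fell_topology euclidean) A L sequentially"
  unfolding fell_topology_def
proof (rule limitin_generatedI)
  show "L \<in> \<Union>({{F. closedin euclidean F \<and> F \<inter> G \<noteq> {}} | G. openin euclidean G} \<union>
      {{F. closedin euclidean F \<and> F \<inter> K = {}} | K. compactin euclidean K})"
    using closed(2) topspace_fell_topology[of "euclidean :: 'b topology"]
    unfolding fell_topology_def topology_generated_by_topspace by auto
next
  fix B assume "B \<in> {{F. closedin euclidean F \<and> F \<inter> G \<noteq> {}} | G. openin euclidean G} \<union>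
      {{F. closedin euclidean F \<and> F \<inter> K = {}} | K. compactin euclidean K}" and L: "L \<in> B"
  then consider G where "open G" "B = {F. closedin euclidean F \<and> F \<inter> G \<noteq> {}}"
    | K where "compact K" "B = {F. closedin euclidean F \<and> F \<inter> K = {}}" by auto
  then show "\<forall>\<^sub>F n in sequentially. A n \<in> B"
  proof cases
    case 1
    then show ?thesis
      using kuratowski_limit_hit[OF lim 1(1)] L closed(1) by auto
  next
    case 2
    then show ?thesis
      using kuratowski_limit_miss[OF lim 2(1)] L closed(1) by auto
  qed
qed

text \<open>Relatively open subsets of an open set are open and its compact subsets are compact, so
  preimages of subbasic sets are subbasic. This makes the restricted graphs random elements.\<close>

lemma fell_restriction_continuous:
  assumes "open U"
  shows "continuous_map (fell_topology euclidean) (fell_topology (top_of_set U)) (\<lambda>F. F \<inter> U)"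
  unfolding fell_topology_def[of "top_of_set U"]
proof (rule continuous_on_generated_topo)
  have cl: "closedin (top_of_set U) (F \<inter> U)" if "closed F" for F
    using that by (auto simp: closedin_closed Int_commute)
  show "(\<lambda>F. F \<inter> U) ` topspace (fell_topology euclidean) \<subseteq>
      \<Union>({{F. closedin (top_of_set U) F \<and> F \<inter> G \<noteq> {}} | G. openin (top_of_set U) G} \<union>
        {{F. closedin (top_of_set U) F \<and> F \<inter> K = {}} | K. compactin (top_of_set U) K})"
    using cl topspace_fell_topology[of "top_of_set U"]
    unfolding fell_topology_def[of "top_of_set U"] topology_generated_by_topspace
    by (auto simp: topspace_fell_topology)
  fix B assume "B \<in> {{F. closedin (top_of_set U) F \<and> F \<inter> G \<noteq> {}} | G. openin (top_of_set U) G} \<union>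
        {{F. closedin (top_of_set U) F \<and> F \<inter> K = {}} | K. compactin (top_of_set U) K}"
  then consider G where "openin (top_of_set U) G" "B = {F. closedin (top_of_set U) F \<and> F \<inter> G \<noteq> {}}"
    | K where "compactin (top_of_set U) K" "B = {F. closedin (top_of_set U) F \<and> F \<inter> K = {}}" by auto
  then show "openin (fell_topology euclidean) ((\<lambda>F. F \<inter> U) -` B \<inter> topspace (fell_topology euclidean))"
  proof cases
    case 1
    then have G: "open G" "G \<subseteq> U"
      using assms by (auto simp: openin_open_eq)
    have "(\<lambda>F. F \<inter> U) -` B \<inter> topspace (fell_topology euclidean) = {F. closedin euclidean F \<and> F \<inter> G \<noteq> {}}"
      using cl G(2) 1(2) by (auto simp: topspace_fell_topology)
    also have "openin (fell_topology euclidean) \<dots>"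
      unfolding fell_topology_def using G(1) by (intro topology_generated_by_Basis) auto
    finally show ?thesis .
  next
    case 2
    then have K: "compact K" "K \<subseteq> U"
      by (auto simp: compactin_subtopology)
    have "(\<lambda>F. F \<inter> U) -` B \<inter> topspace (fell_topology euclidean) = {F. closedin euclidean F \<and> F \<inter> K = {}}"
      using cl K(2) 2(2) by (auto simp: topspace_fell_topology)
    also have "openin (fell_topology euclidean) \<dots>"
      unfolding fell_topology_def using K(1) by (intro topology_generated_by_Basis) auto
    finally show ?thesis .
  qed
qed

context random_plans
begin

lemma convergence_over_interior_support:
  "V \<subseteq> Domain T"
  "converges mode M (weak_topology euclidean) \<pi>n \<pi>"
  "converges mode M (fell_topology (top_of_set (V \<times> UNIV))) (\<lambda>n \<omega>. Tn n \<omega> \<inter> V \<times> UNIV) (T \<inter> V \<times> UNIV)"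
  "compact K \<Longrightarrow> K \<subseteq> V \<times> UNIV \<Longrightarrow> T \<inter> K = {} \<Longrightarrow> holds_eventually mode M (\<lambda>n \<omega>. Tn n \<omega> \<inter> K = {})"
  "open G \<Longrightarrow> G \<subseteq> V \<times> UNIV \<Longrightarrow> T \<inter> G \<noteq> {} \<Longrightarrow> holds_eventually mode M (\<lambda>n \<omega>. Tn n \<omega> \<inter> G \<noteq> {})"
proof -
  note lim = admissibleD[OF limit_admissible]
  show "V \<subseteq> Domain T" by (rule V_Domain)
  show "converges mode M (weak_topology euclidean) \<pi>n \<pi>"
  proof (rule transfer_converges[where C = "\<lambda>_. True" and Y = "\<lambda>p t. p"])
    show "\<pi> \<in> topspace (weak_topology euclidean)"
      using lim(5) by (simp add: topspace_weak_topology couplings_def)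
    fix P' Q' \<pi>' T' assume "plan_sequence P Q \<pi> T P' Q' \<pi>' T'"
    then interpret plan_sequence P Q \<pi> T P' Q' \<pi>' T' .
    show "limitin (weak_topology euclidean) \<pi>' \<pi> sequentially"
    proof (rule limitin_weakI)
      show "\<pi>' n \<in> prob_measures euclidean" for n
        using admissibleD(5)[OF seq_admissible] by (simp add: couplings_def)
      show "\<pi> \<in> prob_measures euclidean"
        using lim(5) by (simp add: couplings_def)
      fix f :: "'a \<times> 'a \<Rightarrow> real"
      assume f: "continuous_map euclidean euclideanreal f" "bounded (f ` topspace euclidean)"
      then obtain B where "\<And>x. \<bar>f x\<bar> \<le> B" by (auto simp: bounded_iff)
      then show "(\<lambda>n. integral\<^sup>L (\<pi>' n) f) \<longlonglongrightarrow> integral\<^sup>L \<pi> f"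
        using f(1) by (intro plan_convergence) auto
    qed
  qed (use measurable_plan in auto)
  show "converges mode M (fell_topology (top_of_set (V \<times> UNIV))) (\<lambda>n \<omega>. Tn n \<omega> \<inter> V \<times> UNIV) (T \<inter> V \<times> UNIV)"
  proof (rule transfer_converges[where C = "\<lambda>_. True" and Y = "\<lambda>p t. t \<inter> V \<times> UNIV"])
    show "T \<inter> V \<times> UNIV \<in> topspace (fell_topology (top_of_set (V \<times> UNIV)))"
      using minty_closed[OF lim(7)] by (auto simp: topspace_fell_topology closedin_closed Int_commute)
    show "(\<lambda>\<omega>. Tn n \<omega> \<inter> V \<times> UNIV) \<in> M n \<rightarrow>\<^sub>M borel_of (fell_topology (top_of_set (V \<times> UNIV)))" for n
      by (rule measurable_compose[OF measurable_graph continuous_map_measurable[OF fell_restriction_continuous]])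
        (intro open_Times; simp)
  qed (use plan_sequence.fell_convergence_on_V in auto)
  show "holds_eventually mode M (\<lambda>n \<omega>. Tn n \<omega> \<inter> K = {})" if K: "compact K" "K \<subseteq> V \<times> UNIV" "T \<inter> K = {}"
  proof (rule transfer_eventually[where C = "\<lambda>_. True" and R = "\<lambda>p t. t \<inter> K = {}"])
    show "\<forall>\<^sub>F n in sequentially. T' n \<inter> K = {}" if "plan_sequence P Q \<pi> T P' Q' \<pi>' T'" for P' Q' \<pi>' T'
      using graph_convergence.miss[OF plan_sequence.graph_convergence_on_V[OF that] K] .
  qed (use hit_compact_measurable(2)[OF K(1)] in auto)
  show "holds_eventually mode M (\<lambda>n \<omega>. Tn n \<omega> \<inter> G \<noteq> {})" if G: "open G" "G \<subseteq> V \<times> UNIV" "T \<inter> G \<noteq> {}"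
  proof (rule transfer_eventually[where C = "\<lambda>_. True" and R = "\<lambda>p t. t \<inter> G \<noteq> {}"])
    show "\<forall>\<^sub>F n in sequentially. T' n \<inter> G \<noteq> {}" if "plan_sequence P Q \<pi> T P' Q' \<pi>' T'" for P' Q' \<pi>' T'
      using graph_convergence.hit[OF plan_sequence.graph_convergence_on_V[OF that] G] .
  qed (use hit_open_measurable[OF G(1)] in auto)
qed

lemma T_bounded_on_compact:
  assumes "compact K" "K \<subseteq> V"
  shows "bounded (T `` K)"
proof -
  have "graph_convergence (\<lambda>_. T) T V"
    by unfold_locales (use admissibleD(7)[OF limit_admissible] V_Domain in auto)
  then show ?thesis
    by (rule graph_convergence.limit_bounded_on_compact(1)[OF _ assms])
qed

lemma convergence_on_compact:
  assumes K: "compact K" "K \<subseteq> V"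
  shows "holds_eventually mode M (\<lambda>n \<omega>. K \<subseteq> interior (Domain (Tn n \<omega>)) \<and> compact (Tn n \<omega> `` K))"
    "(\<forall>x\<in>frontier K. single_valued_at T x) \<Longrightarrow>
      converges mode M euclidean (\<lambda>n \<omega>. hausdorff_dist (Tn n \<omega> `` K) (T `` K)) 0"
    "(\<forall>x\<in>K. single_valued_at T x) \<Longrightarrow> converges mode M euclidean (\<lambda>n \<omega>. sup_deviation (Tn n \<omega>) T K) 0"
proof -
  show "holds_eventually mode M (\<lambda>n \<omega>. K \<subseteq> interior (Domain (Tn n \<omega>)) \<and> compact (Tn n \<omega> `` K))"
  proof (rule transfer_eventually[where C = "\<lambda>_. True" and R = "\<lambda>p t. K \<subseteq> interior (Domain t) \<and> compact (t `` K)"])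
    show "\<forall>\<^sub>F n in sequentially. K \<subseteq> interior (Domain (T' n)) \<and> compact (T' n `` K)"
      if "plan_sequence P Q \<pi> T P' Q' \<pi>' T'" for P' Q' \<pi>' T'
      using graph_convergence.eventually_in_interior_Domain[OF plan_sequence.graph_convergence_on_V[OF that] K] .
  qed (use interior_Domain_measurable[OF K(1)] in auto)
  show "converges mode M euclidean (\<lambda>n \<omega>. hausdorff_dist (Tn n \<omega> `` K) (T `` K)) 0"
    if sv: "\<forall>x\<in>frontier K. single_valued_at T x"
  proof (rule transfer_converges[where C = "\<lambda>_. True" and Y = "\<lambda>p t. hausdorff_dist (t `` K) (T `` K)"])
    show "limitin euclidean (\<lambda>n. hausdorff_dist (T' n `` K) (T `` K)) 0 sequentially"
      if "plan_sequence P Q \<pi> T P' Q' \<pi>' T'" for P' Q' \<pi>' T'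
      using graph_convergence.hausdorff_convergence[OF plan_sequence.graph_convergence_on_V[OF that] K] sv by simp
  qed (use hausdorff_measurable[OF K(1)] in \<open>auto simp: borel_of_euclidean\<close>)
  show "converges mode M euclidean (\<lambda>n \<omega>. sup_deviation (Tn n \<omega>) T K) 0"
    if sv: "\<forall>x\<in>K. single_valued_at T x"
  proof (rule transfer_converges[where C = "\<lambda>_. True" and Y = "\<lambda>p t. sup_deviation t T K"])
    show "limitin euclidean (\<lambda>n. sup_deviation (T' n) T K) 0 sequentially"
      if "plan_sequence P Q \<pi> T P' Q' \<pi>' T'" for P' Q' \<pi>' T'
      using graph_convergence.sup_deviation_convergence[OF plan_sequence.graph_convergence_on_V[OF that] K] sv by simp
    \<comment> \<open>The constant family presents \<open>K\<close> as the countable union that the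
      measurability criterion expects.\<close>
    have "(\<lambda>\<omega>. sup_deviation (Tn n \<omega>) T (\<Union>k :: nat. K)) \<in> borel_measurable (M n)" for n
      by (rule sup_deviation_measurable)
        (use minty_closed[OF admissibleD(7)[OF limit_admissible]] K T_bounded_on_compact sv in auto)
    then show "(\<lambda>\<omega>. sup_deviation (Tn n \<omega>) T K) \<in> M n \<rightarrow>\<^sub>M borel_of euclidean" for n
      by (simp add: borel_of_euclidean)
  qed auto
qed

lemma pointwise_convergence_AE:
  assumes W: "W \<in> sets borel" "W \<subseteq> V" "emeasure P W = 1" "\<forall>x\<in>W. single_valued_at T x"
  shows "AE x in P. holds_eventually mode M (\<lambda>n \<omega>. Tn n \<omega> `` {x} \<noteq> {}) \<and>
    converges mode M euclidean (\<lambda>n \<omega>. \<Squnion>y\<in>Tn n \<omega> `` {x}. ennreal (norm (y - val T x))) 0"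
proof -
  note lim = admissibleD[OF limit_admissible]
  interpret prob_space P by (rule lim)
  have "AE x in P. x \<in> W"
    using W(1,3) lim(2) by (intro AE_in_set_eq_1[THEN iffD2]) (simp_all add: emeasure_eq_measure)
  then show ?thesis
  proof eventually_elim
    case (elim x)
    have x: "compact {x}" "{x} \<subseteq> V" using elim W(2) by auto
    have "holds_eventually mode M (\<lambda>n \<omega>. Tn n \<omega> `` {x} \<noteq> {})"
    proof (rule transfer_eventually[where C = "\<lambda>_. True" and R = "\<lambda>p t. t `` {x} \<noteq> {}"])
      show "\<forall>\<^sub>F n in sequentially. T' n `` {x} \<noteq> {}" if "plan_sequence P Q \<pi> T P' Q' \<pi>' T'" for P' Q' \<pi>' T'
        using graph_convergence.eventually_in_interior_Domain[OF plan_sequence.graph_convergence_on_V[OF that] x]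
        by eventually_elim (use interior_subset in blast)
      have "Tn n \<omega> `` {x} \<noteq> {} \<longleftrightarrow> x \<in> Domain (Tn n \<omega>)" for n \<omega> by blast
      then show "{\<omega> \<in> space (M n). Tn n \<omega> `` {x} \<noteq> {}} \<in> sets (completion (M n))" for n
        using in_Domain_measurable[of n x] by simp
    qed simp
    moreover have "converges mode M euclidean (\<lambda>n \<omega>. sup_deviation (Tn n \<omega>) T {x}) 0"
      using convergence_on_compact(3)[OF x] W(4) elim by simp
    ultimately show ?case
      by (simp add: sup_deviation_def)
  qed
qed

end

section \<open>Bounded range\<close>

locale bounded_range_plans = random_plans +
  fixes U :: "'a set"
  assumes bounded_Range: "bounded (Range T)"
    and U: "open U" "U \<subseteq> spt P" "T `` U \<subseteq> interior (Range T)" "Range T \<subseteq> closure (T `` U)"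
    and AE_Range: "\<And>n. AE \<omega> in M n. Range (Tn n \<omega>) \<subseteq> closure (Range T)"
begin

lemma minty_T: "minty T"
  by (rule admissibleD(7)[OF limit_admissible])

text \<open>The range is the domain of the inverse, so its interior is convex; the conditions on
  \<open>U\<close> make this interior dense in the range.\<close>

lemma convex_closure_Range: "convex (closure (Range T))"
proof -
  have "closure (Range T) = closure (interior (Range T))"
  proof
    have "Range T \<subseteq> closure (interior (Range T))"
      using U(4) closure_mono[OF U(3)] by (rule subset_trans)
    then show "closure (Range T) \<subseteq> closure (interior (Range T))"
      by (intro closure_minimal) auto
  qed (intro closure_mono interior_subset)
  then show ?thesis
    using convex_closure[OF minty_Domain_convex_interior[OF minty_converse[OF minty_T]]] by simp
qed

lemma convergence_bounded_range:
  "Domain T = UNIV"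
  "holds_eventually mode M (\<lambda>n \<omega>. Domain (Tn n \<omega>) = UNIV)"
  "converges mode M (fell_topology euclidean) Tn T"
proof -
  show "Domain T = UNIV"
    by (rule minty_bounded_Range_imp_Domain[OF minty_T bounded_Range])
  show "holds_eventually mode M (\<lambda>n \<omega>. Domain (Tn n \<omega>) = UNIV)"
  proof (rule transfer_eventually[where C = "\<lambda>t. Range t \<subseteq> closure (Range T)" and R = "\<lambda>p t. Domain t = UNIV"])
    fix P' Q' \<pi>' T' assume seq: "plan_sequence P Q \<pi> T P' Q' \<pi>' T'" and C: "\<And>n. Range (T' n) \<subseteq> closure (Range T)"
    have "Domain (T' n) = UNIV" for n
      using admissibleD(7)[OF plan_sequence.seq_admissible[OF seq]] bounded_subset[OF bounded_closure[OF bounded_Range] C]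
      by (rule minty_bounded_Range_imp_Domain)
    then show "\<forall>\<^sub>F n in sequentially. Domain (T' n) = UNIV" by simp
  qed (use AE_Range Domain_UNIV_measurable in auto)
  show "converges mode M (fell_topology euclidean) Tn T"
  proof (rule transfer_converges[where C = "\<lambda>t. Range t \<subseteq> closure (Range T)" and Y = "\<lambda>p t. t"])
    fix P' Q' \<pi>' T' assume seq: "plan_sequence P Q \<pi> T P' Q' \<pi>' T'" and C: "\<And>n. Range (T' n) \<subseteq> closure (Range T)"
    show "limitin (fell_topology euclidean) T' T sequentially"
      by (intro kuratowski_limit_fell plan_sequence.graph_convergence_bounded_range[OF seq U C]
          minty_closed minty_T admissibleD(7)[OF plan_sequence.seq_admissible[OF seq]])
  next
    show "T \<in> topspace (fell_topology euclidean)"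
      using minty_closed[OF minty_T] by (simp add: topspace_fell_topology)
  qed (use AE_Range measurable_graph in auto)
qed

lemma uniform_convergence_receding:
  assumes E: "fsigma E" "\<forall>x\<in>closure E. single_valued_at T x"
    and dir: "\<forall>u. norm u = 1 \<and> recedes_in_direction E u \<longrightarrow>
      strictly_convex_in_direction (closure (Range T)) u"
  shows "\<forall>n. (\<lambda>\<omega>. sup_deviation (Tn n \<omega>) T E) \<in> borel_measurable (M n)"
    "converges mode M euclidean (\<lambda>n \<omega>. sup_deviation (Tn n \<omega>) T E) 0"
proof -
  obtain F where F: "\<And>n :: nat. closed (F n)" "E = \<Union>(range F)"
    using E(1) by (auto elim: fsigma.cases)
  \<comment> \<open>Intersecting with balls writes the \<sigma>-closed set \<open>E\<close> as a
    countable union of compact sets.\<close>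
  define K where "K k = (case prod_decode k of (i, j) \<Rightarrow> F i \<inter> cball 0 (real j))" for k
  have K: "compact (K k)" "K k \<subseteq> E" for k
    using F by (auto simp: K_def closed_Int_compact split: prod.splits)
  have "E = (\<Union>k. K k)"
  proof
    show "E \<subseteq> (\<Union>k. K k)"
    proof
      fix x assume "x \<in> E"
      then obtain i where "x \<in> F i" using F(2) by auto
      moreover obtain j where "norm x \<le> real j" using real_arch_simple by blast
      ultimately have "x \<in> K (prod_encode (i, j))" by (simp add: K_def)
      then show "x \<in> (\<Union>k. K k)" by blast
    qed
  qed (use K(2) in blast)
  moreover have "(\<lambda>\<omega>. sup_deviation (Tn n \<omega>) T (\<Union>k. K k)) \<in> borel_measurable (M n)" for n
  proof (rule sup_deviation_measurable[OF minty_closed[OF minty_T] K(1)])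
    show "bounded (T `` K k)" for k
      by (rule bounded_subset[OF bounded_Range]) blast
    show "single_valued_at T x" if "x \<in> K k" for x k
      using that K(2) E(2) closure_subset by blast
  qed
  ultimately show meas: "\<forall>n. (\<lambda>\<omega>. sup_deviation (Tn n \<omega>) T E) \<in> borel_measurable (M n)"
    by simp
  show "converges mode M euclidean (\<lambda>n \<omega>. sup_deviation (Tn n \<omega>) T E) 0"
  proof (rule transfer_converges[where C = "\<lambda>t. Range t \<subseteq> closure (Range T)" and Y = "\<lambda>p t. sup_deviation t T E"])
    fix P' Q' \<pi>' T' assume seq: "plan_sequence P Q \<pi> T P' Q' \<pi>' T'" and C: "\<And>n. Range (T' n) \<subseteq> closure (Range T)"
    have "(\<lambda>n. sup_deviation (T' n) T E) \<longlonglongrightarrow> 0"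
      using admissibleD(7)[OF plan_sequence.seq_admissible[OF seq]] minty_T
        plan_sequence.graph_convergence_bounded_range[OF seq U C] C bounded_Range
      by (rule sup_deviation_convergence_unbounded) (use E(2) dir in blast)+
    then show "limitin euclidean (\<lambda>n. sup_deviation (T' n) T E) 0 sequentially" by simp
  qed (use AE_Range meas in \<open>auto simp: borel_of_euclidean\<close>)
qed

end

theorem theorem1p2:
  fixes P Q :: "'a::euclidean_space measure"
    and \<pi> :: "('a \<times> 'a) measure"
    and T :: "('a \<times> 'a) set"
    and V :: "'a set"
    and mode :: mode
    and M :: "nat \<Rightarrow> 'w measure"
    and Pn Qn :: "nat \<Rightarrow> 'w \<Rightarrow> 'a measure"
    and \<pi>n :: "nat \<Rightarrow> 'w \<Rightarrow> ('a \<times> 'a) measure"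
    and Tn :: "nat \<Rightarrow> 'w \<Rightarrow> ('a \<times> 'a) set"
  assumes "P \<in> prob_measures euclidean" and "Q \<in> prob_measures euclidean"
    and "\<pi> \<in> couplings P Q" and "cyclically_monotone (spt \<pi>)"
    and "\<forall>\<pi>'\<in>couplings P Q. cyclically_monotone (spt \<pi>') \<longrightarrow> \<pi>' = \<pi>"
    and "closed T" and "maximal_cyclically_monotone T" and "spt \<pi> \<subseteq> T"
    and V_def: "V = interior (spt P)" and "V \<noteq> {}"
    and "\<forall>n. prob_space (M n)"
    and "mode = Almost_Surely \<longrightarrow> (\<forall>n. M n = M 0)"
    and "\<forall>n. (\<lambda>\<omega>. (Pn n \<omega>, Qn n \<omega>, \<pi>n n \<omega>, Tn n \<omega>)) \<in>
           M n \<rightarrow>\<^sub>M borel_of (prod_topology (weak_topology euclidean)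
                       (prod_topology (weak_topology euclidean)
                         (prod_topology (weak_topology euclidean) (fell_topology euclidean))))"
    and "\<forall>n. AE \<omega> in M n. \<pi>n n \<omega> \<in> couplings (Pn n \<omega>) (Qn n \<omega>) \<and>
           maximal_cyclically_monotone (Tn n \<omega>) \<and> spt (\<pi>n n \<omega>) \<subseteq> Tn n \<omega>"
    and "converges mode M (weak_topology euclidean) Pn P"
    and "converges mode M (weak_topology euclidean) Qn Q"
  shows
    \<comment> \<open>(a)\<close>
    "(V \<subseteq> Domain T \<and>
      converges mode M (weak_topology euclidean) \<pi>n \<pi> \<and>
      converges mode M (fell_topology (top_of_set (V \<times> UNIV)))
        (\<lambda>n \<omega>. Tn n \<omega> \<inter> (V \<times> UNIV)) (T \<inter> (V \<times> UNIV)) \<and>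
      (\<forall>K. compact K \<and> K \<subseteq> V \<times> UNIV \<and> T \<inter> K = {} \<longrightarrow>
         holds_eventually mode M (\<lambda>n \<omega>. Tn n \<omega> \<inter> K = {})) \<and>
      (\<forall>G. open G \<and> G \<subseteq> V \<times> UNIV \<and> T \<inter> G \<noteq> {} \<longrightarrow>
         holds_eventually mode M (\<lambda>n \<omega>. Tn n \<omega> \<inter> G \<noteq> {}))) \<and>
    \<comment> \<open>(b)\<close>
     (\<forall>K. compact K \<and> K \<subseteq> V \<longrightarrow>
        holds_eventually mode M
          (\<lambda>n \<omega>. K \<subseteq> interior (Domain (Tn n \<omega>)) \<and> compact (Tn n \<omega> `` K)) \<and>
        ((\<forall>x\<in>frontier K. single_valued_at T x) \<longrightarrow>
           converges mode M euclidean (\<lambda>n \<omega>. hausdorff_dist (Tn n \<omega> `` K) (T `` K)) 0) \<and>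
        ((\<forall>x\<in>K. single_valued_at T x) \<longrightarrow>
           converges mode M euclidean (\<lambda>n \<omega>. sup_deviation (Tn n \<omega>) T K) 0)) \<and>
     (\<forall>W. W \<in> sets borel \<and> W \<subseteq> V \<and> emeasure P W = 1 \<and> (\<forall>x\<in>W. single_valued_at T x) \<longrightarrow>
        (AE x in P.
           holds_eventually mode M (\<lambda>n \<omega>. Tn n \<omega> `` {x} \<noteq> {}) \<and>
           converges mode M euclidean
             (\<lambda>n \<omega>. \<Squnion>y\<in>Tn n \<omega> `` {x}. ennreal (norm (y - val T x))) 0)) \<and>
    \<comment> \<open>(c) and (d)\<close>
     (bounded (Range T) \<and>
      (\<exists>U. open U \<and> U \<subseteq> spt P \<and> T `` U \<subseteq> interior (Range T) \<and> Range T \<subseteq> closure (T `` U)) \<and>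
      (\<forall>n. AE \<omega> in M n. Range (Tn n \<omega>) \<subseteq> closure (Range T)) \<longrightarrow>
        (Domain T = UNIV \<and>
         holds_eventually mode M (\<lambda>n \<omega>. Domain (Tn n \<omega>) = UNIV) \<and>
         converges mode M (fell_topology euclidean) Tn T) \<and>
        (convex (closure (Range T)) \<and>
         (\<forall>E. fsigma E \<and> (\<forall>x\<in>closure E. single_valued_at T x) \<and>
            (\<forall>u. norm u = 1 \<and> recedes_in_direction E u \<longrightarrow>
               strictly_convex_in_direction (closure (Range T)) u) \<longrightarrow>
            (\<forall>n. (\<lambda>\<omega>. sup_deviation (Tn n \<omega>) T E) \<in> borel_measurable (M n)) \<and>
            converges mode M euclidean (\<lambda>n \<omega>. sup_deviation (Tn n \<omega>) T E) 0)))"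

proof -
  let ?W = "weak_topology euclidean" and ?F = "fell_topology euclidean"
  note meas = assms(13)
  have "Tn n \<in> M n \<rightarrow>\<^sub>M borel_of ?F" "\<pi>n n \<in> M n \<rightarrow>\<^sub>M borel_of ?W" for n
  proof -
    have "(snd \<circ> snd \<circ> snd) \<in> borel_of (prod_topology ?W (prod_topology ?W (prod_topology ?W ?F))) \<rightarrow>\<^sub>M borel_of ?F"
      "(fst \<circ> snd \<circ> snd) \<in> borel_of (prod_topology ?W (prod_topology ?W (prod_topology ?W ?F))) \<rightarrow>\<^sub>M borel_of ?W"
      by (intro continuous_map_measurable continuous_map_snd continuous_map_fst
          continuous_map_compose[OF continuous_map_snd continuous_map_compose[OF continuous_map_snd]])+
    from measurable_compose[OF meas[rule_format, of n] this(1)] measurable_compose[OF meas[rule_format, of n] this(2)]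
    show "Tn n \<in> M n \<rightarrow>\<^sub>M borel_of ?F" "\<pi>n n \<in> M n \<rightarrow>\<^sub>M borel_of ?W"
      by simp_all
  qed
  note graph_meas = this
  \<comment> \<open>The joint map takes its values in the product of the spaces of probability
    measures, so this holds at every sample point.\<close>
  have space: "Pn n \<omega> \<in> prob_measures euclidean" "Qn n \<omega> \<in> prob_measures euclidean" if "\<omega> \<in> space (M n)" for n \<omega>
    using measurable_space[OF meas[rule_format, of n] that] by (simp_all add: topspace_weak_topology)
  have adm: "AE \<omega> in M n. admissible (Pn n \<omega>) (Qn n \<omega>) (\<pi>n n \<omega>) (Tn n \<omega>)" for n
    using assms(14)[rule_format, of n] AE_space
    by eventually_elim (use space in \<open>auto simp: admissible_def\<close>)
  interpret random_plans P Q \<pi> T mode M Pn Qn \<pi>n Tn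
  proof (intro random_plans.intro stable_plan.intro random_plans_axioms.intro)
    show "admissible P Q \<pi> T"
      using assms(1,2,3,7,8) by (simp add: admissible_def)
    show "\<pi>' = \<pi>" if "\<pi>' \<in> couplings P Q" "cyclically_monotone (spt \<pi>')" for \<pi>'
      using assms(5) that by blast
    show "prob_space (M n)" for n
      using assms(11) by (rule spec)
    show "M n = M 0" if "mode = Almost_Surely" for n
      using assms(12)[rule_format, OF that] .
  qed (rule graph_meas adm assms(15,16))+
  have d: "(Domain T = UNIV \<and>
         holds_eventually mode M (\<lambda>n \<omega>. Domain (Tn n \<omega>) = UNIV) \<and>
         converges mode M (fell_topology euclidean) Tn T) \<and>
        (convex (closure (Range T)) \<and>
         (\<forall>E. fsigma E \<and> (\<forall>x\<in>closure E. single_valued_at T x) \<and>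
            (\<forall>u. norm u = 1 \<and> recedes_in_direction E u \<longrightarrow>
               strictly_convex_in_direction (closure (Range T)) u) \<longrightarrow>
            (\<forall>n. (\<lambda>\<omega>. sup_deviation (Tn n \<omega>) T E) \<in> borel_measurable (M n)) \<and>
            converges mode M euclidean (\<lambda>n \<omega>. sup_deviation (Tn n \<omega>) T E) 0))"
    if "bounded (Range T)" "open U" "U \<subseteq> spt P" "T `` U \<subseteq> interior (Range T)" "Range T \<subseteq> closure (T `` U)"
      "\<forall>n. AE \<omega> in M n. Range (Tn n \<omega>) \<subseteq> closure (Range T)" for U
  proof -
    interpret bounded_range_plans P Q \<pi> T mode M Pn Qn \<pi>n Tn U
      by unfold_locales (rule that(1-5) that(6)[rule_format])+
    show ?thesis
      by (intro conjI convergence_bounded_range convex_closure_Range)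
        (rule allI, rule impI, elim conjE, rule conjI; rule uniform_convergence_receding; assumption)
  qed
  show ?thesis
    unfolding V_def
  proof (intro conjI)
    show "\<forall>K. compact K \<and> K \<subseteq> interior (spt P) \<times> UNIV \<and> T \<inter> K = {} \<longrightarrow>
         holds_eventually mode M (\<lambda>n \<omega>. Tn n \<omega> \<inter> K = {})"
      by (intro allI impI, elim conjE) (rule convergence_over_interior_support(4))
    show "\<forall>G. open G \<and> G \<subseteq> interior (spt P) \<times> UNIV \<and> T \<inter> G \<noteq> {} \<longrightarrow>
         holds_eventually mode M (\<lambda>n \<omega>. Tn n \<omega> \<inter> G \<noteq> {})"
      by (intro allI impI, elim conjE) (rule convergence_over_interior_support(5))
    show "\<forall>K. compact K \<and> K \<subseteq> interior (spt P) \<longrightarrow>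
        holds_eventually mode M
          (\<lambda>n \<omega>. K \<subseteq> interior (Domain (Tn n \<omega>)) \<and> compact (Tn n \<omega> `` K)) \<and>
        ((\<forall>x\<in>frontier K. single_valued_at T x) \<longrightarrow>
           converges mode M euclidean (\<lambda>n \<omega>. hausdorff_dist (Tn n \<omega> `` K) (T `` K)) 0) \<and>
        ((\<forall>x\<in>K. single_valued_at T x) \<longrightarrow>
           converges mode M euclidean (\<lambda>n \<omega>. sup_deviation (Tn n \<omega>) T K) 0)"
      by (intro allI impI, elim conjE, intro conjI impI convergence_on_compact; assumption)
    show "\<forall>W. W \<in> sets borel \<and> W \<subseteq> interior (spt P) \<and> emeasure P W = 1 \<and> (\<forall>x\<in>W. single_valued_at T x) \<longrightarrow>
        (AE x in P.
           holds_eventually mode M (\<lambda>n \<omega>. Tn n \<omega> `` {x} \<noteq> {}) \<and>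
           converges mode M euclidean
             (\<lambda>n \<omega>. \<Squnion>y\<in>Tn n \<omega> `` {x}. ennreal (norm (y - val T x))) 0)"
      by (intro allI impI, elim conjE) (rule pointwise_convergence_AE)
  qed (rule convergence_over_interior_support(1-3) | (rule impI, elim conjE exE, rule d; assumption))+
qed

end
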